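(* Let $n\ge 1$ and let $\Psi$ be a logarithmic growth function, and suppose that there exists a real number $\eta<1/2$ such that, with $\Phi(x)=x\Psi'(x)$, $$\Phi''(t)=O\big(t^{-\frac12}[\Phi'(t)]^{1+\eta}\big)\quad\text{when } t\to\infty .$$ Then, uniformly in $\xi\in\mathbb{C}^n$, $$\beta^2(z,\xi)=(1+o(1))\left(|\xi|^2\Psi'(|z|^2)+|\langle z,\xi\rangle|^2\,\Psi''(|z|^2)\right)\quad\text{when } |z|\to\infty .$$
   Context: A logarithmic growth function is a $C^3$-function $\Psi:[0,+\infty)\to[0,+\infty)$ with $\Psi'(x)>0$, $\Psi''(x)\ge 0$, $\Psi'''(x)\ge 0$ for all $x$. Notation: $\langle z,w\rangle=\sum_j z_j\overline{w_j}$ on $\mathbb{C}^n$; $dV$ is Lebesgue measure on $\mathbb{C}^n$; $d\mu_\Psi(z)=e^{-\Psi(|z|^2)}dV(z)$. The Fock space $\mathcal{A}^2(\Psi)$ is the closure of the holomorphic polynomials in $L^2(\mu_\Psi)$; it is a reproducing kernel Hilbert space of entire functions, with reproducing kernel $K_\Psi(z,w)$. The Bergman metric is $\beta^2(z,\xi)=\sum_{j,k=1}^n\frac{\partial^2\log K_\Psi(z,z)}{\partial z_j\partial\bar z_k}\xi_j\bar\xi_k$ for $z,\xi\in\mathbb{C}^n$. *)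

theory Defs
  imports "HOL-Analysis.Analysis" "HOL-Library.Landau_Symbols"
begin

text \<open>Derivative of a function on \<open>[0,\<infinity>)\<close>; one-sided at \<open>0\<close>, and insensitive to the values of
  \<open>f\<close> on negative reals.\<close>

definition hderiv :: "(real \<Rightarrow> real) \<Rightarrow> real \<Rightarrow> real" where
  "hderiv f x = vector_derivative f (at x within {0..})"

definition log_growth :: "(real \<Rightarrow> real) \<Rightarrow> bool" where
  "log_growth \<Psi> \<longleftrightarrow>
     \<Psi> differentiable_on {0..} \<and>
     hderiv \<Psi> differentiable_on {0..} \<and>
     hderiv (hderiv \<Psi>) differentiable_on {0..} \<and>
     continuous_on {0..} (hderiv (hderiv (hderiv \<Psi>))) \<and>
     (\<forall>x\<ge>0. \<Psi> x \<ge> 0 \<and> hderiv \<Psi> x > 0 \<and> hderiv (hderiv \<Psi>) x \<ge> 0 \<and>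
            hderiv (hderiv (hderiv \<Psi>)) x \<ge> 0)"

definition herm :: "complex ^ 'n \<Rightarrow> complex ^ 'n \<Rightarrow> complex" where
  "herm z w = (\<Sum>j\<in>UNIV. z $ j * cnj (w $ j))"

definition fock_measure :: "(real \<Rightarrow> real) \<Rightarrow> (complex ^ 'n) measure" where
  "fock_measure \<Psi> = density lborel (\<lambda>z. ennreal (exp (- \<Psi> ((norm z)\<^sup>2))))"

definition holo_polys :: "(complex ^ 'n \<Rightarrow> complex) set" where
  "holo_polys = {p. \<exists>(A :: ('n \<Rightarrow> nat) set) c. finite A \<and>
      p = (\<lambda>z. \<Sum>\<alpha>\<in>A. c \<alpha> * (\<Prod>j\<in>UNIV. (z $ j) ^ \<alpha> j))}"

definition entire :: "(complex ^ 'n \<Rightarrow> complex) \<Rightarrow> bool" where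
  "entire f \<longleftrightarrow> (\<forall>z. \<exists>D. (f has_derivative D) (at z) \<and> (\<forall>c v. D (c *s v) = c * D v))"

text \<open>The \<open>L\<^sup>2\<close>-closure of the polynomials consists of classes modulo null sets, each containing
  exactly one entire function; the space is realised by these entire representatives.\<close>

definition fock_space :: "(real \<Rightarrow> real) \<Rightarrow> (complex ^ 'n \<Rightarrow> complex) set" where
  "fock_space \<Psi> = {f. entire f \<and>
      f \<in> borel_measurable (fock_measure \<Psi>) \<and>
      integrable (fock_measure \<Psi>) (\<lambda>z. (cmod (f z))\<^sup>2) \<and>
      (\<forall>\<epsilon>>0. \<exists>p\<in>holo_polys. (\<integral>z. (cmod (f z - p z))\<^sup>2 \<partial>fock_measure \<Psi>) < \<epsilon>)}"

definition is_reproducing_kernel ::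
    "(real \<Rightarrow> real) \<Rightarrow> (complex ^ 'n \<Rightarrow> complex ^ 'n \<Rightarrow> complex) \<Rightarrow> bool" where
  "is_reproducing_kernel \<Psi> K \<longleftrightarrow>
     (\<forall>w. (\<lambda>z. K z w) \<in> fock_space \<Psi> \<and>
          (\<forall>f\<in>fock_space \<Psi>. f w = (\<integral>z. f z * cnj (K z w) \<partial>fock_measure \<Psi>)))"

definition fock_kernel :: "(real \<Rightarrow> real) \<Rightarrow> complex ^ 'n \<Rightarrow> complex ^ 'n \<Rightarrow> complex" where
  "fock_kernel \<Psi> = (THE K. is_reproducing_kernel \<Psi> K)"

definition dir_deriv :: "(complex ^ 'n \<Rightarrow> complex) \<Rightarrow> complex ^ 'n \<Rightarrow> complex ^ 'n \<Rightarrow> complex" where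
  "dir_deriv f v z = vector_derivative (\<lambda>t::real. f (z + t *\<^sub>R v)) (at 0)"

text \<open>The Wirtinger operators \<open>\<partial>/\<partial>z\<^sub>j = (\<partial>/\<partial>x\<^sub>j - \<i> \<partial>/\<partial>y\<^sub>j)/2\<close> and
  \<open>\<partial>/\<partial>cnj z\<^sub>j = (\<partial>/\<partial>x\<^sub>j + \<i> \<partial>/\<partial>y\<^sub>j)/2\<close>.\<close>

definition wirt :: "'n \<Rightarrow> (complex ^ 'n \<Rightarrow> complex) \<Rightarrow> complex ^ 'n \<Rightarrow> complex" where
  "wirt j f z = (dir_deriv f (axis j 1) z - \<i> * dir_deriv f (axis j \<i>) z) / 2"

definition wirt_bar :: "'n \<Rightarrow> (complex ^ 'n \<Rightarrow> complex) \<Rightarrow> complex ^ 'n \<Rightarrow> complex" where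
  "wirt_bar j f z = (dir_deriv f (axis j 1) z + \<i> * dir_deriv f (axis j \<i>) z) / 2"

text \<open>Here \<open>ln\<close> is the principal branch; the values \<open>K(z,z)\<close> are positive reals.\<close>

definition bergman_metric_sq :: "(real \<Rightarrow> real) \<Rightarrow> complex ^ 'n \<Rightarrow> complex ^ 'n \<Rightarrow> complex" where
  "bergman_metric_sq \<Psi> z \<xi> =
     (\<Sum>j\<in>UNIV. \<Sum>k\<in>UNIV.
        wirt j (wirt_bar k (\<lambda>u. ln (fock_kernel \<Psi> u u))) z * \<xi> $ j * cnj (\<xi> $ k))"

end

theory Submission
  imports Defs "HOL-Probability.Probability" "HOL-Real_Asymp.Real_Asymp"
begin

text \<open>
  Write \<open>n\<close> for the dimension, \<open>\<phi> = \<Phi>'\<close>, \<open>s\<^sub>k = \<integral> t\<^sup>k e\<^bsup>-\<Psi>(t)\<^esup> dt\<close> over \<open>[0,\<infinity>)\<close>, \<open>m\<^sub>k = s\<^sub>k\<^sub>+\<^sub>1 / s\<^sub>k\<close>.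
  Integration by parts and scaling show that, up to a constant factor, \<open>K(z,z) = F(|z|\<^sup>2)\<close> with
  \<open>F(x) = \<Sum> b\<^sub>d x\<^sup>d\<close> and \<open>b\<^sub>d = (d+n-1)! / (d! s\<^sub>d\<^sub>+\<^sub>n\<^sub>-\<^sub>1)\<close>. The metric is therefore
  \<open>|\<xi>|\<^sup>2 L'(|z|\<^sup>2) + |\<langle>z,\<xi>\<rangle>|\<^sup>2 L''(|z|\<^sup>2)\<close> with \<open>L = log F\<close>, and \<open>x L'(x)\<close> and \<open>x (L'(x) + x L''(x))\<close> are the
  mean and the variance of \<open>d\<close> under the weights \<open>b\<^sub>d x\<^sup>d / F(x)\<close>. Splitting \<open>\<xi>\<close> into its components along
  \<open>z\<close> and orthogonal to it, one has to show that the mean is \<open>\<sim> \<Phi>(x)\<close> and the variance is \<open>\<sim> x \<phi>(x)\<close>.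

  Both follow from Stein-type identities. Under the weights, \<open>\<rho>\<^sub>d = b\<^sub>d\<^sub>-\<^sub>1 / b\<^sub>d\<close> satisfies
  \<open>E[q(d) \<rho>\<^sub>d] = x E[q(d+1)]\<close>; under the density \<open>t\<^sup>k e\<^bsup>-\<Psi>(t)\<^esup> / s\<^sub>k\<close>, which has mean \<open>m\<^sub>k\<close>, one has
  \<open>E[q(t) (\<Phi>(t) - (k+1))] = E[t q'(t)]\<close>. Taking \<open>q\<close> of degree \<open>0\<close>, \<open>1\<close> and \<open>3\<close> yields the first two moments as
  soon as \<open>\<rho>\<close>, respectively \<open>\<Phi>\<close>, is nearly affine on windows of a large multiple of the expected width; the
  monotonicity of \<open>\<rho>\<close> and \<open>\<Phi>\<close> takes care of the tails. For \<open>\<Phi>\<close> this is the hypothesis on \<open>\<Phi>''\<close>, which makes the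
  derivative of \<open>\<phi>\<^bsup>-1/2\<^esup>\<close> small; it gives \<open>m\<^sub>k = \<Phi>\<^sup>-\<^sup>1(k+1)\<close> up to a small fraction of the width, and hence the
  required statement about \<open>\<rho>\<^sub>d = d / (d+n-1) \<cdot> m\<^sub>d\<^sub>+\<^sub>n\<^sub>-\<^sub>2\<close>.
\<close>

section \<open>Moments of nearly proportional random variables\<close>

text \<open>One comparison, \<open>near_linear_moments\<close>, serves twice: for the continuous
  moment densities and for the discrete weights. There X is the centred variable divided by its
  width, and Y is the companion \<Phi>(t) - (k+1), respectively \<rho> - x, divided by its own
  scale. Closeness of Y to X is available only for |X| \<le> R; beyond that, monotonicity gives just
  |Y| \<ge> R/2. The product X Y does not control X^2 there, whereas X^3 Y exceeds it by a factor
  R^2/2, which is why a test function of degree 3 is needed. Its expectation is known only up to a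
  multiple of 1 + E[X^2], so the estimate is self-referential; it closes because the tail carries
  the factor 1/R^2. On the kernel side no spherical coordinates occur. The integral of a homogeneous
  function against a radial weight is a one-dimensional constant times its integral over the unit
  ball, and the latter is the same for all weights. It is read off from the Gaussian weight, where
  integration by parts evaluates every pairing exactly.\<close>

lemma cube_mult_near_self:
  fixes x y :: real
  assumes "\<bar>y - x\<bar> \<le> 1"
  shows "x ^ 3 * y + 1 \<ge> 0"
proof -
  define z where "z = y - x"
  have z: "\<bar>z\<bar> \<le> 1" using assms by (simp add: z_def)
  have "x ^ 3 * y + 1 = x ^ 4 + x ^ 3 * z + 1"
    by (simp add: z_def algebra_simps power3_eq_cube power4_eq_xxxx)
  moreover have "x ^ 4 + x ^ 3 * z + 1 \<ge> 0"
  proof (cases "\<bar>x\<bar> \<le> 1")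
    case True
    have "\<bar>x ^ 3 * z\<bar> \<le> 1 * 1" unfolding abs_mult power_abs
      using True z by (intro mult_mono power_le_one) auto
    moreover have "x ^ 4 \<ge> 0" by simp
    ultimately show ?thesis by linarith
  next
    case False
    have "\<bar>x ^ 3 * z\<bar> \<le> \<bar>x\<bar> ^ 3 * \<bar>x\<bar>" unfolding abs_mult power_abs
      using False z by (intro mult_mono) auto
    also have "\<dots> = x ^ 4" by (simp add: power3_eq_cube power4_eq_xxxx abs_if)
    finally show ?thesis by linarith
  qed
  ultimately show ?thesis by simp
qed

text \<open>If Y were equal to X, then E[X Y] = 1 would be the variance and E[Y] = 0 the mean; the
  errors come from the inner discrepancy \<epsilon> and from the tail. The bounds on E[X Y] and
  E[X^3 Y] contain 1 + E[X^2] because no a priori bound on the second moment is at hand when they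
  are derived.\<close>

lemma (in prob_space) near_linear_moments:
  fixes X Y :: "'a \<Rightarrow> real"
  assumes R: "R \<ge> 10" and eps: "0 < \<epsilon>" "\<epsilon> \<le> 1/8"
    and intX: "integrable M X" and intY: "integrable M Y"
    and intXX: "integrable M (\<lambda>\<omega>. (X \<omega>)\<^sup>2)" and intXY: "integrable M (\<lambda>\<omega>. X \<omega> * Y \<omega>)"
    and intX3Y: "integrable M (\<lambda>\<omega>. X \<omega> ^ 3 * Y \<omega>)"
    and EY: "expectation Y = 0"
    and EXY: "\<bar>expectation (\<lambda>\<omega>. X \<omega> * Y \<omega>) - 1\<bar> \<le> \<epsilon> * (1 + expectation (\<lambda>\<omega>. (X \<omega>)\<^sup>2))"
    and EX3Y: "expectation (\<lambda>\<omega>. X \<omega> ^ 3 * Y \<omega>) \<le> 10 * (1 + expectation (\<lambda>\<omega>. (X \<omega>)\<^sup>2))"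
    and inner: "\<And>\<omega>. \<omega> \<in> space M \<Longrightarrow> \<bar>X \<omega>\<bar> \<le> R \<Longrightarrow> \<bar>Y \<omega> - X \<omega>\<bar> \<le> \<epsilon>"
    and right: "\<And>\<omega>. \<omega> \<in> space M \<Longrightarrow> X \<omega> > R \<Longrightarrow> Y \<omega> \<ge> R / 2"
    and left: "\<And>\<omega>. \<omega> \<in> space M \<Longrightarrow> X \<omega> < - R \<Longrightarrow> Y \<omega> \<le> - R / 2"
  shows "\<bar>expectation (\<lambda>\<omega>. (X \<omega>)\<^sup>2) - 1\<bar> \<le> 8 * \<epsilon> + 88 / R\<^sup>2"
    and "\<bar>expectation X\<bar> \<le> 8 * \<epsilon> + 88 / R\<^sup>2"
proof -
  define S where "S = expectation (\<lambda>\<omega>. (X \<omega>)\<^sup>2)"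
  \<comment> \<open>The summand 1 makes Z nonnegative also for |X| \<le> R, by
    \<open>cube_mult_near_self\<close>. A tail bound by a multiple of Z may therefore be added on
    the whole space, and no integral has to be split.\<close>
  define Z where "Z \<omega> = X \<omega> ^ 3 * Y \<omega> + 1" for \<omega>
  define T where "T = expectation Z"
  define P where "P = expectation (\<lambda>\<omega>. X \<omega> * Y \<omega>)"
  have intZ: "integrable M Z" unfolding Z_def using intX3Y by simp
  have S0: "S \<ge> 0" unfolding S_def by simp
  have "T = expectation (\<lambda>\<omega>. X \<omega> ^ 3 * Y \<omega>) + 1"
    using intX3Y by (simp add: T_def Z_def[abs_def] prob_space)
  then have T_le: "T \<le> 11 * (1 + S)"
    using order_trans[OF add_right_mono[OF EX3Y[folded S_def], of 1]] S0 by simp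
  have outer: "\<bar>X \<omega>\<bar> ^ 3 * \<bar>Y \<omega>\<bar> = X \<omega> ^ 3 * Y \<omega>" "\<bar>X \<omega>\<bar> * \<bar>Y \<omega>\<bar> = X \<omega> * Y \<omega>" "\<bar>Y \<omega>\<bar> \<ge> R / 2"
    if w: "\<omega> \<in> space M" "\<bar>X \<omega>\<bar> > R" for \<omega>
  proof -
    consider "X \<omega> > R" "Y \<omega> \<ge> R / 2" | "X \<omega> < - R" "Y \<omega> \<le> - R / 2"
    proof -
      have "X \<omega> > R \<or> X \<omega> < - R" using w(2) by (auto simp: abs_if split: if_splits)
      then show thesis using that right[OF w(1)] left[OF w(1)] by blast
    qed
    then show "\<bar>X \<omega>\<bar> ^ 3 * \<bar>Y \<omega>\<bar> = X \<omega> ^ 3 * Y \<omega>" "\<bar>X \<omega>\<bar> * \<bar>Y \<omega>\<bar> = X \<omega> * Y \<omega>" "\<bar>Y \<omega>\<bar> \<ge> R / 2"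
      using R by (cases; simp add: abs_if power3_eq_cube)+
  qed
  have cube: "\<bar>X \<omega>\<bar> ^ 3 * \<bar>Y \<omega>\<bar> = \<bar>X \<omega>\<bar> * \<bar>X \<omega>\<bar> * (\<bar>X \<omega>\<bar> * \<bar>Y \<omega>\<bar>)" for \<omega>
    by (simp add: power3_eq_cube mult_ac)
  have Z0: "Z \<omega> \<ge> 0" if w: "\<omega> \<in> space M" for \<omega>
  proof (cases "\<bar>X \<omega>\<bar> \<le> R")
    case True
    then show ?thesis using inner[OF w True] eps cube_mult_near_self[of "Y \<omega>" "X \<omega>"] by (simp add: Z_def)
  next
    case False
    then show ?thesis using outer(1)[OF w] unfolding Z_def by (smt (verit) zero_le_mult_iff zero_le_power abs_ge_zero)
  qed
  have sq: "2 * \<bar>X \<omega>\<bar> \<le> 1 + (X \<omega>)\<^sup>2" for \<omega>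
    using sum_squares_bound[of 1 "\<bar>X \<omega>\<bar>"] by simp
  \<comment> \<open>Factors |X| \<ge> R and |Y| \<ge> R/2 of X^3 Y are traded for powers of R: two
    against X Y and X^2, three against X and Y.\<close>
  have outZ: "R\<^sup>2 * (X \<omega> * Y \<omega>) \<le> Z \<omega>" "R\<^sup>2 * (X \<omega>)\<^sup>2 \<le> 2 * Z \<omega>" "R ^ 3 * \<bar>Y \<omega>\<bar> \<le> Z \<omega>" 
     "R ^ 3 * \<bar>X \<omega>\<bar> \<le> 2 * Z \<omega>" "X \<omega> * Y \<omega> \<ge> 0"
    if w: "\<omega> \<in> space M" "\<bar>X \<omega>\<bar> > R" for \<omega>
  proof -
    define x y where "x = \<bar>X \<omega>\<bar>" and "y = \<bar>Y \<omega>\<bar>"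
    have xy: "x \<ge> R" "y \<ge> R / 2" "R > 0" using w outer(3)[OF w] R by (auto simp: x_def y_def)
    have z: "Z \<omega> = x ^ 3 * y + 1" using outer(1)[OF w] by (simp add: Z_def x_def y_def)
    have "R\<^sup>2 * (x * y) \<le> x\<^sup>2 * (x * y)" using xy by (intro mult_right_mono power_mono) auto
    then show "R\<^sup>2 * (X \<omega> * Y \<omega>) \<le> Z \<omega>"
      using z outer(2)[OF w] by (simp add: x_def y_def power2_eq_square power3_eq_cube mult_ac)
    have "R * (R/2) * x\<^sup>2 \<le> x * y * x\<^sup>2" using xy by (intro mult_right_mono mult_mono) auto
    then show "R\<^sup>2 * (X \<omega>)\<^sup>2 \<le> 2 * Z \<omega>"
      using z by (simp add: x_def y_def power2_eq_square power3_eq_cube mult_ac)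
    have "R ^ 3 * y \<le> x ^ 3 * y" using xy by (intro mult_right_mono power_mono) auto
    then show "R ^ 3 * \<bar>Y \<omega>\<bar> \<le> Z \<omega>" using z by (simp add: y_def[symmetric])
    have "(R * R * (R/2)) * x \<le> (x * x * y) * x" using xy by (intro mult_right_mono mult_mono) auto
    then show "R ^ 3 * \<bar>X \<omega>\<bar> \<le> 2 * Z \<omega>"
      using z by (simp add: x_def[symmetric] power3_eq_cube mult_ac)
    show "X \<omega> * Y \<omega> \<ge> 0" using outer(2)[OF w] by (smt (verit) mult_nonneg_nonneg abs_ge_zero)
  qed
  have dif: "\<bar>(X \<omega>)\<^sup>2 - X \<omega> * Y \<omega>\<bar> \<le> \<epsilon> * (1 + (X \<omega>)\<^sup>2)" if w: "\<omega> \<in> space M" "\<bar>X \<omega>\<bar> \<le> R" for \<omega>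
  proof -
    have "\<bar>(X \<omega>)\<^sup>2 - X \<omega> * Y \<omega>\<bar> = \<bar>Y \<omega> - X \<omega>\<bar> * \<bar>X \<omega>\<bar>"
      by (simp add: abs_mult[symmetric] power2_eq_square algebra_simps abs_minus_commute)
    also have "\<dots> \<le> \<epsilon> * (1 + (X \<omega>)\<^sup>2)"
      using inner[OF w] sq[of \<omega>] eps by (intro mult_mono) auto
    finally show ?thesis .
  qed
  have p1: "(X \<omega>)\<^sup>2 \<le> X \<omega> * Y \<omega> + \<epsilon> * (1 + (X \<omega>)\<^sup>2) + (2 / R\<^sup>2) * Z \<omega>" if w: "\<omega> \<in> space M" for \<omega>
  proof (cases "\<bar>X \<omega>\<bar> \<le> R")
    case True
    then show ?thesis using dif[OF w] Z0[OF w] R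
      by (smt (verit) zero_le_mult_iff zero_le_divide_iff zero_le_power2)
  next
    case False
    then have "(X \<omega>)\<^sup>2 \<le> (2 / R\<^sup>2) * Z \<omega>" using outZ(2)[OF w] R by (simp add: field_simps)
    then show ?thesis using outZ(5)[OF w] False eps by (smt (verit) zero_le_mult_iff zero_le_power2)
  qed
  have p2: "X \<omega> * Y \<omega> \<le> (X \<omega>)\<^sup>2 + \<epsilon> * (1 + (X \<omega>)\<^sup>2) + (1 / R\<^sup>2) * Z \<omega>" if w: "\<omega> \<in> space M" for \<omega>
  proof (cases "\<bar>X \<omega>\<bar> \<le> R")
    case True
    then show ?thesis using dif[OF w] Z0[OF w] R
      by (smt (verit) zero_le_mult_iff zero_le_divide_iff zero_le_power2)
  next
    case False
    then have "X \<omega> * Y \<omega> \<le> (1 / R\<^sup>2) * Z \<omega>" using outZ(1)[OF w] R by (simp add: field_simps)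
    then show ?thesis using eps by (smt (verit) zero_le_mult_iff zero_le_power2)
  qed
  have p3: "\<bar>X \<omega> - Y \<omega>\<bar> \<le> \<epsilon> + (3 / R ^ 3) * Z \<omega>" if w: "\<omega> \<in> space M" for \<omega>
  proof (cases "\<bar>X \<omega>\<bar> \<le> R")
    case True
    then show ?thesis using inner[OF w True] Z0[OF w] R
      by (smt (verit) zero_le_mult_iff zero_le_divide_iff zero_le_power)
  next
    case False
    have "R ^ 3 * \<bar>X \<omega> - Y \<omega>\<bar> \<le> R ^ 3 * \<bar>X \<omega>\<bar> + R ^ 3 * \<bar>Y \<omega>\<bar>"
      using R by (simp flip: distrib_left)
    also have "\<dots> \<le> 3 * Z \<omega>" using outZ(3,4)[OF w] False by simp
    finally have "\<bar>X \<omega> - Y \<omega>\<bar> \<le> (3 / R ^ 3) * Z \<omega>" using R by (simp add: field_simps)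
    then show ?thesis using eps by simp
  qed
  have i1: "S \<le> P + \<epsilon> * (1 + S) + (2 / R\<^sup>2) * T"
    using integral_mono[OF intXX _ p1] intXX intXY intZ by (simp add: S_def P_def T_def prob_space)
  have i2: "P \<le> S + \<epsilon> * (1 + S) + (1 / R\<^sup>2) * T"
    using integral_mono[OF intXY _ p2] intXX intXY intZ by (simp add: S_def P_def T_def prob_space)
  have "\<bar>expectation (\<lambda>\<omega>. X \<omega> - Y \<omega>)\<bar> \<le> expectation (\<lambda>\<omega>. \<bar>X \<omega> - Y \<omega>\<bar>)"
    by (rule integral_abs_bound)
  also have "\<dots> \<le> expectation (\<lambda>\<omega>. \<epsilon> + (3 / R ^ 3) * Z \<omega>)"
    by (rule integral_mono[OF _ _ p3]) (use intX intY intZ in auto)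
  finally have "\<bar>expectation (\<lambda>\<omega>. X \<omega> - Y \<omega>)\<bar> \<le> expectation (\<lambda>\<omega>. \<epsilon> + (3 / R ^ 3) * Z \<omega>)" .
  then have i3: "\<bar>expectation X\<bar> \<le> \<epsilon> + (3 / R ^ 3) * T"
    using intX intY intZ EY by (simp add: T_def prob_space)
  have PB: "\<bar>P - 1\<bar> \<le> \<epsilon> * (1 + S)" using EXY by (simp add: P_def S_def)
  \<comment> \<open>22 = 2 * 11: by \<open>T_le\<close> the tail term (2 / R^2) T is at most
    \<theta> (1 + S). As 2\<epsilon> + \<theta> \<le> 1/2, the unknown S can be absorbed, which
    yields S \<le> 3; reinserting this bound gives the error 4 (2\<epsilon> + \<theta>) =
    8\<epsilon> + 88/R^2.\<close>
  define \<theta> where "\<theta> = 22 / R\<^sup>2"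
  have R2: "R\<^sup>2 \<ge> 100" using power_mono[of 10 R 2] R by simp
  have th: "\<theta> \<ge> 0" "\<theta> \<le> 1/4" unfolding \<theta>_def using frac_le[of 22 22 100 "R\<^sup>2"] R2 by auto
  have T1: "(1 / R\<^sup>2) * T \<le> \<theta> / 2 * (1 + S)" 
    using mult_left_mono[OF T_le, of "1 / R\<^sup>2"] by (simp add: \<theta>_def)
  have k1: "S - 1 \<le> (2 * \<epsilon> + \<theta>) * (1 + S)" using i1 PB T1 by (simp add: algebra_simps)
  have "\<theta> / 2 * (1 + S) \<ge> 0" using th S0 by simp
  moreover have "(2 * \<epsilon> + \<theta>) * (1 + S) = 2 * (\<epsilon> * (1 + S)) + 2 * (\<theta> / 2 * (1 + S))"
    by (simp add: algebra_simps)
  ultimately have k2: "1 - S \<le> (2 * \<epsilon> + \<theta>) * (1 + S)" using i2 PB T1 by linarith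
  have "(2 * \<epsilon> + \<theta>) * (1 + S) \<le> 1 / 2 * (1 + S)" using eps th S0 by (intro mult_right_mono) auto
  then have S3: "S \<le> 3" using k1 by simp
  have "(2 * \<epsilon> + \<theta>) * (1 + S) \<le> (2 * \<epsilon> + \<theta>) * 4" using eps th S3 by (intro mult_left_mono) auto
  then show "\<bar>expectation (\<lambda>\<omega>. (X \<omega>)\<^sup>2) - 1\<bar> \<le> 8 * \<epsilon> + 88 / R\<^sup>2"
    using k1 k2 by (simp add: S_def[symmetric] \<theta>_def)
  have "(3 / R ^ 3) * T \<le> (3 / R ^ 3) * 44" using T_le S3 R by (intro mult_left_mono) auto
  also have "\<dots> = (132 / R) * (1 / R\<^sup>2)" by (simp add: power2_eq_square power3_eq_cube)
  also have "\<dots> \<le> 88 * (1 / R\<^sup>2)" using R by (intro mult_right_mono) (auto simp: field_simps)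
  finally show "\<bar>expectation X\<bar> \<le> 8 * \<epsilon> + 88 / R\<^sup>2" using i3 eps by simp
qed

section \<open>Moments of the weight\<close>

text \<open>Two-sided derivatives on the whole line spare all one-sided arguments at 0; the given
  function is extended to negative reals for this, and \<open>wt\<close> cuts the extension off
  again. The constant c is \<Psi>'(0) in the application, and the linear growth it forces makes all
  moments finite. Only first-order data occur, so \<Psi>(x) = x is an instance.\<close>

locale radial_weight =
  fixes \<Psi> \<psi> :: "real \<Rightarrow> real" and c :: real
  assumes deriv: "(\<Psi> has_real_derivative \<psi> x) (at x)"
    and cont: "continuous_on UNIV \<psi>"
    and c_pos: "c > 0" and lower: "c \<le> \<psi> x" and nonneg: "0 \<le> \<Psi> 0"
begin

definition wt :: "real \<Rightarrow> real" where
  "wt t = indicator {0..} t * exp (- \<Psi> t)"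

definition mom :: "nat \<Rightarrow> real" where
  "mom k = (\<integral>t. t ^ k * wt t \<partial>lborel)"

lemma psi_pos: "\<psi> x > 0" using lower[of x] c_pos by linarith

lemma cont_Psi: "continuous_on S \<Psi>"
  by (meson DERIV_continuous_on deriv has_field_derivative_at_within)

lemma measurable_Psi [measurable]: "\<Psi> \<in> borel_measurable borel"
  by (intro borel_measurable_continuous_onI cont_Psi)

lemma measurable_psi [measurable]: "\<psi> \<in> borel_measurable borel"
  by (intro borel_measurable_continuous_onI cont)

lemma measurable_wt [measurable]: "wt \<in> borel_measurable borel"
  unfolding wt_def by measurable

lemma wt_nonneg: "0 \<le> wt t"
  by (simp add: wt_def)

lemma Psi_growth: "x \<le> y \<Longrightarrow> \<Psi> x + c * (y - x) \<le> \<Psi> y"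
proof -
  assume "x \<le> y"
  have "\<Psi> x - c * x \<le> \<Psi> y - c * y"
  proof (rule DERIV_nonneg_imp_nondecreasing[OF \<open>x \<le> y\<close>])
    fix z
    have "((\<lambda>x. \<Psi> x - c * x) has_real_derivative \<psi> z - c) (at z)"
      by (rule derivative_eq_intros deriv refl | simp)+
    then show "\<exists>d. ((\<lambda>x. \<Psi> x - c * x) has_real_derivative d) (at z) \<and> 0 \<le> d"
      using lower[of z] by auto
  qed
  then show ?thesis by (simp add: algebra_simps)
qed

lemma exp_Psi_le: "0 \<le> t \<Longrightarrow> exp (- \<Psi> t) \<le> exp (- (c * t))"
  using Psi_growth[of 0 t] nonneg by simp

lemma wt_le: "wt t \<le> indicator {0..} t * exp (- (c * t))"
  using exp_Psi_le by (simp add: wt_def indicator_def)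

end

lemma power_le_exp:
  fixes b t :: real
  assumes "b > 0" "t \<ge> 0"
  shows "t ^ k \<le> fact k / b ^ k * exp (b * t)"
proof -
  have "(\<Sum>n\<in>{k}. (b * t) ^ n /\<^sub>R fact n) \<le> exp (b * t)"
    unfolding exp_def using assms by (intro sum_le_suminf summable_exp_generic) auto
  then show ?thesis using assms by (simp add: field_simps)
qed

lemma integrable_exp_neg_atLeast:
  fixes b :: real
  assumes "b > 0"
  shows "integrable lborel (\<lambda>t. indicator {0..} t * exp (- (b * t)))"
proof -
  have "(\<integral>\<^sup>+t. ennreal (exp (- (b * t))) * indicator {0..} t \<partial>lborel) = 0 - (- exp (- (b * 0)) / b)"
  proof (rule nn_integral_FTC_atLeast)
    show "((\<lambda>t. - exp (- (b * t)) / b) \<longlongrightarrow> 0) at_top"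
      using assms by real_asymp
  qed (use assms in \<open>auto intro!: derivative_eq_intros\<close>)
  moreover have "(\<integral>\<^sup>+t. ennreal (exp (- (b * t))) * indicator {0..} t \<partial>lborel)
     = (\<integral>\<^sup>+t. ennreal (norm (indicator {0..} t * exp (- (b * t)))) \<partial>lborel)"
    by (intro nn_integral_cong) (auto simp: indicator_def)
  ultimately show ?thesis by (intro integrableI_bounded) auto
qed

context radial_weight
begin

lemma integrable_mom: "integrable lborel (\<lambda>t. t ^ k * wt t)"
proof (rule Bochner_Integration.integrable_bound)
  show "integrable lborel (\<lambda>t. fact k / (c/2) ^ k * (indicator {0..} t * exp (- (c / 2 * t))))"
    using integrable_exp_neg_atLeast[of "c/2"] c_pos by simp
  show "AE t in lborel. norm (t ^ k * wt t) \<le> norm (fact k / (c/2) ^ k * (indicator {0..} t * exp (- (c / 2 * t))))"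
  proof (rule AE_I2)
    fix t :: real
    show "norm (t ^ k * wt t) \<le> norm (fact k / (c/2) ^ k * (indicator {0..} t * exp (- (c / 2 * t))))"
    proof (cases "t \<ge> 0")
      case True
      have "t ^ k * wt t \<le> (fact k / (c/2) ^ k * exp (c / 2 * t)) * exp (- (c * t))"
        using power_le_exp[of "c/2" t k] wt_le[of t] wt_nonneg[of t] c_pos True
        by (intro mult_mono) auto
      also have "\<dots> = fact k / (c/2) ^ k * exp (- (c / 2 * t))"
        by (simp flip: exp_add)
      finally show ?thesis using True wt_nonneg[of t] c_pos by (simp add: abs_mult)
    qed (simp add: wt_def)
  qed
qed simp

lemma mom_pos: "mom k > 0"
proof -
  have "mom k \<ge> 0" unfolding mom_def
    by (intro integral_nonneg_AE AE_I2) (simp add: wt_def indicator_def)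
  moreover have "mom k \<noteq> 0"
  proof
    assume "mom k = 0"
    then have "AE t in lborel. t ^ k * wt t = 0"
      unfolding mom_def
      by (subst (asm) integral_nonneg_eq_0_iff_AE[OF integrable_mom]) (auto simp: wt_def indicator_def)
    then have "AE t in lborel. t \<notin> {1..2::real}"
      by eventually_elim (auto simp: wt_def)
    then have "{1..2::real} \<in> null_sets lborel" by (subst AE_iff_null_sets) auto
    then show False by (simp add: null_sets_def)
  qed
  ultimately show ?thesis by simp
qed

text \<open>The integral of (t - r)^2 against t^k e^(-\<Psi>) is nonnegative; r is the mean, which
  makes the bound sharpest. The ratios m_k are therefore nondecreasing, the source of the
  monotonicity of \<open>rho\<close>.\<close>

lemma mom_log_convex: "(mom (Suc k))\<^sup>2 \<le> mom k * mom (Suc (Suc k))"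
proof -
  define r where "r = mom (Suc k) / mom k"
  have "0 \<le> (\<integral>t. (t - r)\<^sup>2 * (t ^ k * wt t) \<partial>lborel)"
    by (intro integral_nonneg_AE AE_I2) (simp add: wt_def indicator_def)
  also have "(\<lambda>t. (t - r)\<^sup>2 * (t ^ k * wt t)) = (\<lambda>t. t ^ Suc (Suc k) * wt t - 2 * r * (t ^ Suc k * wt t) + r\<^sup>2 * (t ^ k * wt t))"
    by (simp add: power2_eq_square algebra_simps)
  also have "(\<integral>t. \<dots> t \<partial>lborel) = mom (Suc (Suc k)) - 2 * r * mom (Suc k) + r\<^sup>2 * mom k"
    unfolding mom_def using integrable_mom[of k] integrable_mom[of "Suc k"] integrable_mom[of "Suc (Suc k)"]
    by simp
  finally have "0 \<le> mom (Suc (Suc k)) - 2 * r * mom (Suc k) + r\<^sup>2 * mom k" .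
  then show ?thesis using mom_pos[of k] by (simp add: r_def field_simps power2_eq_square)
qed

text \<open>The interval [R, R+1] alone contributes this much. Moments thus outgrow every geometric
  sequence, so the series of the kernel has infinite radius of convergence.\<close>

lemma mom_growth:
  assumes "R > 0"
  shows "\<exists>C>0. \<forall>k. R ^ k * C \<le> mom k"
proof -
  define C where "C = (\<integral>t. indicator {R..R+1} t * wt t \<partial>lborel)"
  have int: "integrable lborel (\<lambda>t. indicator {R..R+1} t * wt t)"
    by (rule Bochner_Integration.integrable_bound[OF integrable_mom[of 0]]) (auto simp: indicator_def)
  have "C \<ge> 0" unfolding C_def by (intro integral_nonneg_AE AE_I2) (simp add: wt_nonneg)
  moreover have "C \<noteq> 0"
  proof
    assume "C = 0"
    then have "AE t in lborel. indicator {R..R+1} t * wt t = 0"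
      unfolding C_def by (subst (asm) integral_nonneg_eq_0_iff_AE) (auto intro: int AE_I2 simp: wt_nonneg)
    then have "AE t in lborel. t \<notin> {R..R+1}"
      by eventually_elim (use assms in \<open>auto simp: wt_def\<close>)
    then have "{R..R+1} \<in> null_sets lborel" by (subst AE_iff_null_sets) auto
    then show False by (simp add: null_sets_def)
  qed
  moreover have "R ^ k * C \<le> mom k" for k
  proof -
    have "R ^ k * C = (\<integral>t. R ^ k * (indicator {R..R+1} t * wt t) \<partial>lborel)" by (simp add: C_def)
    also have "\<dots> \<le> mom k" unfolding mom_def
    proof (rule integral_mono[OF _ integrable_mom])
      show "R ^ k * (indicator {R..R+1} t * wt t) \<le> t ^ k * wt t" for t
        using assms wt_nonneg[of t] by (cases "t \<in> {R..R+1}") (auto intro!: mult_right_mono power_mono simp: wt_def indicator_def)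
    qed (use int in simp)
    finally show ?thesis .
  qed
  ultimately show ?thesis by (intro exI[of _ C]) auto
qed

text \<open>As t^(j+1) \<psi>(t) = t^j \<Phi>(t), this is the Stein identity for powers. The
  fundamental theorem for nonnegative integrands on a half-line delivers integrability and value
  together, from the limit of one antiderivative at infinity.\<close>

lemma moment_by_parts:
  "has_bochner_integral lborel (\<lambda>t. t ^ Suc j * \<psi> t * wt t) (real (Suc j) * mom j)"
proof -
  define g where "g t = t ^ j * exp (- \<Psi> t)" for t
  have contg: "continuous_on S g" for S unfolding g_def by (intro continuous_intros cont_Psi)
  define G where "G t = integral {0..t} g" for t
  have lim_int: "(G \<longlongrightarrow> mom j) at_top"
  proof -
    have "((\<lambda>b. \<integral>t. indicator {..b} t *\<^sub>R (t ^ j * wt t) \<partial>lborel) \<longlongrightarrow> mom j) at_top"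
      unfolding mom_def by (rule tendsto_integral_at_top) (auto simp: integrable_mom)
    moreover have "(\<integral>t. indicator {..b} t *\<^sub>R (t ^ j * wt t) \<partial>lborel) = G b" if "b \<ge> 0" for b
    proof -
      have "(\<integral>t. indicator {..b} t *\<^sub>R (t ^ j * wt t) \<partial>lborel) = (LINT t:{0..b}|lborel. g t)"
        unfolding set_lebesgue_integral_def by (intro Bochner_Integration.integral_cong) (auto simp: wt_def g_def indicator_def)
      also have "\<dots> = G b" unfolding G_def
        by (intro set_borel_integral_eq_integral borel_integrable_atLeastAtMost') (rule contg)
      finally show ?thesis .
    qed
    then have "\<forall>\<^sub>F b in at_top. (\<integral>t. indicator {..b} t *\<^sub>R (t ^ j * wt t) \<partial>lborel) = G b"
      by (rule eventually_mono[OF eventually_ge_at_top[of 0]])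
    ultimately show ?thesis by (rule Lim_transform_eventually)
  qed
  have lim0: "((\<lambda>t. t ^ Suc j * exp (- \<Psi> t)) \<longlongrightarrow> 0) at_top"
  proof (rule tendsto_sandwich)
    show "\<forall>\<^sub>F t in at_top. t ^ Suc j * exp (- \<Psi> t) \<le> t ^ Suc j * exp (- (c * t))"
      using eventually_ge_at_top[of 0] by eventually_elim (intro mult_left_mono exp_Psi_le, auto)
    show "\<forall>\<^sub>F t in at_top. (0::real) \<le> t ^ Suc j * exp (- \<Psi> t)"
      using eventually_ge_at_top[of 0] by eventually_elim auto
    have "((\<lambda>t. (1 / c ^ Suc j) * ((c * t) ^ Suc j / exp (c * t))) \<longlongrightarrow> (1 / c ^ Suc j) * 0) at_top"
    proof (intro tendsto_mult tendsto_const)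
      have "filterlim (\<lambda>t. c * t) at_top at_top"
        using c_pos by (simp add: filterlim_tendsto_pos_mult_at_top[OF tendsto_const _ filterlim_ident])
      then show "((\<lambda>t. (c * t) ^ Suc j / exp (c * t)) \<longlongrightarrow> 0) at_top"
        by (rule filterlim_compose[OF tendsto_power_div_exp_0])
    qed
    moreover have "(\<lambda>t. (1 / c ^ Suc j) * ((c * t) ^ Suc j / exp (c * t))) = (\<lambda>t. t ^ Suc j * exp (- (c * t)))"
      using c_pos by (auto simp: fun_eq_iff power_mult_distrib exp_minus field_simps)
    ultimately show "((\<lambda>t. t ^ Suc j * exp (- (c * t))) \<longlongrightarrow> 0) at_top" by simp
  qed simp
  \<comment> \<open>An antiderivative vanishing at 0. The integral starts at -1, with the part up to
    0 subtracted, so that H has a two-sided derivative at 0 as well.\<close>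
  define H where "H t = real (Suc j) * (integral {-1..t} g - integral {-1..0} g) - t ^ Suc j * exp (- \<Psi> t)" for t
  have "(\<integral>\<^sup>+t. ennreal (t ^ Suc j * \<psi> t * exp (- \<Psi> t)) * indicator {0..} t \<partial>lborel)
      = real (Suc j) * mom j - H 0"
  proof (rule nn_integral_FTC_atLeast)
    fix x :: real assume x: "0 \<le> x"
    have "((\<lambda>t. integral {-1..t} g) has_real_derivative g x) (at x within {-1..x+1})"
      using x by (intro integral_has_real_derivative contg) auto
    then have I: "((\<lambda>t. integral {-1..t} g) has_real_derivative g x) (at x)"
      using x by (simp add: at_within_Icc_at)
    show "(H has_real_derivative x ^ Suc j * \<psi> x * exp (- \<Psi> x)) (at x)"
      unfolding H_def
      by (rule derivative_eq_intros I deriv refl)+ (simp add: g_def algebra_simps)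
  next
    have "G t = integral {-1..t} g - integral {-1..0} g" if "t \<ge> 0" for t
      unfolding G_def using that
      Henstock_Kurzweil_Integration.integral_combine[of "-1" 0 t g] integrable_continuous_interval[OF contg] by auto
    then have "\<forall>\<^sub>F t in at_top. real (Suc j) * G t - t ^ Suc j * exp (- \<Psi> t) = H t"
      by (intro eventually_mono[OF eventually_ge_at_top[of 0]]) (simp add: H_def)
    moreover have "((\<lambda>t. real (Suc j) * G t - t ^ Suc j * exp (- \<Psi> t)) \<longlongrightarrow> real (Suc j) * mom j - 0) at_top"
      by (intro tendsto_intros lim_int lim0)
    ultimately show "(H \<longlongrightarrow> real (Suc j) * mom j) at_top" by (simp add: Lim_transform_eventually)
  qed (use psi_pos less_imp_le in \<open>auto intro!: mult_nonneg_nonneg\<close>)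
  also have "(\<integral>\<^sup>+t. ennreal (t ^ Suc j * \<psi> t * exp (- \<Psi> t)) * indicator {0..} t \<partial>lborel)
    = (\<integral>\<^sup>+t. ennreal (t ^ Suc j * \<psi> t * wt t) \<partial>lborel)"
    by (intro nn_integral_cong) (auto simp: wt_def indicator_def)
  finally show ?thesis
    using mom_pos[of j] psi_pos by (intro has_bochner_integral_nn_integral)
      (auto intro!: AE_I2 mult_nonneg_nonneg less_imp_le[OF psi_pos] simp: wt_def indicator_def H_def)
qed

end

section \<open>Concentration of the moment densities\<close>

text \<open>Condition \<open>flat\<close> is the form in which the hypothesis on \<Phi>'' is used:
  over any fixed number of widths, \<phi> = \<Phi>' changes by a small fraction of itself. It is
  derived in \<open>small_relative_variation\<close>.\<close>

locale flat_weight = radial_weight +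
  fixes \<phi> :: "real \<Rightarrow> real"
  assumes deriv_Phi: "((\<lambda>x. x * \<psi> x) has_real_derivative \<phi> x) (at x)"
    and phi_lower: "c \<le> \<phi> x"
    and flat: "\<And>M \<epsilon>. M > 0 \<Longrightarrow> \<epsilon> > 0 \<Longrightarrow>
      \<forall>\<^sub>F t in at_top. \<forall>\<tau>\<ge>0. \<bar>\<tau> - t\<bar> \<le> M * sqrt (t / \<phi> t) \<longrightarrow> \<bar>\<phi> \<tau> - \<phi> t\<bar> \<le> \<epsilon> * \<phi> t"
begin

definition Phi :: "real \<Rightarrow> real" where "Phi x = x * \<psi> x"

text \<open>The widths, in the variables \<open>t\<close> and \<open>d\<close> respectively, of the Gaussian profiles of
  \<open>t ^ d * exp (- \<Psi> t)\<close>.\<close>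

definition w :: "real \<Rightarrow> real" where "w t = sqrt (t / \<phi> t)"
definition W :: "real \<Rightarrow> real" where "W t = sqrt (t * \<phi> t)"

lemma phi_pos: "\<phi> x > 0" using phi_lower[of x] c_pos by linarith

lemma Phi_deriv: "(Phi has_real_derivative \<phi> x) (at x)"
  unfolding Phi_def using deriv_Phi by simp

lemma Phi_less: "x < y \<Longrightarrow> Phi x < Phi y"
  by (rule DERIV_pos_imp_increasing) (use Phi_deriv phi_pos in blast)+

lemma Phi_le: "x \<le> y \<Longrightarrow> Phi x \<le> Phi y"
  using Phi_less[of x y] by (cases "x = y") auto

lemma Phi_0: "Phi 0 = 0" by (simp add: Phi_def)

lemma measurable_Phi [measurable]: "Phi \<in> borel_measurable borel"
  unfolding Phi_def by measurable

lemma Phi_surj: "v \<ge> 0 \<Longrightarrow> \<exists>a\<ge>0. Phi a = v"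
proof -
  assume v: "v \<ge> 0"
  have "v = c * (v / c)" using c_pos by simp
  also have "\<dots> \<le> Phi (v / c)" unfolding Phi_def
    using mult_left_mono[OF lower[of "v/c"], of "v/c"] v c_pos by (simp add: mult.commute)
  finally have "v \<le> Phi (v / c)" .
  moreover have "\<forall>x. 0 \<le> x \<and> x \<le> v / c \<longrightarrow> isCont Phi x" using Phi_deriv DERIV_isCont by blast
  ultimately show ?thesis using IVT[of Phi 0 v "v/c"] v c_pos Phi_0 by auto
qed

lemma w_W:
  assumes "t > 0"
  shows "w t > 0" "W t > 0" "w t * W t = t" "\<phi> t * w t = W t"
proof -
  show 1: "w t > 0" "W t > 0" using assms phi_pos[of t] by (auto simp: w_def W_def)
  show 2: "w t * W t = t" using assms phi_pos[of t]
    by (simp add: w_def W_def flip: real_sqrt_mult)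
  have "t * \<phi> t = (\<phi> t)\<^sup>2 * (t / \<phi> t)" using phi_pos[of t] by (simp add: power2_eq_square)
  then have "W t = sqrt ((\<phi> t)\<^sup>2) * sqrt (t / \<phi> t)" by (simp only: W_def real_sqrt_mult)
  then show "\<phi> t * w t = W t" using phi_pos[of t] by (simp add: w_def)
qed

lemma W_at_top: "filterlim W at_top at_top"
proof (rule filterlim_at_top_mono)
  show "filterlim (\<lambda>t. sqrt (c * t)) at_top at_top"
    using c_pos by real_asymp
  show "\<forall>\<^sub>F t in at_top. sqrt (c * t) \<le> W t"
    using eventually_ge_at_top[of 0]
  proof eventually_elim
    case (elim t)
    then show ?case using mult_right_mono[OF phi_lower[of t], of t] by (simp add: W_def mult.commute)
  qed
qed

lemma W_ge: "\<forall>\<^sub>F t in at_top. W t \<ge> B"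
  using W_at_top by (simp add: filterlim_at_top)

text \<open>Since w W = t and W tends to infinity, M w is eventually below t/2. The affine
  approximation is the mean value theorem together with \<open>flat\<close>, its error being
  rewritten by \<phi> w = W. The cap 1/4 on e keeps \<phi>(\<tau>) \<ge> \<phi>(t)/2, which with
  \<tau> \<le> 2t gives the comparison of widths.\<close>

lemma window:
  assumes M: "M > 0" and eps: "\<epsilon> > 0"
  shows "\<forall>\<^sub>F t in at_top. t > 0 \<and> M * w t \<le> t / 2 \<and>
    (\<forall>\<tau>. \<bar>\<tau> - t\<bar> \<le> M * w t \<longrightarrow> \<bar>Phi \<tau> - Phi t - \<phi> t * (\<tau> - t)\<bar> \<le> \<epsilon> * W t \<and> w \<tau> \<le> 2 * w t)"
proof -
  define e where "e = min (\<epsilon> / M) (1/4)"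
  have e: "e > 0" "e \<le> 1/4" "e * M \<le> \<epsilon>" using M eps by (auto simp: e_def min_def field_simps)
  show ?thesis
    using flat[OF M e(1)] W_ge[of "2 * M"] eventually_gt_at_top[of 0]
  proof eventually_elim
    case (elim t)
    note wW = w_W[OF elim(3)]
    have "M * w t = M * (w t * W t) / W t" using wW(2) by simp
    also have "\<dots> = M * t / W t" by (simp only: wW(3))
    also have "\<dots> \<le> t / 2" using elim(2,3) M by (simp add: field_simps)
    finally have half: "M * w t \<le> t / 2" .
    have close: "\<bar>\<phi> \<tau> - \<phi> t\<bar> \<le> e * \<phi> t" if "\<bar>\<tau> - t\<bar> \<le> M * w t" for \<tau>
      using elim(1) that half elim(3) unfolding w_def by auto
    have "\<bar>Phi \<tau> - Phi t - \<phi> t * (\<tau> - t)\<bar> \<le> \<epsilon> * W t" if tau: "\<bar>\<tau> - t\<bar> \<le> M * w t" for \<tau>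
    proof -
      obtain \<zeta> where z: "\<bar>\<zeta> - t\<bar> \<le> \<bar>\<tau> - t\<bar>" "Phi \<tau> - Phi t = (\<tau> - t) * \<phi> \<zeta>"
      proof (cases \<tau> t rule: linorder_cases)
        case less
        from MVT2[OF less, of Phi \<phi>] Phi_deriv obtain z where "z > \<tau>" "z < t" "Phi t - Phi \<tau> = (t - \<tau>) * \<phi> z" by blast
        then show ?thesis by (intro that[of z]) (auto simp: algebra_simps)
      next
        case greater
        from MVT2[OF greater, of Phi \<phi>] Phi_deriv obtain z where "z > t" "z < \<tau>" "Phi \<tau> - Phi t = (\<tau> - t) * \<phi> z" by blast
        then show ?thesis by (intro that[of z]) auto
      qed (use that[of t] in auto)
      have "\<bar>Phi \<tau> - Phi t - \<phi> t * (\<tau> - t)\<bar> = \<bar>\<phi> \<zeta> - \<phi> t\<bar> * \<bar>\<tau> - t\<bar>"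
        unfolding z(2) abs_mult[symmetric] by (simp add: algebra_simps)
      also have "\<dots> \<le> (e * \<phi> t) * (M * w t)"
        using close[of \<zeta>] z(1) tau e phi_pos[of t] by (intro mult_mono) auto
      also have "\<dots> = (e * M) * W t" unfolding wW(4)[symmetric] by (simp add: mult_ac)
      also have "\<dots> \<le> \<epsilon> * W t" using e wW by (intro mult_right_mono) auto
      finally show ?thesis .
    qed
    moreover have "w \<tau> \<le> 2 * w t" if tau: "\<bar>\<tau> - t\<bar> \<le> M * w t" for \<tau>
    proof -
      have t: "0 \<le> \<tau>" "\<tau> \<le> 2 * t" using tau half elim(3) by auto
      have "e * \<phi> t \<le> 1/4 * \<phi> t" using e phi_pos[of t] by (intro mult_right_mono) auto
      then have p: "\<phi> \<tau> \<ge> \<phi> t / 2" using close[OF tau] phi_pos[of t] by linarith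
      have "\<tau> / \<phi> \<tau> \<le> (2 * t) / (\<phi> t / 2)" using t p phi_pos[of t] by (intro frac_le) auto
      then have "sqrt (\<tau> / \<phi> \<tau>) \<le> sqrt ((2 * t) / (\<phi> t / 2))" by (rule real_sqrt_le_mono)
      then show ?thesis by (simp add: w_def real_sqrt_mult real_sqrt_divide)
    qed
    ultimately show ?case using half elim(3) by blast
  qed
qed

text \<open>Moving left from t by M widths stays in the positive half-line, while the nearly affine
  \<Phi> drops by about M W(t). As \<Phi> cannot become negative there, \<Phi>(t) is at least (M -
  1) W(t).\<close>

lemma W_le_Phi: "\<forall>\<^sub>F t in at_top. C * W t \<le> Phi t"
proof -
  define M where "M = \<bar>C\<bar> + 1"
  have "M > 0" by (simp add: M_def)
  from window[OF this zero_less_one] show ?thesis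
  proof eventually_elim
    case (elim t)
    define \<tau> where "\<tau> = t - M * w t"
    have "t > 0" using elim by blast
    note wW = w_W[OF this]
    have "\<bar>\<tau> - t\<bar> \<le> M * w t" using wW elim \<open>M > 0\<close> by (simp add: \<tau>_def)
    then have "\<bar>Phi \<tau> - Phi t - \<phi> t * (\<tau> - t)\<bar> \<le> 1 * W t" using elim by blast
    moreover have "\<phi> t * (\<tau> - t) = - (M * W t)" unfolding wW(4)[symmetric] by (simp add: \<tau>_def mult_ac)
    moreover have "Phi \<tau> \<ge> 0" using elim Phi_le[of 0 \<tau>] Phi_0 by (auto simp: \<tau>_def)
    ultimately have "(M - 1) * W t \<le> Phi t" by (simp add: algebra_simps)
    moreover have "C * W t \<le> (M - 1) * W t" using wW elim by (intro mult_right_mono) (auto simp: M_def)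
    ultimately show ?case by linarith
  qed
qed

end

lemma error_parameters:
  fixes \<delta> :: real
  assumes "\<delta> > 0"
  obtains R \<epsilon> :: real where "R \<ge> 10" "0 < \<epsilon>" "\<epsilon> \<le> 1/8" "8 * \<epsilon> + 88 / R\<^sup>2 \<le> \<delta>"
proof
  define R where "R = 10 + 176 / \<delta>"
  show "R \<ge> 10" using assms by (simp add: R_def)
  then have "88 / R\<^sup>2 \<le> 88 / R" by (intro divide_left_mono) (auto simp: power2_eq_square)
  also have "\<dots> \<le> 88 / (176 / \<delta>)" using assms by (intro divide_left_mono) (auto simp: R_def add_pos_pos)
  also have "\<dots> = \<delta> / 2" using assms by simp
  finally show "8 * min (1/8) (\<delta> / 16) + 88 / R\<^sup>2 \<le> \<delta>" by (simp add: min_def)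
qed (use assms in auto)

context flat_weight
begin

text \<open>\<open>near_linear_moments\<close> is applied to X = (t - a)/w(a) and Y = (\<Phi>(t) -
  (k+1))/W(a). The factor t in E[t q'(t)] is not constant, so the identities have remainders: E[X Y]
  = 1 + E[X]/W and E[X^3 Y] = 3 E[X^2] + 3 E[X^3]/W. The first is small since W is large; the second
  brings in a third moment that has to be eliminated.\<close>

lemma moment_ratio:
  assumes \<delta>: "\<delta> > 0"
  shows "\<forall>\<^sub>F a in at_top. \<forall>k. Phi a = real (Suc k) \<longrightarrow> \<bar>mom (Suc k) / mom k - a\<bar> \<le> \<delta> * w a"
proof -
  obtain R \<epsilon> :: real where R: "R \<ge> 10" and eps: "0 < \<epsilon>" "\<epsilon> \<le> 1/8" and err: "8 * \<epsilon> + 88 / R\<^sup>2 \<le> \<delta>"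
    using error_parameters[OF \<delta>] .
  have R0: "R > 0" using R by simp
  from window[OF R0 eps(1)] W_ge[of "3 * R"] W_ge[of "1 / \<epsilon>"] show ?thesis
  proof eventually_elim
    case (elim a)
    then have a: "a > 0" and half: "R * w a \<le> a / 2"
      and lin: "\<And>\<tau>. \<bar>\<tau> - a\<bar> \<le> R * w a \<Longrightarrow> \<bar>Phi \<tau> - Phi a - \<phi> a * (\<tau> - a)\<bar> \<le> \<epsilon> * W a" by blast+
    note wW = w_W[OF a]
    show ?case
    proof (intro allI impI)
      fix k assume k: "Phi a = real (Suc k)"
      define p where "p t = t ^ k * wt t / mom k" for t
      define N where "N = density lborel (\<lambda>t. ennreal (p t))"
      define r where "r j = mom (k + j) / mom k" for j
      define D where "D t = Phi t - real (Suc k)" for t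
      have p0: "p t \<ge> 0" for t using mom_pos[of k] by (simp add: p_def wt_def indicator_def)
      have p_meas [measurable]: "p \<in> borel_measurable borel" unfolding p_def by measurable
      have hbi: "has_bochner_integral N f (v / mom k)"
        if "f \<in> borel_measurable borel" "has_bochner_integral lborel (\<lambda>t. f t * (t ^ k * wt t)) v" for f :: "real \<Rightarrow> real" and v
      proof -
        have "has_bochner_integral lborel (\<lambda>t. p t *\<^sub>R f t) (v / mom k)"
          using has_bochner_integral_divide[OF that(2), of "mom k"] mom_pos[of k] by (simp add: p_def mult_ac)
        then show ?thesis unfolding N_def
          using that(1) p0 by (intro has_bochner_integral_density) auto
      qed
      have m: "has_bochner_integral N (\<lambda>t. t ^ j) (r j)" for j
        unfolding r_def using has_bochner_integral_integrable[OF integrable_mom[of "k + j"]]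
        by (intro hbi) (auto simp: mom_def power_add mult_ac)
      \<comment> \<open>In the product t^j (\<Phi>(t) - (k+1)) the coefficients k+j+1 and k+1
        multiply the same moment and leave the factor j.\<close>
      have mD: "has_bochner_integral N (\<lambda>t. t ^ j * D t) (real j * r j)" for j
      proof -
        have "has_bochner_integral N (\<lambda>t. t ^ j * D t) ((real (Suc (k + j)) * mom (k + j) - real (Suc k) * mom (k + j)) / mom k)"
        proof (rule hbi)
          have "has_bochner_integral lborel (\<lambda>t. t ^ Suc (k + j) * \<psi> t * wt t - real (Suc k) * (t ^ (k + j) * wt t))
             (real (Suc (k + j)) * mom (k + j) - real (Suc k) * mom (k + j))"
            using has_bochner_integral_integrable[OF integrable_mom[of "k + j"]] unfolding mom_def[symmetric]
            by (intro has_bochner_integral_diff moment_by_parts has_bochner_integral_mult_right)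
          then show "has_bochner_integral lborel (\<lambda>t. t ^ j * D t * (t ^ k * wt t))
             (real (Suc (k + j)) * mom (k + j) - real (Suc k) * mom (k + j))"
            unfolding D_def Phi_def by (rule back_subst[of "\<lambda>f. has_bochner_integral lborel f _"])
              (auto simp: fun_eq_iff power_add algebra_simps)
        qed (simp add: D_def)
        then show ?thesis by (rule back_subst[of "has_bochner_integral N _"]) (simp add: r_def algebra_simps)
      qed
      have r0: "r 0 = 1" using mom_pos[of k] by (simp add: r_def)
      have "emeasure N (space N) = 1"
      proof -
        have "emeasure N (space N) = (\<integral>\<^sup>+t. ennreal (p t) \<partial>lborel)"
          unfolding N_def by (subst emeasure_density) auto
        also have "\<dots> = ennreal (\<integral>t. p t \<partial>lborel)"
          by (intro nn_integral_eq_integral) (use p0 integrable_mom[of k] in \<open>auto simp: p_def\<close>)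
        also have "(\<integral>t. p t \<partial>lborel) = 1" using mom_pos[of k] by (simp add: p_def mom_def)
        finally show ?thesis by simp
      qed
      then interpret N: prob_space N by (rule prob_spaceI)
      define X where "X t = (t - a) / w a" for t
      define Y where "Y t = D t / W a" for t
      have X1: "has_bochner_integral N X ((r 1 - a * r 0) / w a)"
      proof -
        have "X = (\<lambda>t. (t ^ 1 - a * t ^ 0) / w a)" by (simp add: X_def fun_eq_iff)
        then show ?thesis using wW
          by (simp only:) (intro has_bochner_integral_divide has_bochner_integral_diff has_bochner_integral_mult_right m)
      qed
      have X2: "has_bochner_integral N (\<lambda>t. (X t)\<^sup>2) ((r 2 - (2 * a) * r 1 + a\<^sup>2 * r 0) / (w a)\<^sup>2)"
      proof -
        have "(\<lambda>t. (X t)\<^sup>2) = (\<lambda>t. (t ^ 2 - (2 * a) * t ^ 1 + a\<^sup>2 * t ^ 0) / (w a)\<^sup>2)"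
          by (simp add: X_def fun_eq_iff power_divide power2_eq_square algebra_simps)
        then show ?thesis using wW
          by (simp only:) (intro has_bochner_integral_divide has_bochner_integral_add has_bochner_integral_diff has_bochner_integral_mult_right m)
      qed
      have e3: "(t - a) ^ 3 = t ^ 3 - (3 * a) * t ^ 2 + (3 * a\<^sup>2) * t ^ 1 - a ^ 3 * t ^ 0" for t
        by (simp add: power2_eq_square power3_eq_cube algebra_simps)
      have X3: "has_bochner_integral N (\<lambda>t. X t ^ 3) ((r 3 - (3 * a) * r 2 + (3 * a\<^sup>2) * r 1 - a ^ 3 * r 0) / w a ^ 3)"
      proof -
        have "(\<lambda>t. X t ^ 3) = (\<lambda>t. (t ^ 3 - (3 * a) * t ^ 2 + (3 * a\<^sup>2) * t ^ 1 - a ^ 3 * t ^ 0) / w a ^ 3)"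
          by (simp only: X_def power_divide e3)
        then show ?thesis using wW
          by (simp only:) (intro has_bochner_integral_divide has_bochner_integral_add has_bochner_integral_diff has_bochner_integral_mult_right m)
      qed
      have Y1: "has_bochner_integral N Y 0"
        using has_bochner_integral_divide[OF mD[of 0], of "W a"] wW by (simp add: Y_def[abs_def])
      have XY: "has_bochner_integral N (\<lambda>t. X t * Y t) (r 1 / a)"
      proof -
        have "has_bochner_integral N (\<lambda>t. (t ^ 1 * D t - a * (t ^ 0 * D t)) / (w a * W a)) ((real 1 * r 1 - a * (real 0 * r 0)) / (w a * W a))"
          using wW by (intro has_bochner_integral_divide has_bochner_integral_diff has_bochner_integral_mult_right mD)
        then show ?thesis using wW(3) by (simp add: X_def Y_def algebra_simps)
      qed
      have X3Y: "has_bochner_integral N (\<lambda>t. X t ^ 3 * Y t) (3 * (r 3 - 2 * a * r 2 + a\<^sup>2 * r 1) / (w a ^ 3 * W a))"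
      proof -
        have "has_bochner_integral N (\<lambda>t. (t ^ 3 * D t - (3 * a) * (t ^ 2 * D t) + (3 * a\<^sup>2) * (t ^ 1 * D t) - a ^ 3 * (t ^ 0 * D t)) / (w a ^ 3 * W a))
          ((real 3 * r 3 - (3 * a) * (real 2 * r 2) + (3 * a\<^sup>2) * (real 1 * r 1) - a ^ 3 * (real 0 * r 0)) / (w a ^ 3 * W a))"
          using wW by (intro has_bochner_integral_divide has_bochner_integral_add has_bochner_integral_diff has_bochner_integral_mult_right mD)
        moreover have "(\<lambda>t. (t ^ 3 * D t - (3 * a) * (t ^ 2 * D t) + (3 * a\<^sup>2) * (t ^ 1 * D t) - a ^ 3 * (t ^ 0 * D t)) / (w a ^ 3 * W a)) = (\<lambda>t. X t ^ 3 * Y t)"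
          by (simp only: X_def Y_def power_divide e3 times_divide_times_eq left_diff_distrib distrib_right mult.assoc)
        moreover have "real 3 * r 3 - (3 * a) * (real 2 * r 2) + (3 * a\<^sup>2) * (real 1 * r 1) - a ^ 3 * (real 0 * r 0) = 3 * (r 3 - 2 * a * r 2 + a\<^sup>2 * r 1)"
          by (simp add: algebra_simps)
        ultimately show ?thesis by (simp only:)
      qed
      define S where "S = N.expectation (\<lambda>t. (X t)\<^sup>2)"
      define Q where "Q = N.expectation (\<lambda>t. X t ^ 3 * Y t)"
      define X3v where "X3v = N.expectation (\<lambda>t. X t ^ 3)"
      have S0: "S \<ge> 0" unfolding S_def by simp
      have Sv: "S * (w a)\<^sup>2 = r 2 - 2 * a * r 1 + a\<^sup>2"
        using X2[THEN has_bochner_integral_integral_eq] wW by (simp add: S_def r0)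
      have X3e: "X3v * w a ^ 3 = r 3 - 3 * a * r 2 + 3 * a\<^sup>2 * r 1 - a ^ 3"
        using X3[THEN has_bochner_integral_integral_eq] wW by (simp add: X3v_def r0)
      have Qv: "Q * (w a ^ 3 * W a) = 3 * (r 3 - 2 * a * r 2 + a\<^sup>2 * r 1)"
        using X3Y[THEN has_bochner_integral_integral_eq] wW by (simp add: Q_def)
      have "Q * (w a ^ 3 * W a) = 3 * (X3v * w a ^ 3) + 3 * a * (S * (w a)\<^sup>2)"
        unfolding Qv X3e Sv by (simp add: algebra_simps power2_eq_square power3_eq_cube)
      also have "\<dots> = (3 * X3v / W a + 3 * S) * (w a ^ 3 * W a)"
      proof -
        have "3 * a * (S * (w a)\<^sup>2) = 3 * S * (w a ^ 3 * W a)"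
        proof -
          have "3 * (w a * W a) * (S * (w a)\<^sup>2) = 3 * S * (w a ^ 3 * W a)"
            by (simp add: power2_eq_square power3_eq_cube)
          then show ?thesis by (simp only: wW(3))
        qed
        moreover have "3 * (X3v * w a ^ 3) = 3 * X3v / W a * (w a ^ 3 * W a)" using wW by simp
        ultimately show ?thesis by (simp add: algebra_simps)
      qed
      finally have Qeq: "Q = 3 * X3v / W a + 3 * S" using wW by simp
      have inner: "\<bar>Y t - X t\<bar> \<le> \<epsilon>" if "\<bar>X t\<bar> \<le> R" for t
      proof -
        have "\<bar>t - a\<bar> \<le> R * w a" using that wW by (simp add: X_def abs_divide pos_divide_le_eq)
        from lin[OF this] have "\<bar>D t - \<phi> a * (t - a)\<bar> \<le> \<epsilon> * W a" by (simp add: D_def k)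
        moreover have "\<phi> a * (t - a) = W a * X t" unfolding wW(4)[symmetric] using wW(1) by (simp add: X_def)
        ultimately have "\<bar>W a * (Y t - X t)\<bar> \<le> \<epsilon> * W a" using wW by (simp add: Y_def algebra_simps)
        then show ?thesis using wW by (simp add: abs_mult mult.commute)
      qed
      have Ymono: "Y s \<le> Y t" if "s \<le> t" for s t
        using Phi_le[OF that] wW by (simp add: Y_def D_def divide_right_mono)
      have right: "Y t \<ge> R / 2" if "X t > R" for t
      proof -
        have "X (a + R * w a) = R" using wW by (simp add: X_def)
        then have "Y (a + R * w a) \<ge> R - \<epsilon>" using inner[of "a + R * w a"] R by auto
        moreover have "a + R * w a \<le> t" using that wW by (simp add: X_def field_simps)
        ultimately have "Y t \<ge> R - \<epsilon>" using Ymono by fastforce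
        then show ?thesis using eps R by simp
      qed
      have left: "Y t \<le> - R / 2" if "X t < - R" for t
      proof -
        have "X (a - R * w a) = - R" using wW by (simp add: X_def)
        then have "Y (a - R * w a) \<le> - R + \<epsilon>" using inner[of "a - R * w a"] R by auto
        moreover have "t \<le> a - R * w a" using that wW by (simp add: X_def field_simps)
        ultimately have "Y t \<le> - R + \<epsilon>" using Ymono by fastforce
        then show ?thesis using eps R by simp
      qed
      \<comment> \<open>Eliminates the third moment: inside the window X^3 \<le> R X^2, to the right
        X^3 is at most (2/R) X^3 Y, to the left it is negative. After division by W \<ge> 3R only S
        + (Q + 1)/2 is left, and half of Q can be moved to the other side.\<close>
      have cube: "X t ^ 3 \<le> R * (X t)\<^sup>2 + (2 / R) * (X t ^ 3 * Y t + 1)" for t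
      proof -
        consider "\<bar>X t\<bar> \<le> R" | "X t > R" | "X t < - R" by linarith
        then show ?thesis
        proof cases
          case 1
          then have "0 \<le> X t ^ 3 * Y t + 1" using inner[OF 1] eps by (intro cube_mult_near_self) auto
          moreover have "X t * (X t)\<^sup>2 \<le> R * (X t)\<^sup>2" using 1 by (intro mult_right_mono) auto
          ultimately show ?thesis using R0 by (simp add: power2_eq_square power3_eq_cube add_increasing2)
        next
          case 2
          have "X t ^ 3 * (R / 2) \<le> X t ^ 3 * Y t" using right[OF 2] 2 R by (intro mult_left_mono) auto
          then have "X t ^ 3 \<le> (2 / R) * (X t ^ 3 * Y t + 1)" using R0 by (simp add: field_simps)
          then show ?thesis using R0 by (simp add: add_increasing)
        next
          case 3
          have neg: "X t ^ 3 \<le> 0" using 3 R by (simp add: power3_eq_cube mult_nonneg_nonpos)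
          then have "X t ^ 3 * Y t \<ge> 0" using left[OF 3] R by (intro mult_nonpos_nonpos) auto
          then show ?thesis using R0 neg by (smt (verit) mult_nonneg_nonneg zero_le_power2 divide_nonneg_nonneg)
        qed
      qed
      note XX = X2[THEN integrable.intros] and XYi = XY[THEN integrable.intros] and XXXY = X3Y[THEN integrable.intros]
        and XXX = X3[THEN integrable.intros]
      have "X3v \<le> R * S + (2 / R) * (Q + 1)"
        using integral_mono[OF XXX _ cube] XX XXXY by (simp add: X3v_def S_def Q_def N.prob_space)
      then have "3 * X3v \<le> 3 * (R * S + (2 / R) * (Q + 1))" by (rule mult_left_mono) simp
      then have "3 * X3v / W a \<le> 3 * (R * S + (2 / R) * (Q + 1)) / W a"
        by (rule divide_right_mono) (use wW in simp)
      also have "\<dots> = (3 * R / W a) * S + (6 / (R * W a)) * (Q + 1)"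
        using wW R0 by (simp add: field_simps)
      also have "\<dots> \<le> 1 * S + (1/2) * (Q + 1)"
      proof (intro add_mono mult_right_mono)
        show "3 * R / W a \<le> 1" using elim(2) wW by (simp add: field_simps)
        have "12 \<le> R * W a" using elim(2) R mult_mono[of 10 R 10 "W a"] by simp
        then show "6 / (R * W a) \<le> 1/2" using wW R0 by (simp add: field_simps)
        have "0 \<le> N.expectation (\<lambda>t. X t ^ 3 * Y t + 1)"
        proof (rule integral_nonneg_AE, rule AE_I2)
          fix t
          consider "\<bar>X t\<bar> \<le> R" | "X t > R" | "X t < - R" by linarith
          then show "0 \<le> X t ^ 3 * Y t + 1"
          proof cases
            case 1 then show ?thesis using inner[OF 1] eps by (intro cube_mult_near_self) auto
          next
            case 2 then show ?thesis using right[OF 2] R by (simp add: add_nonneg_nonneg)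
          next
            case 3
            have "X t ^ 3 \<le> 0" using 3 R by (simp add: power3_eq_cube mult_nonneg_nonpos)
            then have "X t ^ 3 * Y t \<ge> 0" using left[OF 3] R by (intro mult_nonpos_nonpos) auto
            then show ?thesis by simp
          qed
        qed
        then show "0 \<le> Q + 1" using XXXY by (simp add: Q_def N.prob_space)
      qed (use S0 in auto)
      finally have "Q - 3 * S \<le> 1 * S + (1/2) * (Q + 1)" unfolding Qeq by simp
      then have "Q \<le> 10 * (1 + S)" using S0 by (simp add: field_simps)
      moreover have "\<bar>N.expectation (\<lambda>t. X t * Y t) - 1\<bar> \<le> \<epsilon> * (1 + S)"
      proof -
        have EX: "N.expectation X = (r 1 - a) / w a" using X1[THEN has_bochner_integral_integral_eq] by (simp add: r0)
        have "N.expectation (\<lambda>t. X t * Y t) - 1 = (r 1 - a) / a" 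
          using XY[THEN has_bochner_integral_integral_eq] a by (simp add: field_simps)
        also have "\<dots> = N.expectation X / W a" 
          using EX wW(1,2) by (simp add: divide_divide_eq_left wW(3))
        finally have "\<bar>N.expectation (\<lambda>t. X t * Y t) - 1\<bar> = (1 / W a) * \<bar>N.expectation X\<bar>" using wW by simp
        also have "\<dots> \<le> \<epsilon> * (1 + S)"
        proof (rule mult_mono)
          show "1 / W a \<le> \<epsilon>" using elim(3) wW eps by (simp add: field_simps)
          have "\<bar>N.expectation X\<bar> \<le> N.expectation (\<lambda>t. \<bar>X t\<bar>)" by (rule integral_abs_bound)
          also have "\<dots> \<le> N.expectation (\<lambda>t. 1 + (X t)\<^sup>2)"
          proof (rule integral_mono)
            show "\<bar>X t\<bar> \<le> 1 + (X t)\<^sup>2" for t using sum_squares_bound[of 1 "\<bar>X t\<bar>"] by simp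
          qed (use X1[THEN integrable.intros] XX in auto)
          also have "\<dots> = 1 + S" using XX by (simp add: S_def N.prob_space)
          finally show "\<bar>N.expectation X\<bar> \<le> 1 + S" .
        qed (use eps in auto)
        finally show ?thesis .
      qed
      ultimately have "\<bar>N.expectation X\<bar> \<le> 8 * \<epsilon> + 88 / R\<^sup>2"
        using Y1[THEN has_bochner_integral_integral_eq] inner right left unfolding S_def Q_def
        by (intro N.near_linear_moments(2)[OF R eps X1[THEN integrable.intros] Y1[THEN integrable.intros] XX XYi XXXY]) auto
      then have "\<bar>(r 1 - a) / w a\<bar> \<le> \<delta>" using X1[THEN has_bochner_integral_integral_eq] err by (simp add: r0)
      then show "\<bar>mom (Suc k) / mom k - a\<bar> \<le> \<delta> * w a" using wW by (simp add: r_def abs_divide pos_divide_le_eq)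
    qed
  qed
qed

end

section \<open>The power series of the kernel\<close>

context radial_weight
begin

definition coef :: "nat \<Rightarrow> nat \<Rightarrow> real" where
  "coef \<nu> d = fact (d + \<nu>) / (fact d * mom (d + \<nu>))"

definition gen :: "nat \<Rightarrow> real \<Rightarrow> real" where
  "gen \<nu> x = (\<Sum>d. coef \<nu> d * x ^ d)"

text \<open>\<open>rho \<nu> d = coef \<nu> (d - 1) / coef \<nu> d\<close>, and \<open>rho \<nu> 0 = 0\<close>.\<close>

definition rho :: "nat \<Rightarrow> nat \<Rightarrow> real" where
  "rho \<nu> d = real d / real (d + \<nu>) * (mom (d + \<nu>) / mom (d + \<nu> - 1))"

lemma coef_pos: "coef \<nu> d > 0"
  using mom_pos by (simp add: coef_def)

lemma coef_rho: "coef \<nu> (Suc d) * rho \<nu> (Suc d) = coef \<nu> d"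
proof -
  have "(A * f) / ((B * g) * m1) * (B / A * (m1 / m0)) = f / (g * m0)"
    if "A \<noteq> 0" "B \<noteq> 0" "m1 \<noteq> 0" for A B f g m0 m1 :: real
    using that by simp
  from this[of "real (Suc (d + \<nu>))" "real (Suc d)" "mom (Suc (d + \<nu>))"] show ?thesis
    using mom_pos[of "Suc (d + \<nu>)"] by (simp add: coef_def rho_def del: of_nat_Suc)
qed

lemma rho_0 [simp]: "rho \<nu> 0 = 0" by (simp add: rho_def)

lemma rho_nonneg: "rho \<nu> d \<ge> 0"
  using less_imp_le[OF mom_pos] by (simp add: rho_def)

text \<open>Both factors increase: d/(d+\<nu>) by inspection, the quotient of moments by
  log-convexity. Outside the window this is all that is known about \<open>rho\<close>.\<close>

lemma rho_mono_Suc: "rho \<nu> d \<le> rho \<nu> (Suc d)"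
proof (cases d)
  case (Suc k)
  have "real d / real (d + \<nu>) \<le> real (Suc d) / real (Suc d + \<nu>)"
    using Suc by (simp add: field_simps)
  moreover have "mom (d + \<nu>) / mom (d + \<nu> - 1) \<le> mom (Suc d + \<nu>) / mom (Suc d + \<nu> - 1)"
    using Suc mom_log_convex[of "k + \<nu>"] mom_pos[of "k + \<nu>"] mom_pos[of "Suc (k + \<nu>)"]
    by (simp add: field_simps power2_eq_square)
  ultimately show ?thesis unfolding rho_def
    using less_imp_le[OF mom_pos] by (intro mult_mono) auto
qed (simp add: rho_nonneg)

lemma rho_mono: "d \<le> d' \<Longrightarrow> rho \<nu> d \<le> rho \<nu> d'"
  by (rule lift_Suc_mono_le[of "rho \<nu>"]) (rule rho_mono_Suc)

end

lemma fact_add_le: "(fact (d + \<nu>) :: real) \<le> fact d * real (d + \<nu>) ^ \<nu>"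
proof (induction \<nu>)
  case (Suc \<nu>)
  have "(fact (d + Suc \<nu>) :: real) = real (d + Suc \<nu>) * fact (d + \<nu>)" by simp
  also have "\<dots> \<le> real (d + Suc \<nu>) * (fact d * real (d + \<nu>) ^ \<nu>)"
    by (intro mult_left_mono Suc) simp
  also have "\<dots> \<le> real (d + Suc \<nu>) * (fact d * real (d + Suc \<nu>) ^ \<nu>)"
    by (intro mult_left_mono power_mono) auto
  finally show ?case by (simp add: mult_ac)
qed simp

context radial_weight
begin

text \<open>Shift and power are arbitrary because the moments are taken about A = \<Phi>(x), both at
  d and at d + 1, that is with B = -A and B = 1 - A.\<close>

lemma summable_coef: "summable (\<lambda>d. \<bar>(real d + B) ^ j * (coef \<nu> d * x ^ d)\<bar>)"
proof -
  define e :: real where "e = exp 1"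
  have e: "e > 0" "exp (real d) = e ^ d" for d by (auto simp: e_def exp_of_nat_mult[of d 1, simplified])
  \<comment> \<open>The polynomial factor and the quotient of factorials each cost at most e^d up to
    a constant; the choice of R leaves (e e |x| / R)^d \<le> (1/2)^d.\<close>
  define R where "R = 2 * e * e * (\<bar>x\<bar> + 1)"
  have R: "R > 0" using e by (simp add: R_def add_nonneg_pos)
  obtain C where C: "C > 0" "\<And>k. R ^ k * C \<le> mom k" using mom_growth[OF R] by blast
  define K where "K = fact j * exp \<bar>B\<bar> * (fact \<nu> * e ^ \<nu> / (R ^ \<nu> * C))"
  have term_le: "\<bar>(real d + B) ^ j * (coef \<nu> d * x ^ d)\<bar> \<le> K * (1/2) ^ d" for d
  proof -
    have "\<bar>(real d + B) ^ j\<bar> \<le> (real d + \<bar>B\<bar>) ^ j" unfolding power_abs by (intro power_mono) auto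
    also have "\<dots> \<le> fact j * exp (real d + \<bar>B\<bar>)" using power_le_exp[of 1 "real d + \<bar>B\<bar>" j] by simp
    also have "\<dots> = fact j * exp \<bar>B\<bar> * e ^ d" by (simp add: exp_add e)
    finally have 1: "\<bar>(real d + B) ^ j\<bar> \<le> fact j * exp \<bar>B\<bar> * e ^ d" .
    have "coef \<nu> d \<le> real (d + \<nu>) ^ \<nu> / mom (d + \<nu>)"
      using fact_add_le[of d \<nu>] mom_pos[of "d + \<nu>"] by (simp add: coef_def field_simps)
    also have "\<dots> \<le> (fact \<nu> * exp (real (d + \<nu>))) / (R ^ (d + \<nu>) * C)"
      using power_le_exp[of 1 "real (d + \<nu>)" \<nu>] C R by (intro frac_le) auto
    also have "\<dots> = (fact \<nu> * e ^ \<nu> / (R ^ \<nu> * C)) * (e ^ d / R ^ d)" 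
      unfolding e power_add by (simp add: mult_ac)
    finally have 2: "\<bar>coef \<nu> d\<bar> \<le> (fact \<nu> * e ^ \<nu> / (R ^ \<nu> * C)) * (e ^ d / R ^ d)"
      using coef_pos[of \<nu> d] by simp
    have "\<bar>(real d + B) ^ j * (coef \<nu> d * x ^ d)\<bar> = \<bar>(real d + B) ^ j\<bar> * (\<bar>coef \<nu> d\<bar> * \<bar>x\<bar> ^ d)"
      by (simp add: abs_mult power_abs)
    also have "\<dots> \<le> (fact j * exp \<bar>B\<bar> * e ^ d) * ((fact \<nu> * e ^ \<nu> / (R ^ \<nu> * C)) * (e ^ d / R ^ d) * \<bar>x\<bar> ^ d)"
      using 1 2 e C R by (intro mult_mono) auto
    also have "\<dots> = K * (e * e * \<bar>x\<bar> / R) ^ d"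
      by (simp add: K_def power_mult_distrib power_divide)
    also have "\<dots> \<le> K * (1/2) ^ d"
    proof (intro mult_left_mono power_mono)
      show "e * e * \<bar>x\<bar> / R \<le> 1/2" using R e by (simp add: R_def field_simps)
      show "K \<ge> 0" using e R C by (simp add: K_def)
    qed (use e R in auto)
    finally show ?thesis .
  qed
  show ?thesis
    by (rule summable_comparison_test'[where N = 0 and g = "\<lambda>d. K * (1/2) ^ d"])
       (use term_le in \<open>auto intro!: summable_mult summable_geometric\<close>)
qed

lemma summable_gen: "summable (\<lambda>d. coef \<nu> d * x ^ d)"
  using summable_rabs_cancel[OF summable_coef[of 0 0]] by simp

lemma gen_pos: "x \<ge> 0 \<Longrightarrow> gen \<nu> x > 0"
proof -
  assume x: "x \<ge> 0"
  have "0 < coef \<nu> 0" by (rule coef_pos)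
  also have "\<dots> = (\<Sum>d\<in>{0}. coef \<nu> d * x ^ d)" by simp
  also have "\<dots> \<le> gen \<nu> x" unfolding gen_def
    using x less_imp_le[OF coef_pos] by (intro sum_le_suminf summable_gen) auto
  finally show ?thesis .
qed

section \<open>Probability weights on the exponents\<close>

definition gen_mean :: "nat \<Rightarrow> real \<Rightarrow> real" where
  "gen_mean \<nu> x = (\<Sum>d. real d * (coef \<nu> d * x ^ d)) / gen \<nu> x"

definition gen_var :: "nat \<Rightarrow> real \<Rightarrow> real" where
  "gen_var \<nu> x = (\<Sum>d. (real d)\<^sup>2 * (coef \<nu> d * x ^ d)) / gen \<nu> x - (gen_mean \<nu> x)\<^sup>2"

definition gibbs :: "nat \<Rightarrow> real \<Rightarrow> nat measure" where
  "gibbs \<nu> x = density (count_space UNIV) (\<lambda>d. ennreal (coef \<nu> d * x ^ d / gen \<nu> x))"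

lemma has_bochner_integral_gibbs:
  assumes x: "x \<ge> 0" and f: "summable (\<lambda>d. \<bar>f d * (coef \<nu> d * x ^ d)\<bar>)"
  shows "has_bochner_integral (gibbs \<nu> x) f ((\<Sum>d. f d * (coef \<nu> d * x ^ d)) / gen \<nu> x)"
proof -
  have "has_bochner_integral (count_space UNIV) (\<lambda>d. f d * (coef \<nu> d * x ^ d)) (\<Sum>d. f d * (coef \<nu> d * x ^ d))"
    using f integrable_count_space_nat_iff[of "\<lambda>d. f d * (coef \<nu> d * x ^ d)"]
      integral_count_space_nat[of "\<lambda>d. f d * (coef \<nu> d * x ^ d)"]
    by (simp add: has_bochner_integral_iff)
  from has_bochner_integral_divide[OF this, of "gen \<nu> x"]
  have "has_bochner_integral (count_space UNIV) (\<lambda>d. (coef \<nu> d * x ^ d / gen \<nu> x) *\<^sub>R f d) ((\<Sum>d. f d * (coef \<nu> d * x ^ d)) / gen \<nu> x)"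
    by (simp add: mult_ac)
  then show ?thesis unfolding gibbs_def
    using x gen_pos[OF x, of \<nu>] less_imp_le[OF coef_pos] by (intro has_bochner_integral_density) auto
qed

lemma integrable_gibbs_power: "x \<ge> 0 \<Longrightarrow> integrable (gibbs \<nu> x) (\<lambda>d. (real d + B) ^ j)"
  using has_bochner_integral_gibbs[OF _ summable_coef] by (blast intro: integrable.intros)

lemma prob_space_gibbs: "x \<ge> 0 \<Longrightarrow> prob_space (gibbs \<nu> x)"
proof (rule prob_spaceI)
  assume x: "x \<ge> 0"
  have h: "has_bochner_integral (gibbs \<nu> x) (\<lambda>_. 1::real) 1"
    using has_bochner_integral_gibbs[OF x, of "\<lambda>_. 1" \<nu>] summable_coef[of 0 0 \<nu> x] gen_pos[OF x, of \<nu>]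
    by (simp add: gen_def)
  then have one: "measure (gibbs \<nu> x) (space (gibbs \<nu> x)) = 1"
    by (simp add: has_bochner_integral_iff)
  then have "emeasure (gibbs \<nu> x) (space (gibbs \<nu> x)) \<noteq> \<infinity>" by (auto simp: measure_def)
  then show "emeasure (gibbs \<nu> x) (space (gibbs \<nu> x)) = 1"
    using one by (simp add: emeasure_eq_ennreal_measure)
qed

text \<open>By \<open>coef_rho\<close>, multiplication by \<rho> shifts the summation index, and
  \<rho>_0 = 0 leaves no boundary term. Summability of the left-hand series is inherited from the
  shifted one, so no growth bound on \<open>rho\<close> enters.\<close>

lemma gibbs_shift:
  assumes x: "x \<ge> 0" and q: "integrable (gibbs \<nu> x) (\<lambda>d. q (Suc d))"
  shows "has_bochner_integral (gibbs \<nu> x) (\<lambda>d. q d * rho \<nu> d) (x * (\<integral>d. q (Suc d) \<partial>gibbs \<nu> x))"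
proof -
  define p where "p d = coef \<nu> d * x ^ d" for d
  have p0: "p d / gen \<nu> x \<ge> 0" for d using x gen_pos[OF x, of \<nu>] less_imp_le[OF coef_pos] by (simp add: p_def)
  have "integrable (count_space UNIV) (\<lambda>d. (p d / gen \<nu> x) *\<^sub>R q (Suc d))"
    using q unfolding gibbs_def p_def[symmetric] by (subst (asm) integrable_density) (auto simp: p0)
  then have "summable (\<lambda>d. \<bar>gen \<nu> x\<bar> * \<bar>(p d / gen \<nu> x) * q (Suc d)\<bar>)"
    unfolding integrable_count_space_nat_iff by (intro summable_mult) simp
  then have sm: "summable (\<lambda>d. \<bar>q (Suc d) * p d\<bar>)"
    using gen_pos[OF x, of \<nu>] by (simp add: abs_mult mult_ac)
  have eq: "q (Suc d) * rho \<nu> (Suc d) * p (Suc d) = x * (q (Suc d) * p d)" for d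
    using coef_rho[of \<nu> d, symmetric] by (simp add: p_def)
  have "summable (\<lambda>d. \<bar>q (Suc d) * rho \<nu> (Suc d) * p (Suc d)\<bar>)"
    unfolding eq abs_mult[of x] by (intro summable_mult sm)
  then have sm2: "summable (\<lambda>d. \<bar>q d * rho \<nu> d * p d\<bar>)" by (subst (asm) summable_Suc_iff)
  have "(\<Sum>d. q d * rho \<nu> d * p d) = (\<Sum>d. q (Suc d) * rho \<nu> (Suc d) * p (Suc d))"
    using suminf_split_head[OF summable_rabs_cancel[OF sm2]] by simp
  also have "\<dots> = x * (\<Sum>d. q (Suc d) * p d)"
    unfolding eq by (rule suminf_mult[OF summable_rabs_cancel[OF sm]])
  finally have "(\<Sum>d. q d * rho \<nu> d * p d) / gen \<nu> x = x * ((\<Sum>d. q (Suc d) * p d) / gen \<nu> x)" by simp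
  moreover have "has_bochner_integral (gibbs \<nu> x) (\<lambda>d. q d * rho \<nu> d) ((\<Sum>d. q d * rho \<nu> d * p d) / gen \<nu> x)"
    using has_bochner_integral_gibbs[OF x sm2[unfolded p_def]] by (simp only: p_def)
  moreover have "(\<integral>d. q (Suc d) \<partial>gibbs \<nu> x) = (\<Sum>d. q (Suc d) * p d) / gen \<nu> x"
    using has_bochner_integral_gibbs[OF x sm[unfolded p_def]]
    by (simp only: p_def has_bochner_integral_iff)
  ultimately show ?thesis by (simp only:)
qed

end

section \<open>Mean and variance of the exponent\<close>

context flat_weight
begin

text \<open>Let a be the solution of \<Phi>(a) = d + \<nu>. The error splits into four quarters of
  \<epsilon>: the moment ratio against a, the factor d/(d+\<nu>), the affine approximation of \<Phi>
  between a and x, and the shift of d by \<nu>.\<close>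

lemma rho_expansion:
  assumes R: "R > 0" and eps: "0 < \<epsilon>" "\<epsilon> \<le> 1"
  shows "\<forall>\<^sub>F x in at_top. \<forall>d. \<bar>real d - Phi x\<bar> \<le> R * W x \<longrightarrow>
    \<bar>(rho \<nu> d - x) / w x - (real d - Phi x) / W x\<bar> \<le> \<epsilon>"
proof -
  \<comment> \<open>The precision \<epsilon>/8 is in units of w(a); \<open>w2\<close> later converts
    it into \<epsilon>/4 in units of w(x).\<close>
  obtain T where T: "\<And>a k. a \<ge> T \<Longrightarrow> Phi a = real (Suc k) \<Longrightarrow> \<bar>mom (Suc k) / mom k - a\<bar> \<le> \<epsilon> / 8 * w a"
    using moment_ratio[of "\<epsilon> / 8"] eps unfolding eventually_at_top_linorder by auto
  have M: "R + 2 > 0" and e4: "\<epsilon> / 4 > 0" using R eps by auto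
  show ?thesis
    using window[OF M e4] eventually_ge_at_top[of "2 * T"] W_ge[of "real \<nu>"] W_ge[of "4 * real \<nu> / \<epsilon>"]
      W_le_Phi[of "2 * R"] W_le_Phi[of "24 * real \<nu> / \<epsilon>"]
  proof eventually_elim
    case (elim x)
    then have x: "x > 0" and half: "(R + 2) * w x \<le> x / 2"
      and lin: "\<And>\<tau>. \<bar>\<tau> - x\<bar> \<le> (R + 2) * w x \<Longrightarrow> \<bar>Phi \<tau> - Phi x - \<phi> x * (\<tau> - x)\<bar> \<le> \<epsilon> / 4 * W x"
      and w2: "\<And>\<tau>. \<bar>\<tau> - x\<bar> \<le> (R + 2) * w x \<Longrightarrow> w \<tau> \<le> 2 * w x" by blast+
    note wW = w_W[OF x]
    define A where "A = Phi x"
    show ?case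
    proof (intro allI impI)
      fix d assume d: "\<bar>real d - Phi x\<bar> \<le> R * W x"
      have RW: "R * W x > 0" using R wW by simp
      have A2: "2 * (R * W x) \<le> A" using elim(5) by (simp add: A_def)
      have dA: "real d \<ge> A / 2" using d A2 by (simp add: A_def abs_if split: if_splits)
      have "A > 0" using A2 RW by simp
      then obtain d' where d': "d = Suc d'" using dA by (cases d) auto
      \<comment> \<open>k = d + \<nu> - 1 is the index of the moment ratio in
        \<open>rho \<nu> d\<close>, so that \<Phi>(a) = k + 1 = d + \<nu>.\<close>
      define k where "k = d' + \<nu>"
      obtain a where a: "a \<ge> 0" "Phi a = real (Suc k)" using Phi_surj[of "real (Suc k)"] by auto
      have k: "real (Suc k) = real d + real \<nu>" by (simp add: k_def d')
      have near: "\<bar>Phi a - A\<bar> \<le> (R + 1) * W x"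
        using d elim(3) unfolding a(2) k A_def by (simp add: algebra_simps)
      have edge: "\<bar>Phi (x + s * ((R + 2) * w x)) - A - s * ((R + 2) * W x)\<bar> \<le> \<epsilon> / 4 * W x" if "\<bar>s\<bar> = 1" for s
      proof -
        have "\<phi> x * (s * ((R + 2) * w x)) = s * ((R + 2) * (\<phi> x * w x))" by (simp add: mult_ac)
        also have "\<dots> = s * ((R + 2) * W x)" by (simp only: wW(4))
        finally have eq: "\<phi> x * (s * ((R + 2) * w x)) = s * ((R + 2) * W x)" .
        have "\<bar>(x + s * ((R + 2) * w x)) - x\<bar> \<le> (R + 2) * w x"
          using wW(1) R that by (simp add: abs_mult)
        from lin[OF this] show ?thesis unfolding add_diff_cancel_left' eq A_def .
      qed
      have eW: "\<epsilon> / 4 * W x < W x" using eps wW(2) by simp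
      have RW2: "(R + 2) * W x = (R + 1) * W x + W x" by (simp add: algebra_simps)
      \<comment> \<open>\<Phi>(a) is within (R+1) W of A, R for d and 1 for the shift \<nu> \<le> W,
        whereas at x - (R+2) w and x + (R+2) w the function has already moved by more than that.
        Monotonicity confines a between these points; this is why the window has R + 2
        widths.\<close>
      have ax: "\<bar>a - x\<bar> \<le> (R + 2) * w x"
      proof (rule ccontr)
        assume "\<not> ?thesis"
        then consider "x + (R + 2) * w x \<le> a" | "a \<le> x - (R + 2) * w x" by linarith
        then show False
        proof cases
          case 1
          from Phi_le[OF this] edge[of 1] near eW RW2 show False by (smt (verit) mult_1)
        next
          case 2
          have "\<bar>Phi (x - (R + 2) * w x) - A + (R + 2) * W x\<bar> \<le> \<epsilon> / 4 * W x" using edge[of "-1"] by simp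
          with Phi_le[OF 2] near eW RW2 show False by (smt (verit))
        qed
      qed
      have t2: "\<bar>(a - x) / w x - (real d + real \<nu> - A) / W x\<bar> \<le> \<epsilon> / 4"
      proof -
        have "\<bar>(real d + real \<nu> - A) - \<phi> x * (a - x)\<bar> \<le> \<epsilon> / 4 * W x" using lin[OF ax] unfolding a(2) k A_def by simp
        moreover have "\<phi> x * (a - x) = W x * ((a - x) / w x)" unfolding wW(4)[symmetric] using wW(1) by simp
        moreover have "real d + real \<nu> - A = W x * ((real d + real \<nu> - A) / W x)" using wW(2) by simp
        ultimately have "\<bar>W x * ((real d + real \<nu> - A) / W x - (a - x) / w x)\<bar> \<le> \<epsilon> / 4 * W x"
          by (metis right_diff_distrib)
        then have "\<bar>(real d + real \<nu> - A) / W x - (a - x) / w x\<bar> \<le> \<epsilon> / 4"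
          using wW(2) by (simp add: abs_mult mult.commute)
        then show ?thesis by (simp add: abs_minus_commute)
      qed
      define m where "m = mom (Suc k) / mom k"
      have m0: "m \<ge> 0" using less_imp_le[OF mom_pos] by (simp add: m_def)
      have "a \<ge> T" using ax half elim(2) by (simp add: abs_if split: if_splits)
      from T[OF this a(2)] have "\<bar>m - a\<bar> \<le> \<epsilon> / 8 * w a" by (simp add: m_def)
      also have "\<dots> \<le> \<epsilon> / 8 * (2 * w x)" using w2[OF ax] eps by (intro mult_left_mono) auto
      finally have ma: "\<bar>m - a\<bar> \<le> \<epsilon> / 4 * w x" by simp
      have "\<epsilon> / 4 * w x \<le> 1 * w x" using eps wW(1) by (intro mult_right_mono) auto
      moreover have "1 * w x \<le> (R + 2) * w x" using R wW(1) by (intro mult_right_mono) auto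
      ultimately have m3: "m \<le> 3 * x" using ma ax half x by (simp add: abs_if split: if_splits)
      have rho: "rho \<nu> d = m - m * (real \<nu> / (real d + real \<nu>))"
      proof -
        have "real d / (real d + real \<nu>) = 1 - real \<nu> / (real d + real \<nu>)" using d' by (simp add: field_simps)
        moreover have "rho \<nu> d = real d / (real d + real \<nu>) * m" by (simp add: rho_def m_def k_def d')
        ultimately have "rho \<nu> d = (1 - real \<nu> / (real d + real \<nu>)) * m" by (simp only:)
        also have "\<dots> = 1 * m - real \<nu> / (real d + real \<nu>) * m" by (rule left_diff_distrib)
        finally show ?thesis by (simp only: mult_1 mult.commute)
      qed
      \<comment> \<open>Cost of the factor d/(d+\<nu>): with m \<le> 3x and d \<ge> A/2 it is at
        most 6 \<nu> x / A = 6 \<nu> w W / A, and W is a small fraction of A by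
        \<open>W_le_Phi\<close> with the constant 24 \<nu>/\<epsilon>.\<close>
      have "m * (real \<nu> / (real d + real \<nu>)) \<le> 3 * x * (real \<nu> / (A / 2))"
        using m3 m0 dA \<open>A > 0\<close> x by (intro mult_mono divide_left_mono) (auto intro!: add_pos_nonneg)
      also have "\<dots> = 6 * real \<nu> / A * x" by simp
      also have "\<dots> = 6 * real \<nu> / A * (w x * W x)" by (simp only: wW(3))
      also have "\<dots> = (24 * real \<nu> / \<epsilon> * W x) * (\<epsilon> / 4 * w x / A)" using eps \<open>A > 0\<close> by (simp add: field_simps)
      also have "\<dots> \<le> A * (\<epsilon> / 4 * w x / A)" using elim(6) wW eps \<open>A > 0\<close>
        by (intro mult_right_mono) (auto simp: A_def)
      also have "\<dots> = \<epsilon> / 4 * w x" using \<open>A > 0\<close> by simp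
      finally have mn: "m * (real \<nu> / (real d + real \<nu>)) \<le> \<epsilon> / 4 * w x" .
      define q where "q = m * (real \<nu> / (real d + real \<nu>))"
      have "q \<ge> 0" using m0 by (simp add: q_def)
      have "rho \<nu> d - a = (m - a) - q" unfolding rho q_def by simp
      then have "\<bar>rho \<nu> d - a\<bar> \<le> \<bar>m - a\<bar> + \<bar>q\<bar>" by (simp only: abs_triangle_ineq4)
      also have "\<dots> \<le> \<epsilon> / 4 * w x + \<epsilon> / 4 * w x" using ma mn[folded q_def] \<open>q \<ge> 0\<close> by (intro add_mono) auto
      finally have "\<bar>rho \<nu> d - a\<bar> \<le> (\<epsilon> / 2) * w x" by simp
      then have t1: "\<bar>(rho \<nu> d - a) / w x\<bar> \<le> \<epsilon> / 2" using wW(1) by (simp add: abs_divide pos_divide_le_eq)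
      have t3: "\<bar>real \<nu> / W x\<bar> \<le> \<epsilon> / 4" using elim(4) wW(2) eps by (simp add: field_simps)
      have "(rho \<nu> d - x) / w x - (real d - Phi x) / W x
        = (rho \<nu> d - a) / w x + ((a - x) / w x - (real d + real \<nu> - A) / W x) + real \<nu> / W x"
        by (simp add: A_def add_divide_distrib diff_divide_distrib)
      moreover have "\<bar>r + s + t\<bar> \<le> \<epsilon>" if "\<bar>r\<bar> \<le> \<epsilon> / 2" "\<bar>s\<bar> \<le> \<epsilon> / 4" "\<bar>t\<bar> \<le> \<epsilon> / 4" for r s t
        using that by linarith
      ultimately show "\<bar>(rho \<nu> d - x) / w x - (real d - Phi x) / W x\<bar> \<le> \<epsilon>" using t1 t2 t3 by (simp only:)
    qed
  qed
qed

text \<open>\<open>near_linear_moments\<close> with X = (d - A)/W and Y = (\<rho>_d - x)/w. The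
  shift identity replaces the derivative by a difference with constant factor x, so E[X Y] = 1 holds
  exactly and E[X^3 Y] contains only first and second moments.\<close>

lemma gen_mean_var_asymp:
  assumes \<delta>: "\<delta> > 0"
  shows "\<forall>\<^sub>F x in at_top. \<bar>gen_mean \<nu> x - Phi x\<bar> \<le> \<delta> * Phi x \<and> \<bar>gen_var \<nu> x - x * \<phi> x\<bar> \<le> \<delta> * (x * \<phi> x)"
proof -
  \<comment> \<open>Halved because the variance collects two errors, that of E[X^2] and the square
    of E[X]; capped at 1 so that the square of a number up to \<delta>' is again at most
    \<delta>'.\<close>
  define \<delta>' where "\<delta>' = min (\<delta> / 2) 1"
  have \<delta>': "\<delta>' > 0" "\<delta>' \<le> 1" "\<delta>' \<le> \<delta> / 2" using \<delta> by (auto simp: \<delta>'_def)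
  obtain R \<epsilon> :: real where R: "R \<ge> 10" and eps: "0 < \<epsilon>" "\<epsilon> \<le> 1/8" and err: "8 * \<epsilon> + 88 / R\<^sup>2 \<le> \<delta>'"
    using error_parameters[OF \<delta>'(1)] .
  have R0: "R > 0" and eps1: "\<epsilon> \<le> 1" using R eps by auto
  show ?thesis
    using rho_expansion[OF R0 eps(1) eps1, of \<nu>] eventually_gt_at_top[of 0] W_ge[of 1] W_le_Phi[of 1] W_le_Phi[of "R + 1"]
  proof eventually_elim
    case (elim x)
    have x: "x > 0" "x \<ge> 0" using elim(2) by auto
    note wW = w_W[OF x(1)]
    define A where "A = Phi x"
    have A: "A \<ge> W x" "A \<ge> (R + 1) * W x" using elim(4,5) by (auto simp: A_def)
    interpret N: prob_space "gibbs \<nu> x" by (rule prob_space_gibbs[OF x(2)])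
    let ?E = "\<lambda>f. \<integral>d. f d \<partial>gibbs \<nu> x"
    define X where "X d = (real d - A) / W x" for d
    define Y where "Y d = (rho \<nu> d - x) / w x" for d
    have int: "integrable (gibbs \<nu> x) (\<lambda>d. (real d - A) ^ j)" for j
      using integrable_gibbs_power[OF x(2), of \<nu> "-A" j] by simp
    have intS: "integrable (gibbs \<nu> x) (\<lambda>d. (real (Suc d) - A) ^ j)" for j
      using integrable_gibbs_power[OF x(2), of \<nu> "1-A" j] by (simp add: algebra_simps)
    have shift: "has_bochner_integral (gibbs \<nu> x) (\<lambda>d. (real d - A) ^ j * (rho \<nu> d - x))
        (x * ?E (\<lambda>d. (real (Suc d) - A) ^ j - (real d - A) ^ j))" for j
    proof -
      have "has_bochner_integral (gibbs \<nu> x) (\<lambda>d. (real d - A) ^ j * rho \<nu> d - x * (real d - A) ^ j)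
        (x * ?E (\<lambda>d. (real (Suc d) - A) ^ j) - x * ?E (\<lambda>d. (real d - A) ^ j))"
        by (intro has_bochner_integral_diff gibbs_shift[OF x(2), of \<nu> "\<lambda>d. (real d - A) ^ j"] intS
            has_bochner_integral_mult_right has_bochner_integral_integrable int)
      then show ?thesis using int intS by (simp add: algebra_simps)
    qed
    define E1 E2 where "E1 = ?E (\<lambda>d. real d - A)" and "E2 = ?E (\<lambda>d. (real d - A)\<^sup>2)"
    have i1: "integrable (gibbs \<nu> x) (\<lambda>d. real d - A)" and i2: "integrable (gibbs \<nu> x) (\<lambda>d. (real d - A)\<^sup>2)"
      using int[of 1] int[of 2] by simp_all
    have EX: "?E X = E1 / W x" and intX: "integrable (gibbs \<nu> x) X" unfolding X_def E1_def using i1 by auto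
    have EXX: "?E (\<lambda>d. (X d)\<^sup>2) = E2 / (W x)\<^sup>2" and intXX: "integrable (gibbs \<nu> x) (\<lambda>d. (X d)\<^sup>2)"
      unfolding X_def E2_def power_divide using i2 by auto
    have hY: "has_bochner_integral (gibbs \<nu> x) Y 0"
      using has_bochner_integral_divide[OF shift[of 0], of "w x"] by (simp add: Y_def[abs_def])
    have hXY: "has_bochner_integral (gibbs \<nu> x) (\<lambda>d. X d * Y d) 1"
    proof -
      have "has_bochner_integral (gibbs \<nu> x) (\<lambda>d. (real d - A) ^ 1 * (rho \<nu> d - x) / (W x * w x)) (x * 1 / (W x * w x))"
        using has_bochner_integral_divide[OF shift[of 1], of "W x * w x"] by (simp add: N.prob_space)
      moreover have "W x * w x = x" using wW(3) by (simp add: mult.commute)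
      ultimately show ?thesis using x by (simp add: X_def Y_def)
    qed
    have hX3Y: "has_bochner_integral (gibbs \<nu> x) (\<lambda>d. X d ^ 3 * Y d) ((3 * E2 + 3 * E1 + 1) / (W x)\<^sup>2)"
    proof -
      have "(real (Suc d) - A) ^ 3 - (real d - A) ^ 3 = 3 * (real d - A)\<^sup>2 + 3 * (real d - A) + 1" for d
        by (simp add: power2_eq_square power3_eq_cube algebra_simps)
      then have "?E (\<lambda>d. (real (Suc d) - A) ^ 3 - (real d - A) ^ 3) = ?E (\<lambda>d. 3 * (real d - A)\<^sup>2 + 3 * (real d - A) + 1)"
        by (simp only:)
      also have "\<dots> = 3 * E2 + 3 * E1 + 1" using i1 i2
        by (simp only: E1_def E2_def Bochner_Integration.integral_add integrable_mult_right Bochner_Integration.integrable_add integral_mult_right_zero integrable_const N.finite_measure_axioms N.prob_space N.integrable_const lebesgue_integral_const) (simp add: N.prob_space)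
      finally have E3: "?E (\<lambda>d. (real (Suc d) - A) ^ 3 - (real d - A) ^ 3) = 3 * E2 + 3 * E1 + 1" .
      have "has_bochner_integral (gibbs \<nu> x) (\<lambda>d. (real d - A) ^ 3 * (rho \<nu> d - x) / (W x ^ 3 * w x))
        (x * (3 * E2 + 3 * E1 + 1) / (W x ^ 3 * w x))"
        using has_bochner_integral_divide[OF shift[of 3], of "W x ^ 3 * w x"] unfolding E3 .
      moreover have "(real d - A) ^ 3 * (rho \<nu> d - x) / (W x ^ 3 * w x) = X d ^ 3 * Y d" for d
        by (simp add: X_def Y_def power_divide)
      moreover have "x * (3 * E2 + 3 * E1 + 1) / (W x ^ 3 * w x) = (3 * E2 + 3 * E1 + 1) / (W x)\<^sup>2"
      proof -
        have "x * (3 * E2 + 3 * E1 + 1) / (W x ^ 3 * w x) = (w x * W x) * (3 * E2 + 3 * E1 + 1) / (W x ^ 3 * w x)"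
          by (simp only: wW(3))
        also have "\<dots> = (3 * E2 + 3 * E1 + 1) / (W x)\<^sup>2" using wW(1,2) by (simp add: power2_eq_square power3_eq_cube)
        finally show ?thesis .
      qed
      ultimately show ?thesis by (simp only:)
    qed
    define S where "S = E2 / (W x)\<^sup>2"
    have E20: "E2 \<ge> 0" unfolding E2_def by simp
    have S0: "S \<ge> 0" using E20 by (simp add: S_def)
    have W1: "(W x)\<^sup>2 \<ge> 1" using elim(3) by simp
    have inner: "\<bar>Y d - X d\<bar> \<le> \<epsilon>" if "\<bar>X d\<bar> \<le> R" for d
      using elim(1) that wW(2) unfolding X_def Y_def A_def by (simp add: abs_divide pos_divide_le_eq)
    have Ymono: "Y d \<le> Y d'" if "d \<le> d'" for d d'
      using rho_mono[OF that, of \<nu>] wW(1) by (simp add: Y_def divide_right_mono)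
    have iW: "1 / W x \<le> 1" using elim(3) by simp
    have RW: "R * W x \<ge> 10" using mult_mono[of 10 R 1 "W x"] R elim(3) by simp
    have right: "Y d \<ge> R / 2" if "X d > R" for d
    proof -
      have dd: "real d > A + R * W x" using that wW(2) by (simp add: X_def field_simps)
      \<comment> \<open>The edge A + R W need not be an integer. The last integer before it has X
        \<ge> R - 1/W \<ge> R - 1, so Y there is at least R - 1 - \<epsilon>, still above
        R/2.\<close>
      define d1 where "d1 = nat \<lfloor>A + R * W x\<rfloor>"
      have pos: "A + R * W x \<ge> 0" using A RW wW(2) by simp
      have d1: "real d1 \<le> A + R * W x" "real d1 \<ge> A + R * W x - 1" unfolding d1_def using pos by linarith+
      have X1: "X d1 \<le> R" "X d1 \<ge> R - 1" 
      proof -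
        show "X d1 \<le> R" using d1 wW(2) by (simp add: X_def field_simps)
        have "R - 1 \<le> R - 1 / W x" using iW by simp
        also have "\<dots> = (R * W x - 1) / W x" using wW(2) by (simp add: diff_divide_distrib)
        also have "\<dots> \<le> X d1" unfolding X_def using d1 wW(2) by (intro divide_right_mono) auto
        finally show "X d1 \<ge> R - 1" .
      qed
      have "d1 \<le> d" using d1 dd by linarith
      then have "Y d1 \<le> Y d" by (rule Ymono)
      moreover have "\<bar>X d1\<bar> \<le> R" using X1 R by simp
      from inner[OF this] have "Y d1 \<ge> R - 1 - \<epsilon>" using X1 by (simp add: abs_if split: if_splits)
      ultimately show ?thesis using eps R by simp
    qed
    have left: "Y d \<le> - R / 2" if "X d < - R" for d
    proof -
      have dd: "real d < A - R * W x" using that wW(2) by (simp add: X_def field_simps)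
      define d1 where "d1 = nat \<lceil>A - R * W x\<rceil>"
      have pos: "A - R * W x \<ge> 0" using A wW(2) by (simp add: algebra_simps)
      have d1: "real d1 \<ge> A - R * W x" "real d1 \<le> A - R * W x + 1" unfolding d1_def using pos by linarith+
      have X1: "X d1 \<ge> - R" "X d1 \<le> - R + 1" 
      proof -
        show "X d1 \<ge> - R" using d1 wW(2) by (simp add: X_def field_simps)
        have "X d1 \<le> (- (R * W x) + 1) / W x" unfolding X_def using d1 wW(2) by (intro divide_right_mono) auto
        also have "\<dots> = - R + 1 / W x" using wW(2) by (simp add: diff_divide_distrib)
        also have "\<dots> \<le> - R + 1" using iW by simp
        finally show "X d1 \<le> - R + 1" .
      qed
      have "d \<le> d1" using d1 dd by linarith
      then have "Y d \<le> Y d1" by (rule Ymono)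
      moreover have "\<bar>X d1\<bar> \<le> R" using X1 R by simp
      from inner[OF this] have "Y d1 \<le> - R + 1 + \<epsilon>" using X1 by (simp add: abs_if split: if_splits)
      ultimately show ?thesis using eps R by simp
    qed
    have "E1 \<le> ?E (\<lambda>d. 1 + (real d - A)\<^sup>2)" unfolding E1_def
    proof (rule integral_mono)
      have "z \<le> 1 + z\<^sup>2" for z :: real 
      proof (cases "z \<le> 0")
        case True
        then show ?thesis by (intro order_trans[of z 0 "1 + z\<^sup>2"]) auto
      next
        case False
        then show ?thesis using sum_squares_bound[of 1 z] by (intro order_trans[of z "2 * z" "1 + z\<^sup>2"]) auto
      qed
      then show "real d - A \<le> 1 + (real d - A)\<^sup>2" for d .
    qed (use i1 i2 in auto)
    then have "E1 \<le> 1 + E2" using i2 by (simp add: E2_def N.prob_space)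
    then have "(3 * E2 + 3 * E1 + 1) / (W x)\<^sup>2 \<le> (6 * E2 + 4) / (W x)\<^sup>2" by (intro divide_right_mono) auto
    also have "\<dots> \<le> 6 * S + 4" using W1 frac_le[of 4 4 1 "(W x)\<^sup>2"] by (simp add: S_def add_divide_distrib)
    also have "\<dots> \<le> 10 * (1 + S)" using S0 by simp
    finally have c3: "?E (\<lambda>d. X d ^ 3 * Y d) \<le> 10 * (1 + ?E (\<lambda>d. (X d)\<^sup>2))"
      using hX3Y[THEN has_bochner_integral_integral_eq] unfolding EXX S_def by simp
    have c1: "\<bar>?E (\<lambda>d. X d * Y d) - 1\<bar> \<le> \<epsilon> * (1 + ?E (\<lambda>d. (X d)\<^sup>2))"
      using hXY[THEN has_bochner_integral_integral_eq] eps by simp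
    note fin = N.near_linear_moments[OF R eps intX hY[THEN integrable.intros] intXX hXY[THEN integrable.intros]
        hX3Y[THEN integrable.intros] hY[THEN has_bochner_integral_integral_eq] c1 c3 inner right left]
    have f1: "\<bar>S - 1\<bar> \<le> \<delta>'" using fin(1) err unfolding EXX S_def by simp
    have f2: "\<bar>E1 / W x\<bar> \<le> \<delta>'" using fin(2) err unfolding EX by simp
    have i0: "integrable (gibbs \<nu> x) real" using integrable_gibbs_power[OF x(2), of \<nu> 0 1] by simp
    have i00: "integrable (gibbs \<nu> x) (\<lambda>d. (real d)\<^sup>2)" using integrable_gibbs_power[OF x(2), of \<nu> 0 2] by simp
    have mean: "gen_mean \<nu> x = ?E real"
      using has_bochner_integral_gibbs[OF x(2), of real \<nu>] summable_coef[of 0 1 \<nu> x]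
      by (simp add: gen_mean_def has_bochner_integral_iff)
    have m1: "gen_mean \<nu> x = E1 + A" unfolding mean E1_def using i0 by (simp add: N.prob_space)
    have m2: "(\<Sum>d. (real d)\<^sup>2 * (coef \<nu> d * x ^ d)) / gen \<nu> x = ?E (\<lambda>d. (real d)\<^sup>2)"
      using has_bochner_integral_gibbs[OF x(2), of "\<lambda>d. (real d)\<^sup>2" \<nu>] summable_coef[of 0 2 \<nu> x]
      by (simp add: has_bochner_integral_iff)
    have "E2 = ?E (\<lambda>d. (real d)\<^sup>2 - (2 * A) * real d + A\<^sup>2)"
      unfolding E2_def by (simp add: power2_eq_square algebra_simps)
    also have "\<dots> = ?E (\<lambda>d. (real d)\<^sup>2) - 2 * A * (E1 + A) + A\<^sup>2"
      using i0 i00 mean m1 by (simp add: N.prob_space)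
    finally have "gen_var \<nu> x = E2 - E1\<^sup>2"
      unfolding gen_var_def m2 m1 by (simp add: power2_eq_square algebra_simps)
    then have var: "gen_var \<nu> x = (W x)\<^sup>2 * (S - (E1 / W x)\<^sup>2)"
      using wW(2) by (simp add: S_def power_divide right_diff_distrib)
    have W2: "(W x)\<^sup>2 = x * \<phi> x" using x phi_pos[of x] by (simp add: W_def)
    have "\<bar>E1 / W x\<bar>\<^sup>2 \<le> \<delta>' * 1" unfolding power2_eq_square using f2 \<delta>' by (intro mult_mono) auto
    then have "(E1 / W x)\<^sup>2 \<le> \<delta>'" by (simp only: power2_abs mult_1_right)
    moreover have "\<bar>(S - 1) - (E1 / W x)\<^sup>2\<bar> \<le> \<bar>S - 1\<bar> + \<bar>(E1 / W x)\<^sup>2\<bar>" by (rule abs_triangle_ineq4)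
    ultimately have "\<bar>(S - 1) - (E1 / W x)\<^sup>2\<bar> \<le> \<delta>' + \<delta>'" using f1 by simp
    then have "\<bar>S - (E1 / W x)\<^sup>2 - 1\<bar> \<le> \<delta>" using \<delta>'(3) by (simp add: algebra_simps)
    then have "x * \<phi> x * \<bar>S - (E1 / W x)\<^sup>2 - 1\<bar> \<le> x * \<phi> x * \<delta>"
      using x phi_pos[of x] by (intro mult_left_mono) auto
    moreover have "\<bar>gen_var \<nu> x - x * \<phi> x\<bar> = x * \<phi> x * \<bar>S - (E1 / W x)\<^sup>2 - 1\<bar>"
    proof -
      have "gen_var \<nu> x - x * \<phi> x = (x * \<phi> x) * (S - (E1 / W x)\<^sup>2 - 1)" unfolding var W2 by (simp add: algebra_simps)
      moreover have "\<bar>x * \<phi> x\<bar> = x * \<phi> x" using x phi_pos[of x] by simp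
      ultimately show ?thesis by (simp only: abs_mult[of "x * \<phi> x"])
    qed
    ultimately have v: "\<bar>gen_var \<nu> x - x * \<phi> x\<bar> \<le> \<delta> * (x * \<phi> x)" by (simp add: mult.commute)
    have "\<bar>gen_mean \<nu> x - Phi x\<bar> = \<bar>E1 / W x\<bar> * W x" using m1 wW(2) by (simp add: A_def)
    also have "\<dots> \<le> \<delta> * Phi x" using f2 \<delta>' A(1) wW(2) by (intro mult_mono) (auto simp: A_def)
    finally show ?case using v by simp
  qed
qed

end

section \<open>Radial integrals\<close>

lemma lborel_integral_scaleR:
  fixes f :: "'a::euclidean_space \<Rightarrow> 'b::{banach, second_countable_topology}"
  assumes [measurable]: "f \<in> borel_measurable borel" and c: "c > 0"
  shows "(\<integral>z. f z \<partial>lborel) = c ^ DIM('a) *\<^sub>R (\<integral>z. f (c *\<^sub>R z) \<partial>lborel)"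
proof -
  have "(\<integral>z. f z \<partial>lborel) = (\<integral>z. f z \<partial>density (distr lborel borel (\<lambda>x. 0 + c *\<^sub>R x)) (\<lambda>_. \<bar>c\<bar> ^ DIM('a)))"
    using c by (subst lborel_affine[of c 0]) auto
  also have "\<dots> = (\<integral>z. c ^ DIM('a) *\<^sub>R f z \<partial>distr lborel borel (\<lambda>x. 0 + c *\<^sub>R x))"
    using c by (subst integral_density) auto
  also have "\<dots> = (\<integral>z. c ^ DIM('a) *\<^sub>R f (0 + c *\<^sub>R z) \<partial>lborel)"
    by (subst integral_distr) auto
  finally show ?thesis by simp
qed

lemma lborel_integral_translate:
  fixes f :: "'a::euclidean_space \<Rightarrow> 'b::{banach, second_countable_topology}"
  assumes f: "integrable lborel f"
  shows "(\<integral>z. f (z + v) \<partial>lborel) = (\<integral>z. f z \<partial>lborel)" "integrable lborel (\<lambda>z. f (z + v))"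
proof -
  have [measurable]: "f \<in> borel_measurable borel" using f by auto
  have d: "lborel = distr lborel borel (\<lambda>z::'a. v + z)"
    by (simp add: lborel_distr_plus)
  show "(\<integral>z. f (z + v) \<partial>lborel) = (\<integral>z. f z \<partial>lborel)"
    by (subst (2) d, subst integral_distr) (auto simp: add.commute)
  have "integrable (distr lborel borel (\<lambda>z::'a. v + z)) f" using f d by simp
  then show "integrable lborel (\<lambda>z. f (z + v))"
    by (subst (asm) integrable_distr_eq) (auto simp: add.commute)
qed

lemma integral_homogeneous_cball:
  fixes f :: "'a::euclidean_space \<Rightarrow> 'b::{banach, second_countable_topology}"
  assumes [measurable]: "f \<in> borel_measurable borel" and hom: "\<And>r z. r > 0 \<Longrightarrow> f (r *\<^sub>R z) = r ^ D *\<^sub>R f z"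
    and \<rho>: "\<rho> \<ge> 0"
  shows "(\<integral>z. indicator (cball 0 \<rho>) z *\<^sub>R f z \<partial>lborel) = \<rho> ^ (D + DIM('a)) *\<^sub>R (\<integral>z. indicator (cball 0 1) z *\<^sub>R f z \<partial>lborel)"
proof (cases "\<rho> = 0")
  case True
  have "AE z in lborel. indicator (cball 0 \<rho>) z *\<^sub>R f z = 0"
    using AE_lborel_singleton[of "0::'a"] by eventually_elim (simp add: True)
  then have "(\<integral>z. indicator (cball 0 \<rho>) z *\<^sub>R f z \<partial>lborel) = 0" by (rule integral_eq_zero_AE)
  then show ?thesis using True by simp
next
  case False
  then have pos: "\<rho> > 0" using \<rho> by simp
  have "(\<integral>z. indicator (cball 0 \<rho>) z *\<^sub>R f z \<partial>lborel) = \<rho> ^ DIM('a) *\<^sub>R (\<integral>z. indicator (cball 0 \<rho>) (\<rho> *\<^sub>R z) *\<^sub>R f (\<rho> *\<^sub>R z) \<partial>lborel)"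
    by (intro lborel_integral_scaleR[OF _ pos] borel_measurable_scaleR borel_measurable_indicator assms(1)) simp
  also have "(\<lambda>z. indicator (cball 0 \<rho>) (\<rho> *\<^sub>R z) *\<^sub>R f (\<rho> *\<^sub>R z)) = (\<lambda>z. \<rho> ^ D *\<^sub>R (indicator (cball 0 1) z *\<^sub>R f z))"
    using pos hom[OF pos] by (auto simp: fun_eq_iff indicator_def mult_le_cancel_left1)
  finally show ?thesis unfolding integral_scaleR_right by (simp add: power_add mult.commute)
qed

lemma integrable_continuous_cball:
  fixes f :: "'a::euclidean_space \<Rightarrow> 'b::{banach, second_countable_topology}"
  assumes f: "continuous_on UNIV f"
  shows "integrable lborel (\<lambda>z. indicator (cball 0 \<rho>) z *\<^sub>R f z)"
  by (intro borel_integrable_compact continuous_on_subset[OF f]) auto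

context radial_weight
begin

lemma tail_density:
  assumes "s \<ge> 0"
  shows "has_bochner_integral lborel (\<lambda>r. indicator {s..} r * (\<psi> r * exp (- \<Psi> r))) (exp (- \<Psi> s))"
proof -
  have "(\<integral>\<^sup>+r. ennreal (\<psi> r * exp (- \<Psi> r)) * indicator {s..} r \<partial>lborel) = 0 - (- exp (- \<Psi> s))"
  proof (rule nn_integral_FTC_atLeast)
    show "((\<lambda>r. - exp (- \<Psi> r)) has_real_derivative \<psi> x * exp (- \<Psi> x)) (at x)" for x
      by (rule derivative_eq_intros deriv refl)+ simp
    show "((\<lambda>r. - exp (- \<Psi> r)) \<longlongrightarrow> 0) at_top"
    proof -
      have "((\<lambda>r. exp (- \<Psi> r)) \<longlongrightarrow> 0) at_top"
      proof (rule tendsto_sandwich[where f = "\<lambda>_. 0" and h = "\<lambda>r. exp (- (c * r))"])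
        show "\<forall>\<^sub>F r in at_top. exp (- \<Psi> r) \<le> exp (- (c * r))"
          using eventually_ge_at_top[of 0] by eventually_elim (rule exp_Psi_le)
        show "((\<lambda>r. exp (- (c * r))) \<longlongrightarrow> 0) at_top" using c_pos by real_asymp
      qed auto
      then show ?thesis using tendsto_minus by fastforce
    qed
  qed (use less_imp_le[OF psi_pos] in auto)
  moreover have "(\<integral>\<^sup>+r. ennreal (\<psi> r * exp (- \<Psi> r)) * indicator {s..} r \<partial>lborel)
      = (\<integral>\<^sup>+r. ennreal (indicator {s..} r * (\<psi> r * exp (- \<Psi> r))) \<partial>lborel)"
    by (intro nn_integral_cong) (auto simp: indicator_def)
  ultimately show ?thesis
    using less_imp_le[OF psi_pos] by (intro has_bochner_integral_nn_integral) auto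
qed

text \<open>The factor contributed by the weight to the integral of a function homogeneous of degree
  m - dim. The variable r stands for the squared radius, hence the square root.\<close>

definition layer :: "nat \<Rightarrow> real" where
  "layer m = (\<integral>r. sqrt r ^ m * \<psi> r * wt r \<partial>lborel)"

text \<open>sqrt r ^ m \<le> r + r^m reduces to integer exponents, where integration by parts
  applies. Odd m occur for the powers of the norm that dominate functions of polynomial
  growth.\<close>

lemma integrable_layer:
  assumes "m \<ge> 2"
  shows "integrable lborel (\<lambda>r. sqrt r ^ m * \<psi> r * wt r)"
proof (rule Bochner_Integration.integrable_bound)
  show "integrable lborel (\<lambda>r. r ^ Suc 0 * \<psi> r * wt r + r ^ Suc (m - 1) * \<psi> r * wt r)"
    by (intro Bochner_Integration.integrable_add integrable.intros[OF moment_by_parts])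
  show "AE r in lborel. norm (sqrt r ^ m * \<psi> r * wt r) \<le> norm (r ^ Suc 0 * \<psi> r * wt r + r ^ Suc (m - 1) * \<psi> r * wt r)"
  proof (rule AE_I2)
    fix r :: real
    show "norm (sqrt r ^ m * \<psi> r * wt r) \<le> norm (r ^ Suc 0 * \<psi> r * wt r + r ^ Suc (m - 1) * \<psi> r * wt r)"
    proof (cases "r \<ge> 0")
      case True
      have "sqrt r ^ m \<le> r + r ^ m"
      proof (cases "r \<le> 1")
        case True
        then have "sqrt r ^ m \<le> sqrt r ^ 2" using \<open>r \<ge> 0\<close> assms by (intro power_decreasing) auto
        then show ?thesis using \<open>r \<ge> 0\<close> by (simp add: add_increasing2)
      next
        case False
        then have "sqrt r \<le> r" using real_le_rsqrt[of r r] real_sqrt_le_iff[of r "r\<^sup>2"] \<open>r \<ge> 0\<close>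
          by (simp add: power2_eq_square)
        then have "sqrt r ^ m \<le> r ^ m" using \<open>r \<ge> 0\<close> by (intro power_mono) auto
        then show ?thesis using \<open>r \<ge> 0\<close> by simp
      qed
      then have "sqrt r ^ m * (\<psi> r * wt r) \<le> (r + r ^ m) * (\<psi> r * wt r)"
        using less_imp_le[OF psi_pos] wt_nonneg by (intro mult_right_mono) auto
      also have "(r + r ^ m) * (\<psi> r * wt r) = r ^ Suc 0 * \<psi> r * wt r + r ^ Suc (m - 1) * \<psi> r * wt r"
        using assms by (simp add: algebra_simps flip: power_Suc)
      finally show ?thesis using True less_imp_le[OF psi_pos] wt_nonneg by (simp add: mult.assoc)
    qed (simp add: wt_def)
  qed
qed simp

lemma layer_even: "layer (2 * Suc j) = real (Suc j) * mom j"
proof -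
  have "layer (2 * Suc j) = (\<integral>t. t ^ Suc j * \<psi> t * wt t \<partial>lborel)"
    unfolding layer_def by (intro Bochner_Integration.integral_cong) (auto simp: wt_def indicator_def power_mult)
  then show ?thesis using moment_by_parts[of j] by (simp add: has_bochner_integral_iff)
qed

lemma layer_pos:
  assumes "m \<ge> 2" shows "layer m > 0"
proof -
  have "layer m \<ge> 0" unfolding layer_def
    by (intro integral_nonneg_AE AE_I2) (use less_imp_le[OF psi_pos] in \<open>auto simp: wt_def indicator_def\<close>)
  moreover have "layer m \<noteq> 0"
  proof
    assume "layer m = 0"
    then have "AE t in lborel. sqrt t ^ m * \<psi> t * wt t = 0"
      unfolding layer_def
      by (subst (asm) integral_nonneg_eq_0_iff_AE[OF integrable_layer[OF assms]])
        (use less_imp_le[OF psi_pos] in \<open>auto simp: wt_def indicator_def\<close>)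
    then have "AE t in lborel. t \<notin> {1..2::real}"
    proof eventually_elim
      case (elim t)
      have "sqrt t ^ m * \<psi> t * wt t > 0" if "t \<in> {1..2}" using that psi_pos[of t] by (simp add: wt_def)
      then show ?case using elim by force
    qed
    then have "{1..2::real} \<in> null_sets lborel" by (subst AE_iff_null_sets) auto
    then show False by (simp add: null_sets_def)
  qed
  ultimately show ?thesis by simp
qed

text \<open>Writing e^(-\<Psi>(s)) as the integral of \<psi> e^(-\<Psi>) over [s, \<infinity>) and
  exchanging the integrals turns the weighted integral into a superposition of integrals over balls
  of radius \<open>sqrt r\<close>, each of which is a power of the radius times the one over the
  unit ball.\<close>

lemma layer_cake:
  fixes g :: "'a::euclidean_space \<Rightarrow> 'b::{banach, second_countable_topology}"
  assumes cont_g: "continuous_on UNIV g" and hom: "\<And>r z. r > 0 \<Longrightarrow> g (r *\<^sub>R z) = r ^ D *\<^sub>R g z"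
    and dim: "D + DIM('a) \<ge> 2"
  shows "has_bochner_integral lborel (\<lambda>z. exp (- \<Psi> ((norm z)\<^sup>2)) *\<^sub>R g z)
     (layer (D + DIM('a)) *\<^sub>R (\<integral>z. indicator (cball 0 1) z *\<^sub>R g z \<partial>lborel))"
proof -
  have gm [measurable]: "g \<in> borel_measurable borel" by (rule borel_measurable_continuous_onI[OF cont_g])
  define h where "h r z = (indicator {(norm z)\<^sup>2..} r * (\<psi> r * exp (- \<Psi> r))) *\<^sub>R g z" for r z
  have ind: "indicator {(norm z)\<^sup>2..} r = (indicator {0..} r * indicator (cball 0 (sqrt r)) z :: real)" for r :: real and z :: 'a
  proof -
    have "(norm z)\<^sup>2 \<le> r \<longleftrightarrow> 0 \<le> r \<and> norm z \<le> sqrt r"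
      by (metis norm_ge_zero order_trans real_le_rsqrt real_sqrt_le_iff real_sqrt_abs abs_norm_cancel zero_le_power2)
    then show ?thesis by (auto simp: indicator_def)
  qed
  have h_eq: "h r z = (\<psi> r * wt r) *\<^sub>R (indicator (cball 0 (sqrt r)) z *\<^sub>R g z)" for r z
    unfolding h_def ind wt_def by (simp add: mult_ac)
  have h_meas: "case_prod h \<in> borel_measurable (lborel \<Otimes>\<^sub>M lborel)"
  proof -
    have "(\<lambda>(r, z). (if (norm z)\<^sup>2 \<le> r then \<psi> r * exp (- \<Psi> r) else 0) *\<^sub>R g z) \<in> borel_measurable (lborel \<Otimes>\<^sub>M lborel)"
      by measurable
    moreover have "case_prod h = (\<lambda>(r, z). (if (norm z)\<^sup>2 \<le> r then \<psi> r * exp (- \<Psi> r) else 0) *\<^sub>R g z)"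
      by (auto simp: h_def fun_eq_iff)
    ultimately show ?thesis by simp
  qed
  have inner: "(\<integral>z. h r z \<partial>lborel) = (sqrt r ^ (D + DIM('a)) * \<psi> r * wt r) *\<^sub>R (\<integral>z. indicator (cball 0 1) z *\<^sub>R g z \<partial>lborel)" for r
  proof (cases "r \<ge> 0")
    case True
    then have "(\<integral>z. indicator (cball 0 (sqrt r)) z *\<^sub>R g z \<partial>lborel) = sqrt r ^ (D + DIM('a)) *\<^sub>R (\<integral>z. indicator (cball 0 1) z *\<^sub>R g z \<partial>lborel)"
      by (intro integral_homogeneous_cball[OF gm hom]) auto
    then show ?thesis unfolding h_eq integral_scaleR_right by (simp only:) (simp only: scaleR_scaleR mult_ac)
  qed (simp add: h_eq wt_def)
  have inner_norm: "(\<integral>z. norm (h r z) \<partial>lborel) = (sqrt r ^ (D + DIM('a)) * \<psi> r * wt r) * (\<integral>z. indicator (cball 0 1) z * norm (g z) \<partial>lborel)" for r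
  proof (cases "r \<ge> 0")
    case True
    have "(\<integral>z. indicator (cball 0 (sqrt r)) z *\<^sub>R norm (g z) \<partial>lborel) = sqrt r ^ (D + DIM('a)) *\<^sub>R (\<integral>z. indicator (cball 0 1) z *\<^sub>R norm (g z) \<partial>lborel)"
      using True by (intro integral_homogeneous_cball) (auto simp: hom)
    moreover have "norm (h r z) = (\<psi> r * wt r) * (indicator (cball 0 (sqrt r)) z *\<^sub>R norm (g z))" for z
      unfolding h_eq using less_imp_le[OF psi_pos] wt_nonneg by (simp add: abs_mult)
    ultimately show ?thesis by simp
  qed (simp add: h_eq wt_def)
  have int: "integrable (lborel \<Otimes>\<^sub>M lborel) (case_prod h)"
  proof (rule lborel_pair.Fubini_integrable[OF h_meas])
    show "integrable lborel (\<lambda>r. \<integral>z. norm (case_prod h (r, z)) \<partial>lborel)"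
      unfolding split inner_norm using integrable_layer[OF dim] by simp
    show "AE r in lborel. integrable lborel (\<lambda>z. case_prod h (r, z))"
      unfolding split h_eq by (intro AE_I2 integrable_scaleR_right integrable_continuous_cball[OF cont_g])
  qed
  have outer: "(\<integral>r. h r z \<partial>lborel) = exp (- \<Psi> ((norm z)\<^sup>2)) *\<^sub>R g z" for z
    unfolding h_def using tail_density[of "(norm z)\<^sup>2"] by (simp add: has_bochner_integral_iff)
  have "integrable lborel (\<lambda>z. \<integral>r. h r z \<partial>lborel)" using lborel_pair.integrable_snd[OF int] .
  moreover have "(\<integral>z. (\<integral>r. h r z \<partial>lborel) \<partial>lborel) = (\<integral>r. (\<integral>z. h r z \<partial>lborel) \<partial>lborel)"
    using lborel_pair.Fubini_integral[OF int] .
  moreover have "(\<integral>r. (\<integral>z. h r z \<partial>lborel) \<partial>lborel) = layer (D + DIM('a)) *\<^sub>R (\<integral>z. indicator (cball 0 1) z *\<^sub>R g z \<partial>lborel)"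
    unfolding inner layer_def using integrable_layer[OF dim] by simp
  ultimately show ?thesis unfolding outer by (simp add: has_bochner_integral_iff)
qed

end

text \<open>By translation invariance G(z + v) - G(z) has integral 0. It is also the integral of
  G'(z + t v) over t in [0,1], and every t contributes the same amount. No boundary terms at
  infinity have to be discussed.\<close>

lemma integral_directional_derivative:
  fixes G G' :: "'a::euclidean_space \<Rightarrow> 'b::euclidean_space"
  assumes G: "integrable lborel G" and G': "integrable lborel G'" and cont: "continuous_on UNIV G'"
    and deriv: "\<And>z t. ((\<lambda>t. G (z + t *\<^sub>R v)) has_vector_derivative G' (z + t *\<^sub>R v)) (at t)"
  shows "(\<integral>z. G' z \<partial>lborel) = 0"
proof -
  define h where "h t z = indicator {0..1::real} t *\<^sub>R G' (z + t *\<^sub>R v)" for t z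
  have [measurable]: "G' \<in> borel_measurable borel" by (rule borel_measurable_continuous_onI[OF cont])
  have h_meas: "case_prod h \<in> borel_measurable (lborel \<Otimes>\<^sub>M lborel)"
    unfolding h_def by measurable
  have nG': "integrable lborel (\<lambda>z. norm (G' z))" using G' by simp
  have int: "integrable (lborel \<Otimes>\<^sub>M lborel) (case_prod h)"
  proof (rule lborel_pair.Fubini_integrable[OF h_meas])
    have "(\<integral>z. norm (case_prod h (t, z)) \<partial>lborel) = indicator {0..1} t * (\<integral>z. norm (G' z) \<partial>lborel)" for t
      using lborel_integral_translate(1)[OF nG', of "t *\<^sub>R v"] by (simp add: h_def)
    then show "integrable lborel (\<lambda>t. \<integral>z. norm (case_prod h (t, z)) \<partial>lborel)"
      by simp
    show "AE t in lborel. integrable lborel (\<lambda>z. case_prod h (t, z))"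
      using lborel_integral_translate(2)[OF G'] by (simp add: h_def)
  qed
  have ftc: "(\<integral>t. h t z \<partial>lborel) = G (z + v) - G z" for z
  proof -
    have "(\<integral>t. h t z \<partial>lborel) = G (z + 1 *\<^sub>R v) - G (z + 0 *\<^sub>R v)" unfolding h_def
    proof (rule integral_FTC_atLeastAtMost[where F = "\<lambda>t. G (z + t *\<^sub>R v)"])
      show "continuous_on {0..1} (\<lambda>t. G' (z + t *\<^sub>R v))"
        by (intro continuous_on_compose2[OF cont] continuous_intros) auto
    qed (auto intro: has_vector_derivative_at_within deriv)
    then show ?thesis by simp
  qed
  have "(\<integral>t. (\<integral>z. h t z \<partial>lborel) \<partial>lborel) = (\<integral>z. (\<integral>t. h t z \<partial>lborel) \<partial>lborel)"
    using lborel_pair.Fubini_integral[OF int] by simp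
  also have "\<dots> = 0" unfolding ftc using lborel_integral_translate[OF G, of v] G by simp
  also have "(\<lambda>t. \<integral>z. h t z \<partial>lborel) = (\<lambda>t. indicator {0..1} t *\<^sub>R (\<integral>z. G' z \<partial>lborel))"
    unfolding h_def using lborel_integral_translate(1)[OF G'] by simp
  finally show ?thesis by simp
qed

section \<open>Gaussian integrals of monomials\<close>

text \<open>Closed under sums, products and powers, so that the integrability of each integrand
  below follows from its syntactic form.\<close>

definition poly_growth :: "('a::real_normed_vector \<Rightarrow> 'b::real_normed_vector) \<Rightarrow> bool" where
  "poly_growth f \<longleftrightarrow> (\<exists>C m. \<forall>z. norm (f z) \<le> C * (1 + norm z) ^ m)"

lemma poly_growthI: "(\<And>z. norm (f z) \<le> C * (1 + norm z) ^ m) \<Longrightarrow> poly_growth f"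
  by (auto simp: poly_growth_def)

lemma poly_growthE:
  assumes "poly_growth f"
  obtains C m where "C \<ge> 0" "\<And>z. norm (f z) \<le> C * (1 + norm z) ^ m"
proof -
  from assms obtain C m where "\<And>z. norm (f z) \<le> C * (1 + norm z) ^ m" by (auto simp: poly_growth_def)
  moreover have "C * (1 + norm z) ^ m \<le> \<bar>C\<bar> * (1 + norm z) ^ m" for z :: 'a by (intro mult_right_mono) auto
  ultimately show ?thesis by (intro that[of "\<bar>C\<bar>" m]) (auto intro: order_trans)
qed

lemma poly_growth_const [intro]: "poly_growth (\<lambda>_. a)"
  by (rule poly_growthI[of _ "norm a" 0]) simp

lemma poly_growth_add [intro]:
  assumes "poly_growth f" "poly_growth g" shows "poly_growth (\<lambda>z. f z + g z)"
proof -
  obtain C m where f: "C \<ge> 0" "\<And>z. norm (f z) \<le> C * (1 + norm z) ^ m" using assms(1) by (rule poly_growthE) blast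
  obtain C' m' where g: "C' \<ge> 0" "\<And>z. norm (g z) \<le> C' * (1 + norm z) ^ m'" using assms(2) by (rule poly_growthE) blast
  show ?thesis
  proof (rule poly_growthI[of _ "C + C'" "max m m'"])
    fix z :: 'a
    have "norm (f z) \<le> C * (1 + norm z) ^ max m m'"
      by (rule order_trans[OF f(2)]) (intro mult_left_mono power_increasing f, auto)
    moreover have "norm (g z) \<le> C' * (1 + norm z) ^ max m m'"
      by (rule order_trans[OF g(2)]) (intro mult_left_mono power_increasing g, auto)
    ultimately show "norm (f z + g z) \<le> (C + C') * (1 + norm z) ^ max m m'"
      using norm_triangle_ineq[of "f z" "g z"] by (simp add: distrib_right)
  qed
qed

lemma poly_growth_mult [intro]:
  fixes f g :: "'a::real_normed_vector \<Rightarrow> 'b::real_normed_algebra"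
  assumes "poly_growth f" "poly_growth g" shows "poly_growth (\<lambda>z. f z * g z)"
proof -
  obtain C m where f: "C \<ge> 0" "\<And>z. norm (f z) \<le> C * (1 + norm z) ^ m" using assms(1) by (rule poly_growthE) blast
  obtain C' m' where g: "C' \<ge> 0" "\<And>z. norm (g z) \<le> C' * (1 + norm z) ^ m'" using assms(2) by (rule poly_growthE) blast
  show ?thesis
  proof (rule poly_growthI[of _ "C * C'" "m + m'"])
    fix z :: 'a
    have "norm (f z * g z) \<le> norm (f z) * norm (g z)" by (rule norm_mult_ineq)
    also have "\<dots> \<le> (C * (1 + norm z) ^ m) * (C' * (1 + norm z) ^ m')" using f g by (intro mult_mono) auto
    finally show "norm (f z * g z) \<le> C * C' * (1 + norm z) ^ (m + m')" by (simp add: power_add mult_ac)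
  qed
qed

lemma poly_growth_power [intro]:
  fixes f :: "'a::real_normed_vector \<Rightarrow> 'b::real_normed_algebra_1"
  shows "poly_growth f \<Longrightarrow> poly_growth (\<lambda>z. f z ^ k)"
  by (induction k) auto

lemma poly_growth_sum [intro]: "(\<And>i. i \<in> A \<Longrightarrow> poly_growth (f i)) \<Longrightarrow> poly_growth (\<lambda>z. \<Sum>i\<in>A. f i z)"
  by (induction A rule: infinite_finite_induct) auto

lemma poly_growth_nth [intro]: "poly_growth (\<lambda>z::complex^'n. z $ j)" "poly_growth (\<lambda>z::complex^'n. cnj (z $ j))"
proof -
  have "norm (z $ j) \<le> 1 * (1 + norm z) ^ 1" for z :: "complex^'n"
    using Finite_Cartesian_Product.norm_nth_le[of z j] by simp
  then show "poly_growth (\<lambda>z::complex^'n. z $ j)" "poly_growth (\<lambda>z::complex^'n. cnj (z $ j))"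
    by (auto intro!: poly_growthI[of _ 1 1])
qed

lemma poly_growth_inner [intro]: "poly_growth (\<lambda>z::'a::real_inner. of_real (z \<bullet> v) :: 'b::real_normed_algebra_1)"
proof (rule poly_growthI[of _ "norm v" 1])
  show "norm (of_real (z \<bullet> v) :: 'b) \<le> norm v * (1 + norm z) ^ 1" for z :: 'a
    using order_trans[OF Cauchy_Schwarz_ineq2[of z v], of "norm v * (1 + norm z)"] by (simp add: algebra_simps)
qed

lemma poly_growth_herm [intro]: "poly_growth (\<lambda>z. herm w z)" "poly_growth (\<lambda>z. herm z w)"
  unfolding herm_def by (intro poly_growth_sum poly_growth_mult poly_growth_nth poly_growth_const)+

lemma continuous_on_herm [continuous_intros]:
  "continuous_on S f \<Longrightarrow> continuous_on S g \<Longrightarrow> continuous_on S (\<lambda>x. herm (f x) (g x))"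
  unfolding herm_def by (intro continuous_intros)

context radial_weight
begin

lemma integrable_poly_growth:
  fixes f :: "'a::euclidean_space \<Rightarrow> 'b::{banach, second_countable_topology}"
  assumes cont: "continuous_on UNIV f" and growth: "poly_growth f" and dim: "DIM('a) \<ge> 2"
  shows "integrable lborel (\<lambda>z. exp (- \<Psi> ((norm z)\<^sup>2)) *\<^sub>R f z)"
proof -
  obtain C m where C: "C \<ge> 0" "\<And>z. norm (f z) \<le> C * (1 + norm z) ^ m" using growth by (rule poly_growthE) blast
  have pw: "(1 + x) ^ m \<le> 2 ^ m * (1 + x ^ m)" if "x \<ge> 0" for x :: real
  proof -
    have "(1 + x) ^ m \<le> (2 * max 1 x) ^ m" using that by (intro power_mono) auto
    also have "\<dots> \<le> 2 ^ m * (1 + x ^ m)" using that by (auto simp: power_mult_distrib max_def)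
    finally show ?thesis .
  qed
  have fm: "f \<in> borel_measurable borel" by (rule borel_measurable_continuous_onI[OF cont])
  show ?thesis
  proof (rule Bochner_Integration.integrable_bound)
    have "integrable lborel (\<lambda>z::'a. exp (- \<Psi> ((norm z)\<^sup>2)) *\<^sub>R (1::real))"
      by (rule integrable.intros, rule layer_cake[where D = 0]) (use dim in auto)
    moreover have "integrable lborel (\<lambda>z::'a. exp (- \<Psi> ((norm z)\<^sup>2)) *\<^sub>R (norm z ^ m))"
      by (rule integrable.intros, rule layer_cake[where D = m])
        (use dim in \<open>auto intro!: continuous_intros simp: power_mult_distrib\<close>)
    ultimately show "integrable lborel (\<lambda>z::'a. (C * 2 ^ m) * (exp (- \<Psi> ((norm z)\<^sup>2)) *\<^sub>R (1::real) + exp (- \<Psi> ((norm z)\<^sup>2)) *\<^sub>R (norm z ^ m)))"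
      by (intro integrable_mult_right Bochner_Integration.integrable_add)
    show "AE z in lborel. norm (exp (- \<Psi> ((norm z)\<^sup>2)) *\<^sub>R f z)
       \<le> norm ((C * 2 ^ m) * (exp (- \<Psi> ((norm z)\<^sup>2)) *\<^sub>R (1::real) + exp (- \<Psi> ((norm z)\<^sup>2)) *\<^sub>R (norm z ^ m)))"
    proof (rule AE_I2)
      fix z :: 'a
      have "norm (f z) \<le> C * (2 ^ m * (1 + norm z ^ m))"
        using C(2)[of z] mult_left_mono[OF pw[of "norm z"] C(1)] by simp
      then have "exp (- \<Psi> ((norm z)\<^sup>2)) * norm (f z) \<le> exp (- \<Psi> ((norm z)\<^sup>2)) * (C * (2 ^ m * (1 + norm z ^ m)))"
        by (intro mult_left_mono) auto
      also have "\<dots> = (C * 2 ^ m) * (exp (- \<Psi> ((norm z)\<^sup>2)) *\<^sub>R (1::real) + exp (- \<Psi> ((norm z)\<^sup>2)) *\<^sub>R (norm z ^ m))"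
        by (simp add: algebra_simps)
      finally show "norm (exp (- \<Psi> ((norm z)\<^sup>2)) *\<^sub>R f z)
         \<le> norm ((C * 2 ^ m) * (exp (- \<Psi> ((norm z)\<^sup>2)) *\<^sub>R (1::real) + exp (- \<Psi> ((norm z)\<^sup>2)) *\<^sub>R (norm z ^ m)))"
        by (simp add: order_trans[OF _ abs_ge_self])
    qed
    show "(\<lambda>z. exp (- \<Psi> ((norm z)\<^sup>2)) *\<^sub>R f z) \<in> borel_measurable lborel"
      using fm by measurable
  qed
qed

end

text \<open>The reference weight: its density is smooth and differentiates to a multiple of itself,
  so pairings can be computed by parts. \<open>layer_cake\<close> transfers them to any other
  weight.\<close>

interpretation gauss: radial_weight "\<lambda>x. x" "\<lambda>_. 1" 1
  by unfold_locales auto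

text \<open>As a measurability rule, the identity would match every goal.\<close>
declare gauss.measurable_Psi [measurable del]

lemma integrable_gauss:
  fixes f :: "complex^'n \<Rightarrow> complex"
  assumes "continuous_on UNIV f" "poly_growth f"
  shows "integrable lborel (\<lambda>z. exp (- (norm z)\<^sup>2) *\<^sub>R f z)"
  using gauss.integrable_poly_growth[OF assms] by simp

text \<open>Monomials are indexed by lists of coordinates, so that they can be built up one factor at a
  time.\<close>

definition lmono :: "'n list \<Rightarrow> complex^'n \<Rightarrow> complex" where
  "lmono l z = prod_list (map (\<lambda>j. z $ j) l)"

fun dlmono :: "'n list \<Rightarrow> complex^'n \<Rightarrow> complex^'n \<Rightarrow> complex" where
  "dlmono [] v z = 0"
| "dlmono (j # l) v z = v $ j * lmono l z + z $ j * dlmono l v z"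

lemma lmono_simps [simp]: "lmono [] z = 1" "lmono (j # l) z = z $ j * lmono l z"
  by (auto simp: lmono_def)

lemma continuous_on_lmono [continuous_intros]: "continuous_on S f \<Longrightarrow> continuous_on S (\<lambda>x. lmono l (f x))"
  by (induction l) (auto intro!: continuous_intros)

lemma continuous_on_dlmono [continuous_intros]: "continuous_on S (dlmono l v)"
  by (induction l) (auto intro!: continuous_intros)

lemma poly_growth_lmono [intro]: "poly_growth (lmono l)"
proof (induction l)
  case (Cons j l)
  have "poly_growth (\<lambda>z. z $ j * lmono l z)" using Cons by (intro poly_growth_mult poly_growth_nth)
  then show ?case by (simp add: poly_growth_def)
qed (auto simp: poly_growth_def intro!: exI[of _ 1])

lemma poly_growth_dlmono [intro]: "poly_growth (dlmono l v)"
proof (induction l)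
  case (Cons j l)
  have "poly_growth (\<lambda>z. v $ j * lmono l z + z $ j * dlmono l v z)"
    using Cons by (intro poly_growth_add poly_growth_mult poly_growth_nth poly_growth_const poly_growth_lmono)
  then show ?case by (simp add: poly_growth_def)
qed (auto simp: poly_growth_def intro!: exI[of _ 1])

text \<open>Complex linearity in the direction is the holomorphy of monomials, the fact behind the
  cancellation of their \<partial>/\<partial>cnj z derivative.\<close>

lemma dlmono_scale: "dlmono l (c *s v) z = c * dlmono l v z"
  by (induction l) (auto simp: algebra_simps)

lemma lmono_deriv: "((\<lambda>t. lmono l (z + t *\<^sub>R v)) has_vector_derivative dlmono l v (z + t *\<^sub>R v)) (at t)"
proof (induction l)
  case (Cons j l)
  have "((\<lambda>t. z $ j + t *\<^sub>R v $ j) has_vector_derivative v $ j) (at t)"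
    by (auto intro!: derivative_eq_intros)
  from has_vector_derivative_mult[OF this Cons] show ?case by (simp add: add.commute)
qed simp

lemma herm_deriv: "((\<lambda>t. herm w (z + t *\<^sub>R v)) has_vector_derivative herm w v) (at t)"
proof -
  have "herm w (z + t *\<^sub>R v) = herm w z + t *\<^sub>R herm w v" for t
    by (simp add: herm_def sum.distrib scaleR_sum_right algebra_simps)
  then show ?thesis by (auto intro!: derivative_eq_intros)
qed

lemma has_vector_derivative_power_complex:
  fixes h :: "real \<Rightarrow> complex"
  assumes "(h has_vector_derivative h') (at t)"
  shows "((\<lambda>t. h t ^ d) has_vector_derivative of_nat d * h t ^ (d - 1) * h') (at t)"
proof -
  have "((\<lambda>x. x ^ d) has_field_derivative of_nat d * h t ^ (d - 1)) (at (h t))"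
    by (auto intro!: derivative_eq_intros)
  from field_vector_diff_chain_at[OF assms this] show ?thesis by (simp add: o_def mult.commute)
qed

lemma gauss_by_parts:
  fixes P P' :: "complex^'n \<Rightarrow> complex"
  assumes P: "continuous_on UNIV P" "poly_growth P" and P': "continuous_on UNIV P'" "poly_growth P'"
    and deriv: "\<And>z t. ((\<lambda>t. P (z + t *\<^sub>R v)) has_vector_derivative P' (z + t *\<^sub>R v)) (at t)"
  shows "(\<integral>z. exp (- (norm z)\<^sup>2) *\<^sub>R P' z \<partial>lborel) = (\<integral>z. exp (- (norm z)\<^sup>2) *\<^sub>R (of_real (z \<bullet> v) * (2 * P z)) \<partial>lborel)"
proof -
  let ?G' = "\<lambda>z. exp (- (norm z)\<^sup>2) *\<^sub>R P' z - exp (- (norm z)\<^sup>2) *\<^sub>R (of_real (z \<bullet> v) * (2 * P z))"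
  have i1: "integrable lborel (\<lambda>z. exp (- (norm z)\<^sup>2) *\<^sub>R P' z)" by (rule integrable_gauss[OF P'])
  have i2: "integrable lborel (\<lambda>z. exp (- (norm z)\<^sup>2) *\<^sub>R (of_real (z \<bullet> v) * (2 * P z)))"
    using P by (intro integrable_gauss continuous_intros poly_growth_mult poly_growth_inner poly_growth_const)
  have "(\<integral>z. ?G' z \<partial>lborel) = 0"
  proof (rule integral_directional_derivative)
    show "integrable lborel (\<lambda>z. exp (- (norm z)\<^sup>2) *\<^sub>R P z)" by (rule integrable_gauss[OF P])
    show "integrable lborel ?G'" using i1 i2 by simp
    show "continuous_on UNIV ?G'" using P(1) P'(1) by (intro continuous_intros)
    fix z :: "complex^'n" and t :: real
    have "((\<lambda>t. (z + t *\<^sub>R v) \<bullet> (z + t *\<^sub>R v)) has_real_derivative 2 * ((z + t *\<^sub>R v) \<bullet> v)) (at t)"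
      by (simp add: inner_add_left inner_add_right power2_eq_square)
        (auto intro!: derivative_eq_intros simp: inner_commute algebra_simps)
    then have "((\<lambda>t. exp (- (norm (z + t *\<^sub>R v))\<^sup>2)) has_real_derivative exp (- (norm (z + t *\<^sub>R v))\<^sup>2) * - (2 * ((z + t *\<^sub>R v) \<bullet> v))) (at t)"
      unfolding power2_norm_eq_inner by (intro DERIV_fun_exp DERIV_minus)
    from has_vector_derivative_scaleR[OF this deriv]
    show "((\<lambda>t. exp (- (norm (z + t *\<^sub>R v))\<^sup>2) *\<^sub>R P (z + t *\<^sub>R v)) has_vector_derivative ?G' (z + t *\<^sub>R v)) (at t)"
      by (rule back_subst[of "\<lambda>d. (_ has_vector_derivative d) _"]) (simp add: scaleR_conv_of_real algebra_simps)
  qed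
  then show ?thesis using i1 i2 by simp
qed

text \<open>Pairing with powers of \<langle>w,z\<rangle> instead of conjugated monomials returns the
  value of the monomial at w directly and avoids orthogonality relations with multinomial
  coefficients.\<close>

definition gauss_pair :: "'n::finite list \<Rightarrow> nat \<Rightarrow> complex^'n \<Rightarrow> complex" where
  "gauss_pair l d w = (\<integral>z. exp (- (norm z)\<^sup>2) *\<^sub>R (lmono l z * herm w z ^ d) \<partial>lborel)"

lemma herm_axis: "herm w (axis j 1) = w $ j" "herm w (axis j \<i>) = - \<i> * w $ j"
proof -
  have "herm w (axis j a) = w $ j * cnj a" for a
    unfolding herm_def by (subst sum.remove[of _ j]) (auto simp: axis_def intro!: sum.neutral)
  then show "herm w (axis j 1) = w $ j" "herm w (axis j \<i>) = - \<i> * w $ j" by auto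
qed

lemma integral_complex_combination:
  fixes f g :: "'a \<Rightarrow> complex"
  assumes "integrable M f" "integrable M g"
  shows "(\<integral>x. f x + a * g x \<partial>M) = (\<integral>x. f x \<partial>M) + a * (\<integral>x. g x \<partial>M)"
    "(\<integral>x. f x - a * g x \<partial>M) = (\<integral>x. f x \<partial>M) - a * (\<integral>x. g x \<partial>M)"
  using assms by auto

lemma gauss_pair_deriv:
  "(\<integral>z. exp (- (norm z)\<^sup>2) *\<^sub>R (dlmono l v z * herm w z ^ d + lmono l z * (of_nat d * herm w z ^ (d - 1) * herm w v)) \<partial>lborel)
   = (\<integral>z. exp (- (norm z)\<^sup>2) *\<^sub>R (of_real (z \<bullet> v) * (2 * (lmono l z * herm w z ^ d))) \<partial>lborel)"
proof (rule gauss_by_parts)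
  show "poly_growth (\<lambda>z. dlmono l v z * herm w z ^ d + lmono l z * (of_nat d * herm w z ^ (d - 1) * herm w v))"
    by (intro poly_growth_add poly_growth_mult poly_growth_power poly_growth_herm poly_growth_const poly_growth_lmono poly_growth_dlmono)
  show "poly_growth (\<lambda>z. lmono l z * herm w z ^ d)"
    by (intro poly_growth_mult poly_growth_power poly_growth_herm poly_growth_lmono)
  fix z :: "complex^'a" and t :: real
  show "((\<lambda>t. lmono l (z + t *\<^sub>R v) * herm w (z + t *\<^sub>R v) ^ d) has_vector_derivative
     dlmono l v (z + t *\<^sub>R v) * herm w (z + t *\<^sub>R v) ^ d +
     lmono l (z + t *\<^sub>R v) * (of_nat d * herm w (z + t *\<^sub>R v) ^ (d - 1) * herm w v)) (at t)"
    using has_vector_derivative_mult[OF lmono_deriv has_vector_derivative_power_complex[OF herm_deriv]]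
    by (simp add: add.commute)
qed (intro continuous_intros)+

lemma integrable_gauss_pair:
  "integrable lborel (\<lambda>z. exp (- (norm z)\<^sup>2) *\<^sub>R (cnj (z $ j) * (lmono l z * herm w z ^ d)))"
  "integrable lborel (\<lambda>z. exp (- (norm z)\<^sup>2) *\<^sub>R (of_real (z \<bullet> v) * (2 * (lmono l z * herm w z ^ d))))"
  "integrable lborel (\<lambda>z. exp (- (norm z)\<^sup>2) *\<^sub>R (dlmono l v z * herm w z ^ d + lmono l z * (of_nat d * herm w z ^ (d - 1) * b)))"
  by (intro integrable_gauss continuous_intros poly_growth_mult poly_growth_add poly_growth_power poly_growth_herm poly_growth_lmono
      poly_growth_dlmono poly_growth_nth poly_growth_inner poly_growth_const)+

text \<open>Combining the two real directions \<open>axis j 1\<close> and \<open>axis j \<i>\<close> into \<open>\<partial>/\<partial>cnj z\<^sub>j\<close> kills the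
  derivative of the holomorphic factor \<open>lmono l\<close>.\<close>

lemma gauss_pair_Cons: "gauss_pair (j # l) d w = of_nat d * w $ j * gauss_pair l (d - 1) w"
proof -
  let ?e = "\<lambda>z::complex^'a. exp (- (norm z)\<^sup>2)"
  let ?L = "\<lambda>v z. dlmono l v z * herm w z ^ d + lmono l z * (of_nat d * herm w z ^ (d - 1) * herm w v)"
  let ?Q = "\<lambda>z. lmono l z * herm w z ^ d"
  have ax: "axis j \<i> = \<i> *s axis j (1::complex)" by (simp add: vec_eq_iff axis_def)
  have eq: "?L (axis j 1) z + \<i> * ?L (axis j \<i>) z = (2 * of_nat d * w $ j) * (lmono l z * herm w z ^ (d - 1))" for z
    unfolding herm_axis unfolding ax dlmono_scale by (simp add: algebra_simps)
  have "(\<integral>z. ?e z *\<^sub>R ((2 * of_nat d * w $ j) * (lmono l z * herm w z ^ (d - 1))) \<partial>lborel)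
     = (\<integral>z. (?e z *\<^sub>R ?L (axis j 1) z) + \<i> * (?e z *\<^sub>R ?L (axis j \<i>) z) \<partial>lborel)"
    by (simp only: mult_scaleR_right scaleR_add_right[symmetric] eq)
  also have "\<dots> = (\<integral>z. ?e z *\<^sub>R ?L (axis j 1) z \<partial>lborel) + \<i> * (\<integral>z. ?e z *\<^sub>R ?L (axis j \<i>) z \<partial>lborel)"
    by (intro integral_complex_combination(1) integrable_gauss_pair(3))
  also have "\<dots> = (\<integral>z. ?e z *\<^sub>R (of_real (z \<bullet> axis j 1) * (2 * ?Q z)) \<partial>lborel) + \<i> * (\<integral>z. ?e z *\<^sub>R (of_real (z \<bullet> axis j \<i>) * (2 * ?Q z)) \<partial>lborel)"
    by (simp only: gauss_pair_deriv)
  also have "\<dots> = (\<integral>z. ?e z *\<^sub>R (of_real (z \<bullet> axis j 1) * (2 * ?Q z)) + \<i> * (?e z *\<^sub>R (of_real (z \<bullet> axis j \<i>) * (2 * ?Q z))) \<partial>lborel)"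
    by (intro integral_complex_combination(1)[symmetric] integrable_gauss_pair(2))
  also have "\<dots> = (\<integral>z. 2 * (?e z *\<^sub>R (lmono (j # l) z * herm w z ^ d)) \<partial>lborel)"
  proof (rule Bochner_Integration.integral_cong[OF refl])
    fix z :: "complex^'a"
    have "of_real (z \<bullet> axis j 1) + \<i> * of_real (z \<bullet> axis j \<i>) = z $ j"
      by (simp add: inner_axis inner_complex_def complex_eq_iff)
    then have "?e z *\<^sub>R ((of_real (z \<bullet> axis j 1) + \<i> * of_real (z \<bullet> axis j \<i>)) * (2 * ?Q z)) = 2 * (?e z *\<^sub>R (lmono (j # l) z * herm w z ^ d))"
      by (simp add: scaleR_conv_of_real)
    then show "?e z *\<^sub>R (of_real (z \<bullet> axis j 1) * (2 * ?Q z)) + \<i> * (?e z *\<^sub>R (of_real (z \<bullet> axis j \<i>) * (2 * ?Q z))) = 2 * (?e z *\<^sub>R (lmono (j # l) z * herm w z ^ d))"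
      by (simp add: scaleR_conv_of_real algebra_simps)
  qed
  also have "\<dots> = 2 * gauss_pair (j # l) d w" unfolding gauss_pair_def by (rule integral_mult_right_zero)
  also have "(\<integral>z. ?e z *\<^sub>R ((2 * of_nat d * w $ j) * (lmono l z * herm w z ^ (d - 1))) \<partial>lborel) = (2 * of_nat d * w $ j) * gauss_pair l (d - 1) w"
    unfolding gauss_pair_def mult_scaleR_right[symmetric] by (rule integral_mult_right_zero)
  finally show ?thesis by (simp add: mult.assoc)
qed

text \<open>The opposite combination of the two real directions, \<partial>/\<partial>z_j,
  annihilates powers of \<langle>w,z\<rangle>, which are antiholomorphic in z. Hence cnj z_j
  \<langle>w,z\<rangle>^(d-1) integrates to 0 for every j, and \<langle>w,z\<rangle>^d is a linear
  combination of these.\<close>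

lemma gauss_pair_Nil: "d > 0 \<Longrightarrow> gauss_pair [] d w = 0"
proof -
  assume "d > 0"
  then obtain k where d: "d = Suc k" by (cases d) auto
  let ?e = "\<lambda>z::complex^'a. exp (- (norm z)\<^sup>2)"
  let ?L = "\<lambda>v z. dlmono [] v z * herm w z ^ k + lmono [] z * (of_nat k * herm w z ^ (k - 1) * herm w v)"
  let ?Q = "\<lambda>z. lmono [] z * herm w z ^ k"
  have zero: "(\<integral>z. ?e z *\<^sub>R (cnj (z $ j) * ?Q z) \<partial>lborel) = 0" for j
  proof -
    have eq: "?L (axis j 1) z - \<i> * ?L (axis j \<i>) z = 0" for z
      unfolding herm_axis by (simp add: algebra_simps)
    have "0 = (\<integral>z. (?e z *\<^sub>R ?L (axis j 1) z) - \<i> * (?e z *\<^sub>R ?L (axis j \<i>) z) \<partial>lborel)"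
      unfolding mult_scaleR_right scaleR_diff_right[symmetric] eq by simp
    also have "\<dots> = (\<integral>z. ?e z *\<^sub>R ?L (axis j 1) z \<partial>lborel) - \<i> * (\<integral>z. ?e z *\<^sub>R ?L (axis j \<i>) z \<partial>lborel)"
      by (intro integral_complex_combination(2) integrable_gauss_pair(3))
    also have "\<dots> = (\<integral>z. ?e z *\<^sub>R (of_real (z \<bullet> axis j 1) * (2 * ?Q z)) \<partial>lborel) - \<i> * (\<integral>z. ?e z *\<^sub>R (of_real (z \<bullet> axis j \<i>) * (2 * ?Q z)) \<partial>lborel)"
      by (simp only: gauss_pair_deriv)
    also have "\<dots> = (\<integral>z. ?e z *\<^sub>R (of_real (z \<bullet> axis j 1) * (2 * ?Q z)) - \<i> * (?e z *\<^sub>R (of_real (z \<bullet> axis j \<i>) * (2 * ?Q z))) \<partial>lborel)"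
      by (intro integral_complex_combination(2)[symmetric] integrable_gauss_pair(2))
    also have "\<dots> = (\<integral>z. 2 * (?e z *\<^sub>R (cnj (z $ j) * ?Q z)) \<partial>lborel)"
    proof (rule Bochner_Integration.integral_cong[OF refl])
      fix z :: "complex^'a"
      have "of_real (z \<bullet> axis j 1) - \<i> * of_real (z \<bullet> axis j \<i>) = cnj (z $ j)"
        by (simp add: inner_axis inner_complex_def complex_eq_iff)
      then have "?e z *\<^sub>R ((of_real (z \<bullet> axis j 1) - \<i> * of_real (z \<bullet> axis j \<i>)) * (2 * ?Q z)) = 2 * (?e z *\<^sub>R (cnj (z $ j) * ?Q z))"
        by (simp add: scaleR_conv_of_real)
      then show "?e z *\<^sub>R (of_real (z \<bullet> axis j 1) * (2 * ?Q z)) - \<i> * (?e z *\<^sub>R (of_real (z \<bullet> axis j \<i>) * (2 * ?Q z))) = 2 * (?e z *\<^sub>R (cnj (z $ j) * ?Q z))"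
        by (simp add: scaleR_conv_of_real algebra_simps)
    qed
    also have "\<dots> = 2 * (\<integral>z. ?e z *\<^sub>R (cnj (z $ j) * ?Q z) \<partial>lborel)" by (rule integral_mult_right_zero)
    finally show ?thesis by simp
  qed
  have "gauss_pair [] d w = (\<integral>z. (\<Sum>j\<in>UNIV. w $ j * (?e z *\<^sub>R (cnj (z $ j) * ?Q z))) \<partial>lborel)"
    unfolding gauss_pair_def d
    by (intro Bochner_Integration.integral_cong refl)
       (simp add: herm_def[of w] sum_distrib_left sum_distrib_right scaleR_conv_of_real mult_ac)
  also have "\<dots> = (\<Sum>j\<in>UNIV. w $ j * (\<integral>z. ?e z *\<^sub>R (cnj (z $ j) * ?Q z) \<partial>lborel))"
  proof -
    have "integrable lborel (\<lambda>z. w $ j * (?e z *\<^sub>R (cnj (z $ j) * ?Q z)))" for j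
      by (intro integrable_mult_right integrable_gauss_pair(1))
    then show ?thesis by (simp only: Bochner_Integration.integral_sum integral_mult_right_zero)
  qed
  also have "\<dots> = 0" unfolding zero by simp
  finally show ?thesis .
qed

lemma gauss_pair_eq:
  "gauss_pair l d w = (if length l = d then fact d * lmono l w * gauss_pair [] 0 w else 0)"
proof (induction l arbitrary: d)
  case Nil
  then show ?case using gauss_pair_Nil[of d w] by auto
next
  case (Cons j l)
  show ?case
  proof (cases d)
    case (Suc k)
    then show ?thesis using Cons[of k] by (simp add: gauss_pair_Cons)
  qed (simp add: gauss_pair_Cons)
qed

section \<open>The reproducing kernel\<close>

text \<open>Equal to \<pi>^n, since both Gaussian integrals are classical; kept as a quotient so
  that neither is evaluated. It cancels in the derivatives of log K.\<close>

definition vol_const :: "'n::finite itself \<Rightarrow> real" where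
  "vol_const _ = integral\<^sup>L lborel (\<lambda>z::complex^'n. exp (- (norm z)\<^sup>2)) / gauss.mom 0"

lemma vol_const_pos: "vol_const TYPE('n::finite) > 0"
proof -
  have dim: "0 + DIM(complex^'n) \<ge> 2" by (simp add: DIM_cart)
  have "has_bochner_integral lborel (\<lambda>z::complex^'n. exp (- (norm z)\<^sup>2) *\<^sub>R (1::real))
     (gauss.layer (0 + DIM(complex^'n)) *\<^sub>R (\<integral>z. indicator (cball 0 1) (z::complex^'n) *\<^sub>R 1 \<partial>lborel))"
    by (rule gauss.layer_cake[where D = 0]) (use dim in auto)
  then have "integral\<^sup>L lborel (\<lambda>z::complex^'n. exp (- (norm z)\<^sup>2)) = gauss.layer (0 + DIM(complex^'n)) * measure lborel (cball (0::complex^'n) 1)"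
    by (simp add: has_bochner_integral_iff)
  also have "\<dots> > 0" using gauss.layer_pos[OF dim] content_cball_pos[of 1 "0::complex^'n"] by (intro mult_pos_pos) auto
  finally show ?thesis using gauss.mom_pos[of 0] by (simp add: vol_const_def)
qed

lemma gauss_mom: "gauss.mom k = fact k * gauss.mom 0"
proof (induction k)
  case (Suc k)
  have "gauss.mom (Suc k) = real (Suc k) * gauss.mom k"
    using gauss.moment_by_parts[of k] by (simp add: has_bochner_integral_iff gauss.mom_def)
  then show ?case using Suc by simp
qed simp

lemma herm_scaleR: "herm w (r *\<^sub>R z) = r *\<^sub>R herm w z" "herm (r *\<^sub>R z) w = r *\<^sub>R herm z w"
  by (simp_all add: herm_def scaleR_sum_right)

lemma lmono_scaleR: "lmono l (r *\<^sub>R z) = r ^ length l *\<^sub>R lmono l z"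
  by (induction l) (auto simp: mult_ac)

lemma cnj_herm: "cnj (herm z w) = herm w z"
  by (simp add: herm_def mult.commute)

lemma herm_self: "herm z z = of_real ((norm z)\<^sup>2)"
proof -
  have "herm z z = (\<Sum>j\<in>UNIV. of_real ((norm (z $ j))\<^sup>2))"
    unfolding herm_def by (simp only: complex_norm_square)
  also have "\<dots> = of_real ((norm z)\<^sup>2)" by (simp add: norm_vec_def L2_set_def sum_nonneg)
  finally show ?thesis .
qed

context radial_weight
begin

abbreviation ew :: "complex^'n \<Rightarrow> real" where "ew z \<equiv> exp (- \<Psi> ((norm z)\<^sup>2))"

text \<open>The Gaussian pairing and this one are multiples of the same unit-ball integral I, by the
  factors \<open>gauss.layer\<close> and \<open>layer\<close>. Unequal degrees force I = 0; for
  equal ones the total exponent 2(d+n) is even, and the two factors are the moments of order d+n-1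
  times d+n.\<close>

lemma ew_pair:
  fixes w :: "complex^'n::finite"
  shows "(\<integral>z. ew z *\<^sub>R (lmono l z * herm w z ^ d) \<partial>lborel)
    = (if length l = d then of_real (vol_const TYPE('n) / coef (CARD('n) - 1) d) * lmono l w else 0)"
proof -
  let ?g = "\<lambda>z. lmono l z * herm w z ^ d"
  let ?D = "length l + d"
  define I where "I = (\<integral>z. indicator (cball 0 1) z *\<^sub>R ?g z \<partial>lborel)"
  have dim: "?D + DIM(complex^'n) \<ge> 2" by (simp add: DIM_cart trans_le_add2)
  have cont: "continuous_on UNIV ?g" by (intro continuous_intros)
  have hom: "?g (r *\<^sub>R z) = r ^ ?D *\<^sub>R ?g z" for r z
    by (simp add: lmono_scaleR herm_scaleR power_add scaleR_power mult_ac)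
  have B: "(\<integral>z. ew z *\<^sub>R ?g z \<partial>lborel) = layer (?D + DIM(complex^'n)) *\<^sub>R I"
    using layer_cake[OF cont hom dim] by (simp add: has_bochner_integral_iff I_def)
  have A: "gauss_pair l d w = gauss.layer (?D + DIM(complex^'n)) *\<^sub>R I"
    using gauss.layer_cake[OF cont hom dim] by (simp add: has_bochner_integral_iff I_def gauss_pair_def)
  show ?thesis
  proof (cases "length l = d")
    case False
    then have "I = 0" using A gauss_pair_eq[of l d w] gauss.layer_pos[OF dim] by auto
    then show ?thesis using B False by simp
  next
    case True
    define \<nu> where "\<nu> = CARD('n) - 1"
    have n: "CARD('n) = Suc \<nu>" by (simp add: \<nu>_def)
    have D: "?D + DIM(complex^'n) = 2 * Suc (d + \<nu>)" using True by (simp add: DIM_cart n)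
    define V where "V = integral\<^sup>L lborel (\<lambda>z::complex^'n. exp (- (norm z)\<^sup>2))"
    have "gauss_pair [] 0 w = integral\<^sup>L lborel (\<lambda>z::complex^'n. complex_of_real (exp (- (norm z)\<^sup>2)))"
      by (simp add: gauss_pair_def scaleR_conv_of_real)
    then have gp: "gauss_pair [] 0 w = of_real V" by (simp only: V_def integral_complex_of_real)
    have "gauss_pair l d w = of_real (fact d * V) * lmono l w" using gauss_pair_eq[of l d w] True gp by simp
    moreover have "gauss.layer (2 * Suc (d + \<nu>)) = real (Suc (d + \<nu>)) * (fact (d + \<nu>) * gauss.mom 0)"
      unfolding gauss.layer_even gauss_mom[of "d + \<nu>"] ..
    ultimately have "(real (Suc (d + \<nu>)) * (fact (d + \<nu>) * gauss.mom 0)) *\<^sub>R I = of_real (fact d * V) * lmono l w"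
      using A unfolding D by simp
    moreover have "J = of_real (b / a) * L" if "a *\<^sub>R J = of_real b * L" "a \<noteq> 0" for a b :: real and J L :: complex
    proof -
      have "J = of_real (1 / a) * (a *\<^sub>R J)" using that(2) by (simp add: scaleR_conv_of_real)
      then show ?thesis unfolding that(1) by simp
    qed
    ultimately have I: "I = of_real (fact d * V / (real (Suc (d + \<nu>)) * (fact (d + \<nu>) * gauss.mom 0))) * lmono l w"
      using gauss.mom_pos[of 0] by (metis fact_nonzero mult_eq_0_iff nat.distinct(1) of_nat_eq_0_iff less_irrefl)
    have "(\<integral>z. ew z *\<^sub>R ?g z \<partial>lborel) = of_real (real (Suc (d + \<nu>)) * mom (d + \<nu>) * (fact d * V / (real (Suc (d + \<nu>)) * (fact (d + \<nu>) * gauss.mom 0)))) * lmono l w"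
      unfolding B D layer_even I by (simp only: scaleR_conv_of_real of_real_mult mult.assoc)
    also have "real (Suc (d + \<nu>)) * mom (d + \<nu>) * (fact d * V / (real (Suc (d + \<nu>)) * (fact (d + \<nu>) * gauss.mom 0))) = vol_const TYPE('n) / coef \<nu> d"
    proof -
      have "S * m * (f * V / (S * (f' * g))) = (V / g) / (f' / (f * m))" if "S \<noteq> 0" for S m f f' g :: real
        using that by (simp add: mult_ac)
      from this[of "real (Suc (d + \<nu>))"] show ?thesis by (simp add: vol_const_def coef_def V_def del: of_nat_Suc)
    qed
    finally show ?thesis using True by (simp only: \<nu>_def if_True refl)
  qed
qed

lemma integrable_ew:
  fixes f :: "complex^'n \<Rightarrow> 'b::{banach, second_countable_topology}"
  assumes "continuous_on UNIV f" "poly_growth f"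
  shows "integrable lborel (\<lambda>z. ew z *\<^sub>R f z)"
  by (rule integrable_poly_growth[OF assms]) (simp add: DIM_cart)

text \<open>Each factor \<langle>z,w\<rangle> is expanded into coordinates, which join the list of
  the monomial. The case of the empty list provides the norms of the partial sums of the
  kernel.\<close>

lemma ew_pair_herm:
  fixes w :: "complex^'n::finite"
  shows "(\<integral>z. ew z *\<^sub>R (lmono l z * herm z w ^ k * herm w z ^ d) \<partial>lborel)
    = (if length l + k = d then of_real (vol_const TYPE('n) / coef (CARD('n) - 1) d) * (lmono l w * herm w w ^ k) else 0)"
proof (induction k arbitrary: l)
  case 0
  then show ?case using ew_pair[of l w d] by simp
next
  case (Suc k)
  have "(\<integral>z. ew z *\<^sub>R (lmono l z * herm z w ^ Suc k * herm w z ^ d) \<partial>lborel)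
    = (\<integral>z. (\<Sum>j\<in>UNIV. cnj (w $ j) * (ew z *\<^sub>R (lmono (j # l) z * herm z w ^ k * herm w z ^ d))) \<partial>lborel)"
    by (intro Bochner_Integration.integral_cong refl)
       (simp add: herm_def[of _ w] sum_distrib_left sum_distrib_right scaleR_conv_of_real mult_ac)
  also have "\<dots> = (\<Sum>j\<in>UNIV. cnj (w $ j) * (\<integral>z. ew z *\<^sub>R (lmono (j # l) z * herm z w ^ k * herm w z ^ d) \<partial>lborel))"
  proof -
    have "integrable lborel (\<lambda>z. cnj (w $ j) * (ew z *\<^sub>R (lmono (j # l) z * herm z w ^ k * herm w z ^ d)))" for j
      by (intro integrable_mult_right integrable_ew continuous_intros poly_growth_mult poly_growth_power poly_growth_herm poly_growth_lmono)
    then show ?thesis by (simp only: Bochner_Integration.integral_sum integral_mult_right_zero)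
  qed
  also have "\<dots> = (if length l + Suc k = d then of_real (vol_const TYPE('n) / coef (CARD('n) - 1) d) * (lmono l w * herm w w ^ Suc k) else 0)"
  proof -
    have "herm w w = (\<Sum>j\<in>UNIV. cnj (w $ j) * w $ j)" by (simp add: herm_def mult.commute)
    then show ?thesis unfolding Suc by (auto simp: sum_distrib_left sum_distrib_right mult_ac)
  qed
  finally show ?case .
qed

end

section \<open>Polynomials and square-integrable pairings\<close>

lemma lmono_append: "lmono (xs @ ys) z = lmono xs z * lmono ys z"
  by (simp add: lmono_def)

lemma ex_lmono: "finite S \<Longrightarrow> \<exists>l. \<forall>z. (\<Prod>j\<in>S. (z $ j) ^ \<alpha> j) = lmono l z"
proof (induction S rule: finite_induct)
  case empty
  then show ?case by (intro exI[of _ "[]"]) simp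
next
  case (insert j S)
  then obtain l where l: "\<And>z. (\<Prod>j\<in>S. (z $ j) ^ \<alpha> j) = lmono l z" by blast
  have "lmono (replicate (\<alpha> j) j) z = (z $ j) ^ \<alpha> j" for z by (simp add: lmono_def)
  then show ?case using insert(1,2) l by (intro exI[of _ "replicate (\<alpha> j) j @ l"]) (simp add: lmono_append)
qed

lemma holo_polys_lmono:
  assumes "p \<in> (holo_polys :: (complex^'n::finite \<Rightarrow> complex) set)"
  shows "\<exists>(A :: ('n \<Rightarrow> nat) set) c L. finite A \<and> p = (\<lambda>z. \<Sum>\<alpha>\<in>A. c \<alpha> * lmono (L \<alpha>) z)"
proof -
  from assms obtain A :: "('n \<Rightarrow> nat) set" and c where A: "finite A" "p = (\<lambda>z. \<Sum>\<alpha>\<in>A. c \<alpha> * (\<Prod>j\<in>UNIV. (z $ j) ^ \<alpha> j))"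
    unfolding holo_polys_def by blast
  have "\<forall>\<alpha>::'n \<Rightarrow> nat. \<exists>l. \<forall>z. (\<Prod>j\<in>UNIV. (z $ j) ^ \<alpha> j) = lmono l z" by (intro allI ex_lmono) simp
  then obtain L where "\<And>\<alpha>::'n \<Rightarrow> nat. \<And>z. (\<Prod>j\<in>UNIV. (z $ j) ^ \<alpha> j) = lmono (L \<alpha>) z" by metis
  then show ?thesis using A by auto
qed

lemma holo_polysI: "finite A \<Longrightarrow> (\<And>z. p z = (\<Sum>\<alpha>\<in>A. c \<alpha> * (\<Prod>j\<in>UNIV. (z $ j) ^ \<alpha> j))) \<Longrightarrow> p \<in> holo_polys"
  unfolding holo_polys_def by blast

lemma holo_polys_const: "(\<lambda>_. a) \<in> holo_polys"
  by (rule holo_polysI[of "{\<lambda>_. 0}" _ "\<lambda>_. a"]) auto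

lemma holo_polys_add:
  assumes "p \<in> holo_polys" "q \<in> holo_polys" shows "(\<lambda>z. p z + q z) \<in> holo_polys"
proof -
  obtain A c where A: "finite A" "p = (\<lambda>z. \<Sum>\<alpha>\<in>A. c \<alpha> * (\<Prod>j\<in>UNIV. (z $ j) ^ \<alpha> j))" using assms(1) unfolding holo_polys_def by blast
  obtain B d where B: "finite B" "q = (\<lambda>z. \<Sum>\<alpha>\<in>B. d \<alpha> * (\<Prod>j\<in>UNIV. (z $ j) ^ \<alpha> j))" using assms(2) unfolding holo_polys_def by blast
  show ?thesis
  proof (rule holo_polysI[of "A \<union> B" _ "\<lambda>\<alpha>. (if \<alpha> \<in> A then c \<alpha> else 0) + (if \<alpha> \<in> B then d \<alpha> else 0)"])
    fix z :: "complex^'a"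
    let ?m = "\<lambda>\<alpha>. \<Prod>j\<in>UNIV. (z $ j) ^ \<alpha> j"
    have "p z = (\<Sum>\<alpha>\<in>A \<union> B. (if \<alpha> \<in> A then c \<alpha> else 0) * ?m \<alpha>)"
      unfolding A(2) using A(1) B(1) by (intro sum.mono_neutral_cong_left) auto
    moreover have "q z = (\<Sum>\<alpha>\<in>A \<union> B. (if \<alpha> \<in> B then d \<alpha> else 0) * ?m \<alpha>)"
      unfolding B(2) using A(1) B(1) by (intro sum.mono_neutral_cong_left) auto
    ultimately show "p z + q z = (\<Sum>\<alpha>\<in>A \<union> B. ((if \<alpha> \<in> A then c \<alpha> else 0) + (if \<alpha> \<in> B then d \<alpha> else 0)) * ?m \<alpha>)"
      by (simp only: distrib_right sum.distrib)
  qed (use A B in auto)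
qed

lemma holo_polys_cmult:
  assumes "p \<in> holo_polys" shows "(\<lambda>z. a * p z) \<in> holo_polys"
proof -
  obtain A c where A: "finite A" "p = (\<lambda>z. \<Sum>\<alpha>\<in>A. c \<alpha> * (\<Prod>j\<in>UNIV. (z $ j) ^ \<alpha> j))" using assms(1) unfolding holo_polys_def by blast
  show ?thesis
    by (rule holo_polysI[of A _ "\<lambda>\<alpha>. a * c \<alpha>"]) (auto simp: A sum_distrib_left mult_ac)
qed

lemma holo_polys_nth_mult:
  assumes "p \<in> holo_polys" shows "(\<lambda>z. z $ i * p z) \<in> holo_polys"
proof -
  obtain A c where A: "finite A" "p = (\<lambda>z. \<Sum>\<alpha>\<in>A. c \<alpha> * (\<Prod>j\<in>UNIV. (z $ j) ^ \<alpha> j))" using assms(1) unfolding holo_polys_def by blast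
  define s where "s \<alpha> = \<alpha>(i := Suc (\<alpha> i))" for \<alpha> :: "'a \<Rightarrow> nat"
  have inj: "inj s"
  proof (rule injI)
    fix \<alpha> \<beta> assume "s \<alpha> = s \<beta>"
    then have "s \<alpha> k = s \<beta> k" for k by simp
    then have "\<alpha> k = \<beta> k" for k using \<open>\<And>k. s \<alpha> k = s \<beta> k\<close>[of k] by (cases "k = i") (auto simp: s_def)
    then show "\<alpha> = \<beta>" by blast
  qed
  have m: "(\<Prod>j\<in>UNIV. (z $ j) ^ s \<alpha> j) = z $ i * (\<Prod>j\<in>UNIV. (z $ j) ^ \<alpha> j)" for z :: "complex^'a" and \<alpha>
  proof -
    have "(\<Prod>j\<in>UNIV. (z $ j) ^ s \<alpha> j) = z $ i ^ s \<alpha> i * (\<Prod>j\<in>UNIV - {i}. (z $ j) ^ s \<alpha> j)"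
      by (rule prod.remove) auto
    also have "(\<Prod>j\<in>UNIV - {i}. (z $ j) ^ s \<alpha> j) = (\<Prod>j\<in>UNIV - {i}. (z $ j) ^ \<alpha> j)"
      by (intro prod.cong) (auto simp: s_def)
    also have "z $ i ^ s \<alpha> i = z $ i * z $ i ^ \<alpha> i" by (simp add: s_def)
    finally show ?thesis by (simp add: prod.remove[of UNIV i] mult.assoc)
  qed
  show ?thesis
  proof (rule holo_polysI[of "s ` A" _ "\<lambda>\<beta>. c (inv s \<beta>)"])
    fix z :: "complex^'a"
    have "(\<Sum>\<beta>\<in>s ` A. c (inv s \<beta>) * (\<Prod>j\<in>UNIV. (z $ j) ^ \<beta> j)) = (\<Sum>\<alpha>\<in>A. c \<alpha> * (\<Prod>j\<in>UNIV. (z $ j) ^ s \<alpha> j))"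
      using inj by (subst sum.reindex) (auto intro: inj_on_subset simp: o_def)
    then show "z $ i * p z = (\<Sum>\<beta>\<in>s ` A. c (inv s \<beta>) * (\<Prod>j\<in>UNIV. (z $ j) ^ \<beta> j))"
      unfolding m A(2) by (simp add: sum_distrib_left mult_ac)
  qed (use A in auto)
qed

lemma holo_polys_sum: "finite I \<Longrightarrow> (\<And>i. i \<in> I \<Longrightarrow> f i \<in> holo_polys) \<Longrightarrow> (\<lambda>z. \<Sum>i\<in>I. f i z) \<in> holo_polys"
  by (induction I rule: finite_induct) (auto intro: holo_polys_const[of 0, simplified] holo_polys_add)

lemma holo_polys_herm_power: "(\<lambda>z. herm z w ^ d) \<in> holo_polys"
proof (induction d)
  case (Suc d)
  have "(\<lambda>z. herm z w ^ Suc d) = (\<lambda>z. \<Sum>j\<in>UNIV. cnj (w $ j) * (z $ j * herm z w ^ d))"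
    by (simp add: fun_eq_iff herm_def[of _ w] sum_distrib_right mult_ac)
  then show ?case by (simp only:) (intro holo_polys_sum holo_polys_cmult holo_polys_nth_mult Suc finite)
qed (simp add: holo_polys_const)

lemma measurable_cnj [measurable]: "cnj \<in> borel_measurable borel"
  by (intro borel_measurable_continuous_onI continuous_intros)

text \<open>Young's inequality |f g| \<le> \<epsilon> |f|^2 + |g|^2/\<epsilon>, integrated. The
  second claim is used with g the error of an approximation, where smallness matters and the sharp
  Cauchy-Schwarz constant does not.\<close>

lemma L2_pairing:
  fixes f g :: "'a \<Rightarrow> complex"
  assumes [measurable]: "f \<in> borel_measurable M" "g \<in> borel_measurable M"
    and f: "integrable M (\<lambda>x. (cmod (f x))\<^sup>2)" and g: "integrable M (\<lambda>x. (cmod (g x))\<^sup>2)"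
  shows "integrable M (\<lambda>x. f x * cnj (g x))"
    and "\<epsilon> > 0 \<Longrightarrow> (\<integral>x. (cmod (g x))\<^sup>2 \<partial>M) \<le> \<epsilon>\<^sup>2 \<Longrightarrow>
      cmod (\<integral>x. f x * cnj (g x) \<partial>M) \<le> \<epsilon> * (1 + (\<integral>x. (cmod (f x))\<^sup>2 \<partial>M))"
proof -
  have young: "cmod (f x * cnj (g x)) \<le> \<epsilon> * (cmod (f x))\<^sup>2 + 1 / \<epsilon> * (cmod (g x))\<^sup>2" if "\<epsilon> > 0" for x \<epsilon>
  proof -
    have "2 * cmod (f x) * cmod (g x) \<le> \<epsilon> * (cmod (f x))\<^sup>2 + 1 / \<epsilon> * (cmod (g x))\<^sup>2"
    proof -
      have "0 \<le> (\<epsilon> * cmod (f x) - cmod (g x))\<^sup>2 / \<epsilon>" using that by simp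
      also have "\<dots> = \<epsilon> * (cmod (f x))\<^sup>2 + 1 / \<epsilon> * (cmod (g x))\<^sup>2 - 2 * cmod (f x) * cmod (g x)"
        using that by (simp add: power2_eq_square field_simps)
      finally show ?thesis by simp
    qed
    moreover have "cmod (f x) * cmod (g x) \<ge> 0" by simp
    ultimately show ?thesis
      using order_trans[of "cmod (f x) * cmod (g x)" "2 * cmod (f x) * cmod (g x)"] by (simp add: norm_mult)
  qed
  show int: "integrable M (\<lambda>x. f x * cnj (g x))"
  proof (rule Bochner_Integration.integrable_bound)
    show "integrable M (\<lambda>x. 1 * (cmod (f x))\<^sup>2 + 1 / 1 * (cmod (g x))\<^sup>2)" using f g by simp
    show "AE x in M. norm (f x * cnj (g x)) \<le> norm (1 * (cmod (f x))\<^sup>2 + 1 / 1 * (cmod (g x))\<^sup>2)"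
      using young[of 1] by (intro AE_I2) (simp add: order_trans[OF _ abs_ge_self])
  qed measurable
  assume \<epsilon>: "\<epsilon> > 0" and small: "(\<integral>x. (cmod (g x))\<^sup>2 \<partial>M) \<le> \<epsilon>\<^sup>2"
  have "cmod (\<integral>x. f x * cnj (g x) \<partial>M) \<le> (\<integral>x. cmod (f x * cnj (g x)) \<partial>M)" by (rule integral_norm_bound)
  also have "\<dots> \<le> (\<integral>x. \<epsilon> * (cmod (f x))\<^sup>2 + 1 / \<epsilon> * (cmod (g x))\<^sup>2 \<partial>M)"
    using f g int young[OF \<epsilon>] by (intro integral_mono) auto
  also have "\<dots> = \<epsilon> * (\<integral>x. (cmod (f x))\<^sup>2 \<partial>M) + 1 / \<epsilon> * (\<integral>x. (cmod (g x))\<^sup>2 \<partial>M)" using f g by simp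
  also have "\<dots> \<le> \<epsilon> * (\<integral>x. (cmod (f x))\<^sup>2 \<partial>M) + 1 / \<epsilon> * \<epsilon>\<^sup>2"
    using small \<epsilon> by (intro add_left_mono mult_left_mono) auto
  also have "\<dots> = \<epsilon> * (1 + (\<integral>x. (cmod (f x))\<^sup>2 \<partial>M))" using \<epsilon> by (simp add: power2_eq_square algebra_simps)
  finally show "cmod (\<integral>x. f x * cnj (g x) \<partial>M) \<le> \<epsilon> * (1 + (\<integral>x. (cmod (f x))\<^sup>2 \<partial>M))" .
qed

lemma norm_add_square_le: "(cmod (a + b))\<^sup>2 \<le> 2 * (cmod a)\<^sup>2 + 2 * (cmod b)\<^sup>2"
proof -
  have "(cmod (a + b))\<^sup>2 \<le> (cmod a + cmod b)\<^sup>2" by (intro power_mono norm_triangle_ineq) auto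
  also have "\<dots> \<le> 2 * (cmod a)\<^sup>2 + 2 * (cmod b)\<^sup>2"
    using sum_squares_bound[of "cmod a" "cmod b"] by (simp add: power2_sum)
  finally show ?thesis .
qed

lemma square_integrable_diff:
  fixes f g :: "'a \<Rightarrow> complex"
  assumes [measurable]: "f \<in> borel_measurable M" "g \<in> borel_measurable M"
    and f: "integrable M (\<lambda>x. (cmod (f x))\<^sup>2)" and g: "integrable M (\<lambda>x. (cmod (g x))\<^sup>2)"
  shows "integrable M (\<lambda>x. (cmod (f x - g x))\<^sup>2)"
proof (rule Bochner_Integration.integrable_bound)
  show "integrable M (\<lambda>x. 2 * (cmod (f x))\<^sup>2 + 2 * (cmod (g x))\<^sup>2)" using f g by simp
  show "AE x in M. norm ((cmod (f x - g x))\<^sup>2) \<le> norm (2 * (cmod (f x))\<^sup>2 + 2 * (cmod (g x))\<^sup>2)"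
  proof (rule AE_I2)
    fix x
    show "norm ((cmod (f x - g x))\<^sup>2) \<le> norm (2 * (cmod (f x))\<^sup>2 + 2 * (cmod (g x))\<^sup>2)"
      using norm_add_square_le[of "f x" "- g x"] by simp
  qed
qed measurable

section \<open>The kernel as a power series in \<langle>z,w\<rangle>\<close>

context radial_weight
begin

abbreviation fm :: "(complex^'n) measure" where "fm \<equiv> fock_measure \<Psi>"

lemma sets_fm [measurable_cong, simp]: "sets fm = sets borel" by (simp add: fock_measure_def)
lemma space_fm [simp]: "space fm = UNIV" by (simp add: fock_measure_def)

lemma borel_measurable_fm [simp]: "borel_measurable fm = borel_measurable borel"
  by (rule measurable_cong_sets) auto

lemma measurable_ew [measurable]: "ew \<in> borel_measurable borel"
  by measurable

lemma integrable_fm: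
  fixes f :: "complex^'n \<Rightarrow> 'b::{banach, second_countable_topology}"
  assumes "f \<in> borel_measurable borel"
  shows "integrable fm f \<longleftrightarrow> integrable lborel (\<lambda>z. ew z *\<^sub>R f z)"
  unfolding fock_measure_def using assms measurable_ew by (subst integrable_density) simp_all

lemma integral_fm:
  fixes f :: "complex^'n \<Rightarrow> 'b::{banach, second_countable_topology}"
  assumes "f \<in> borel_measurable borel"
  shows "(\<integral>z. f z \<partial>fm) = (\<integral>z. ew z *\<^sub>R f z \<partial>lborel)"
  unfolding fock_measure_def using assms measurable_ew by (subst integral_density) simp_all

lemma integrable_fm_poly_growth:
  fixes f :: "complex^'n \<Rightarrow> 'b::{banach, second_countable_topology}"
  assumes "continuous_on UNIV f" "poly_growth f"
  shows "integrable fm f"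
  using integrable_ew[OF assms] integrable_fm[OF borel_measurable_continuous_onI[OF assms(1)]] by simp

text \<open>The reciprocals of the constants in \<open>ew_pair\<close>, so that a sum of the terms
  \<open>kcoef\<close> times \<langle>z,w\<rangle>^d reproduces monomials.\<close>

definition kcoef :: "'n::finite itself \<Rightarrow> nat \<Rightarrow> real" where
  "kcoef _ d = coef (CARD('n) - 1) d / vol_const TYPE('n)"

definition kser :: "'n::finite itself \<Rightarrow> complex \<Rightarrow> complex" where
  "kser T \<zeta> = (\<Sum>d. of_real (kcoef T d) * \<zeta> ^ d)"

definition Ker :: "complex^'n::finite \<Rightarrow> complex^'n \<Rightarrow> complex" where
  "Ker z w = kser TYPE('n) (herm z w)"

definition part :: "nat \<Rightarrow> complex^'n::finite \<Rightarrow> complex^'n \<Rightarrow> complex" where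
  "part N z w = (\<Sum>d<N. of_real (kcoef TYPE('n) d) * herm z w ^ d)"

lemma kcoef_pos: "kcoef (T::'n::finite itself) d > 0"
  using coef_pos[of "CARD('n) - 1" d] vol_const_pos[where 'n = 'n] by (simp add: kcoef_def)

lemma summable_kcoef: "summable (\<lambda>d. kcoef (T::'n::finite itself) d * x ^ d)"
  using summable_mult[OF summable_gen[of "CARD('n) - 1" x], of "1 / vol_const TYPE('n)"] by (simp add: kcoef_def)

lemma suminf_kcoef: "(\<Sum>d. kcoef (T::'n::finite itself) d * x ^ d) = gen (CARD('n) - 1) x / vol_const TYPE('n)"
  using suminf_mult[OF summable_gen[of "CARD('n) - 1" x], of "1 / vol_const TYPE('n)"] by (simp add: kcoef_def gen_def)

lemma summable_kser: "summable (\<lambda>d. of_real (kcoef T d) * \<zeta> ^ d :: complex)"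
proof (rule summable_norm_cancel)
  show "summable (\<lambda>d. norm (of_real (kcoef T d) * \<zeta> ^ d :: complex))"
    using summable_kcoef[of T "norm \<zeta>"] by (simp add: norm_mult norm_power abs_of_pos[OF kcoef_pos])
qed

lemma kser_deriv: "(kser T has_field_derivative (\<Sum>d. diffs (\<lambda>d. of_real (kcoef T d)) d * \<zeta> ^ d)) (at \<zeta>)"
  unfolding kser_def by (rule termdiffs_strong_converges_everywhere) (rule summable_kser)

lemma kser_of_real: "kser (T::'n::finite itself) (of_real x) = of_real (gen (CARD('n) - 1) x / vol_const TYPE('n))"
proof -
  have "(\<lambda>d. kcoef T d * x ^ d) sums (gen (CARD('n) - 1) x / vol_const TYPE('n))"
    using summable_sums[OF summable_kcoef[of T x]] suminf_kcoef[of T x] by simp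
  then have "(\<lambda>d. of_real (kcoef T d * x ^ d) :: complex) sums of_real (gen (CARD('n) - 1) x / vol_const TYPE('n))"
    by (rule sums_of_real)
  then show ?thesis unfolding kser_def by (simp add: sums_iff)
qed

lemma cnj_part: "cnj (part N z w) = part N w z"
  by (simp add: part_def cnj_herm)

lemma part_tendsto: "(\<lambda>N. part N z w) \<longlonglongrightarrow> Ker z w"
  unfolding part_def Ker_def kser_def by (rule summable_LIMSEQ[OF summable_kser])

lemma Ker_has_derivative: "((\<lambda>z. Ker z w) has_derivative (\<lambda>v. herm v w * (\<Sum>d. diffs (\<lambda>d. of_real (kcoef TYPE('n) d)) d * herm z w ^ d))) (at (z::complex^'n::finite))"
proof -
  have lin: "bounded_linear (\<lambda>z. herm z w)"
    unfolding herm_def by (intro bounded_linear_sum bounded_linear_mult_const[OF bounded_linear_vec_nth])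
  have "((\<lambda>z. herm z w) has_derivative (\<lambda>v. herm v w)) (at z)"
    by (rule bounded_linear_imp_has_derivative[OF lin])
  from has_derivative_compose[OF this kser_deriv[of "TYPE('n)" "herm z w", unfolded has_field_derivative_def]]
  show ?thesis unfolding Ker_def by (simp add: mult.commute)
qed

lemma entire_Ker: "entire (\<lambda>z. Ker z w)"
  unfolding entire_def
proof (intro allI exI conjI)
  fix z show "((\<lambda>z. Ker z w) has_derivative (\<lambda>v. herm v w * (\<Sum>d. diffs (\<lambda>d. of_real (kcoef TYPE('a) d)) d * herm z w ^ d))) (at z)"
    by (rule Ker_has_derivative)
  fix c v show "herm (c *s v) w * (\<Sum>d. diffs (\<lambda>d. of_real (kcoef TYPE('a) d)) d * herm z w ^ d)
     = c * (herm v w * (\<Sum>d. diffs (\<lambda>d. of_real (kcoef TYPE('a) d)) d * herm z w ^ d))"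
    by (simp add: herm_def sum_distrib_left mult_ac)
qed

lemma continuous_Ker: "continuous_on UNIV (\<lambda>z. Ker z w)"
  using Ker_has_derivative by (intro continuous_at_imp_continuous_on ballI) (rule has_derivative_continuous)

lemma measurable_Ker [measurable]: "(\<lambda>z. Ker z w) \<in> borel_measurable borel"
  by (rule borel_measurable_continuous_onI[OF continuous_Ker])

lemma continuous_part: "continuous_on UNIV (\<lambda>z. part N z w)" "continuous_on UNIV (\<lambda>z. part N w z)"
  unfolding part_def by (intro continuous_intros)+

lemma measurable_part [measurable]: "(\<lambda>z. part N z w) \<in> borel_measurable borel"
  by (rule borel_measurable_continuous_onI[OF continuous_part(1)])

lemma poly_growth_part: "poly_growth (\<lambda>z. part N z w)" "poly_growth (\<lambda>z. part N w z)"
  unfolding part_def by (intro poly_growth_sum poly_growth_mult poly_growth_const poly_growth_power poly_growth_herm)+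

lemma part_in_holo_polys: "(\<lambda>z. part N z w) \<in> holo_polys"
  unfolding part_def by (intro holo_polys_sum holo_polys_cmult holo_polys_herm_power) auto

lemma fm_pair_herm:
  fixes w :: "complex^'n::finite"
  shows "(\<integral>z. lmono l z * herm z w ^ k * herm w z ^ d \<partial>fm)
    = (if length l + k = d then lmono l w * herm w w ^ k / of_real (kcoef TYPE('n) d) else 0)"
proof -
  have "continuous_on UNIV (\<lambda>z. lmono l z * herm z w ^ k * herm w z ^ d)" by (intro continuous_intros)
  then have "(\<integral>z. lmono l z * herm z w ^ k * herm w z ^ d \<partial>fm) = (\<integral>z. ew z *\<^sub>R (lmono l z * herm z w ^ k * herm w z ^ d) \<partial>lborel)"
    by (intro integral_fm borel_measurable_continuous_onI)
  then show ?thesis unfolding ew_pair_herm by (simp add: kcoef_def)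
qed

lemma integrable_fm_pair: "integrable fm (\<lambda>z. a * (lmono l z * herm z w ^ k * herm w z ^ d))"
  by (intro integrable_fm_poly_growth continuous_intros poly_growth_mult poly_growth_const poly_growth_power poly_growth_herm poly_growth_lmono)

lemma part_reproduces:
  fixes w :: "complex^'n::finite"
  shows "(\<integral>z. lmono l z * cnj (part N z w) \<partial>fm) = (if length l < N then lmono l w else 0)"
proof -
  have "(\<integral>z. lmono l z * cnj (part N z w) \<partial>fm) = (\<integral>z. (\<Sum>d<N. of_real (kcoef TYPE('n) d) * (lmono l z * herm z w ^ 0 * herm w z ^ d)) \<partial>fm)"
    unfolding cnj_part by (simp add: part_def sum_distrib_left mult_ac)
  also have "\<dots> = (\<Sum>d<N. of_real (kcoef TYPE('n) d) * (if length l + 0 = d then lmono l w * herm w w ^ 0 / of_real (kcoef TYPE('n) d) else 0))"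
    by (subst Bochner_Integration.integral_sum[OF integrable_fm_pair], subst integral_mult_right_zero, subst fm_pair_herm) (rule refl)
  also have "\<dots> = (\<Sum>d<N. if d = length l then lmono l w else 0)"
    using kcoef_pos[of "TYPE('n)"] by (intro sum.cong) (auto simp: less_imp_neq[symmetric])
  also have "\<dots> = (if length l < N then lmono l w else 0)" by simp
  finally show ?thesis .
qed

text \<open>Terms of different degree are orthogonal by \<open>fm_pair_herm\<close>, and on the
  diagonal one of the two coefficients cancels. The result is a block of a convergent series, so the
  partial sums are Cauchy.\<close>

lemma part_norm:
  fixes w :: "complex^'n::finite"
  shows "(\<integral>z. (cmod (part (N + K) z w - part N z w))\<^sup>2 \<partial>fm) = (\<Sum>d<K. kcoef TYPE('n) (d + N) * ((norm w)\<^sup>2) ^ (d + N))"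
proof -
  let ?k = "\<lambda>d. complex_of_real (kcoef TYPE('n) d)"
  have diff: "part (N + K) z w - part N z w = (\<Sum>d<K. ?k (d + N) * herm z w ^ (d + N))" for z w :: "complex^'n"
  proof (induction K)
    case (Suc K)
    have "part (N + Suc K) z w - part N z w = (part (N + K) z w - part N z w) + ?k (N + K) * herm z w ^ (N + K)"
      by (simp add: part_def)
    also have "\<dots> = (\<Sum>d<K. ?k (d + N) * herm z w ^ (d + N)) + ?k (K + N) * herm z w ^ (K + N)"
      unfolding Suc by (simp only: add.commute[of N K])
    finally show ?case by (simp only: sum.lessThan_Suc)
  qed simp
  have "complex_of_real (\<integral>z. (cmod (part (N + K) z w - part N z w))\<^sup>2 \<partial>fm) = (\<integral>z. complex_of_real ((cmod (part (N + K) z w - part N z w))\<^sup>2) \<partial>fm)"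
    by (rule integral_complex_of_real[symmetric])
  also have "\<dots> = (\<integral>z. (\<Sum>d<K. \<Sum>e<K. (?k (d + N) * ?k (e + N)) * (lmono [] z * herm z w ^ (d + N) * herm w z ^ (e + N))) \<partial>fm)"
  proof (rule Bochner_Integration.integral_cong[OF refl])
    fix z :: "complex^'n"
    have "complex_of_real ((cmod (part (N + K) z w - part N z w))\<^sup>2) = (part (N + K) z w - part N z w) * (part (N + K) w z - part N w z)"
      by (simp only: complex_norm_square complex_cnj_diff cnj_part)
    also have "\<dots> = (\<Sum>d<K. \<Sum>e<K. (?k (d + N) * ?k (e + N)) * (lmono [] z * herm z w ^ (d + N) * herm w z ^ (e + N)))"
      unfolding diff sum_product by (simp add: mult_ac)
    finally show "complex_of_real ((cmod (part (N + K) z w - part N z w))\<^sup>2) = \<dots>" .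
  qed
  also have "\<dots> = (\<Sum>d<K. \<Sum>e<K. (?k (d + N) * ?k (e + N)) * (if length ([]::'n list) + (d + N) = e + N then lmono [] w * herm w w ^ (d + N) / ?k (e + N) else 0))"
  proof -
    have i1: "integrable fm (\<lambda>z. \<Sum>e<K. (?k (d + N) * ?k (e + N)) * (lmono [] z * herm z w ^ (d + N) * herm w z ^ (e + N)))" for d
      by (intro Bochner_Integration.integrable_sum integrable_fm_pair)
    show ?thesis
      by (simp only: Bochner_Integration.integral_sum[OF i1] Bochner_Integration.integral_sum[OF integrable_fm_pair] integral_mult_right_zero fm_pair_herm)
  qed
  also have "\<dots> = (\<Sum>d<K. \<Sum>e<K. if e = d then ?k (d + N) * herm w w ^ (d + N) else 0)"
    using kcoef_pos[of "TYPE('n)"] by (intro sum.cong refl) (auto simp: less_imp_neq[symmetric])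
  also have "\<dots> = (\<Sum>d<K. ?k (d + N) * herm w w ^ (d + N))" by (intro sum.cong refl) simp
  also have "\<dots> = of_real (\<Sum>d<K. kcoef TYPE('n) (d + N) * ((norm w)\<^sup>2) ^ (d + N))" by (simp add: herm_self)
  finally show ?thesis by (simp only: of_real_eq_iff)
qed


lemma tail_tendsto: "(\<lambda>N. \<Sum>d. kcoef (T::'n::finite itself) (d + N) * x ^ (d + N)) \<longlonglongrightarrow> 0"
proof -
  have "(\<lambda>N. (\<Sum>d. kcoef T d * x ^ d) - (\<Sum>d<N. kcoef T d * x ^ d)) \<longlonglongrightarrow> (\<Sum>d. kcoef T d * x ^ d) - (\<Sum>d. kcoef T d * x ^ d)"
    by (intro tendsto_diff tendsto_const summable_LIMSEQ summable_kcoef)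
  then show ?thesis by (simp add: suminf_minus_initial_segment[OF summable_kcoef])
qed

text \<open>Fatou's lemma: the blocks of length K converge pointwise to the remainder as K grows,
  and their squared norms stay below the full tail.\<close>

lemma Ker_part_L2:
  fixes w :: "complex^'n::finite"
  shows "integrable fm (\<lambda>z. (cmod (Ker z w - part N z w))\<^sup>2)"
    and "(\<integral>z. (cmod (Ker z w - part N z w))\<^sup>2 \<partial>fm) \<le> (\<Sum>d. kcoef TYPE('n) (d + N) * ((norm w)\<^sup>2) ^ (d + N))"
proof -
  define t where "t = (\<Sum>d. kcoef TYPE('n) (d + N) * ((norm w)\<^sup>2) ^ (d + N))"
  have sm: "summable (\<lambda>d. kcoef TYPE('n) (d + N) * ((norm w)\<^sup>2) ^ (d + N))"
    using summable_ignore_initial_segment[OF summable_kcoef[of "TYPE('n)" "(norm w)\<^sup>2"], of N] by simp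
  have t0: "t \<ge> 0" unfolding t_def using less_imp_le[OF kcoef_pos[of "TYPE('n)"]] by (intro suminf_nonneg sm) auto
  define u where "u K z = ennreal ((cmod (part (N + K) z w - part N z w))\<^sup>2)" for K z
  have u_meas: "u K \<in> borel_measurable fm" for K unfolding u_def by measurable
  have u_int: "integral\<^sup>N fm (u K) \<le> ennreal t" for K
  proof -
    have "integrable fm (\<lambda>z. (cmod (part (N + K) z w - part N z w))\<^sup>2)"
    proof -
      have "poly_growth (\<lambda>z. part (N + K) z w + (-1) * part N z w)"
        by (intro poly_growth_add poly_growth_mult poly_growth_const poly_growth_part)
      then have "poly_growth (\<lambda>z. cmod (part (N + K) z w - part N z w))" by (simp add: poly_growth_def)
      then show ?thesis
        by (intro integrable_fm_poly_growth poly_growth_power) (intro continuous_intros continuous_part)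
    qed
    then have "integral\<^sup>N fm (u K) = ennreal (\<integral>z. (cmod (part (N + K) z w - part N z w))\<^sup>2 \<partial>fm)"
      unfolding u_def by (intro nn_integral_eq_integral) auto
    also have "\<dots> \<le> ennreal t" unfolding part_norm t_def
      using less_imp_le[OF kcoef_pos[of "TYPE('n)"]] by (intro ennreal_leI sum_le_suminf sm) auto
    finally show ?thesis .
  qed
  have "(\<integral>\<^sup>+z. ennreal ((cmod (Ker z w - part N z w))\<^sup>2) \<partial>fm) = (\<integral>\<^sup>+z. liminf (\<lambda>K. u K z) \<partial>fm)"
  proof (rule nn_integral_cong)
    fix z :: "complex^'n"
    have "(\<lambda>K. part (K + N) z w) \<longlonglongrightarrow> Ker z w" by (rule LIMSEQ_ignore_initial_segment[OF part_tendsto])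
    then have "(\<lambda>K. part (N + K) z w) \<longlonglongrightarrow> Ker z w" by (simp only: add.commute)
    then have "(\<lambda>K. u K z) \<longlonglongrightarrow> ennreal ((cmod (Ker z w - part N z w))\<^sup>2)"
      unfolding u_def by (intro tendsto_ennrealI tendsto_intros)
    then show "ennreal ((cmod (Ker z w - part N z w))\<^sup>2) = liminf (\<lambda>K. u K z)"
      by (simp add: lim_imp_Liminf)
  qed
  also have "\<dots> \<le> liminf (\<lambda>K. integral\<^sup>N fm (u K))" by (rule nn_integral_liminf[OF u_meas])
  also have "\<dots> \<le> limsup (\<lambda>K. integral\<^sup>N fm (u K))" by (rule Liminf_le_Limsup) simp
  also have "\<dots> \<le> ennreal t" by (rule Limsup_bounded) (simp add: u_int)
  finally have le: "(\<integral>\<^sup>+z. ennreal ((cmod (Ker z w - part N z w))\<^sup>2) \<partial>fm) \<le> ennreal t" .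
  show int: "integrable fm (\<lambda>z. (cmod (Ker z w - part N z w))\<^sup>2)"
  proof (rule integrableI_bounded)
    show "(\<integral>\<^sup>+z. ennreal (norm ((cmod (Ker z w - part N z w))\<^sup>2)) \<partial>fm) < \<infinity>"
      using le by (simp add: le_less_trans[OF _ ennreal_less_top])
  qed measurable
  have "ennreal (\<integral>z. (cmod (Ker z w - part N z w))\<^sup>2 \<partial>fm) \<le> ennreal t"
    using le by (subst (asm) nn_integral_eq_integral[OF int]) auto
  then show "(\<integral>z. (cmod (Ker z w - part N z w))\<^sup>2 \<partial>fm) \<le> (\<Sum>d. kcoef TYPE('n) (d + N) * ((norm w)\<^sup>2) ^ (d + N))"
    using t0 by (simp add: t_def)
qed

lemma Ker_L2:
  fixes w :: "complex^'n::finite"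
  shows "integrable fm (\<lambda>z. (cmod (Ker z w))\<^sup>2)"
    and "(\<integral>z. (cmod (Ker z w))\<^sup>2 \<partial>fm) \<le> gen (CARD('n) - 1) ((norm w)\<^sup>2) / vol_const TYPE('n)"
  using Ker_part_L2[of w 0] by (simp_all add: part_def suminf_kcoef)

lemma Ker_in_fock_space: "(\<lambda>z. Ker z w) \<in> fock_space \<Psi>"
  unfolding fock_space_def
proof (intro CollectI conjI allI impI)
  fix \<epsilon> :: real assume "\<epsilon> > 0"
  then have "\<forall>\<^sub>F N in sequentially. (\<Sum>d. kcoef TYPE('a) (d + N) * ((norm w)\<^sup>2) ^ (d + N)) < \<epsilon>"
    by (rule order_tendstoD(2)[OF tail_tendsto])
  then obtain N where "(\<Sum>d. kcoef TYPE('a) (d + N) * ((norm w)\<^sup>2) ^ (d + N)) < \<epsilon>"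
    by (auto simp: eventually_sequentially)
  then show "\<exists>p\<in>holo_polys. (\<integral>z. (cmod (Ker z w - p z))\<^sup>2 \<partial>fm) < \<epsilon>"
    using Ker_part_L2(2)[of w N] by (intro bexI[OF _ part_in_holo_polys[of N w]]) simp
qed (use entire_Ker Ker_L2 in auto)

lemma lmono_L2: "integrable fm (\<lambda>z. (cmod (lmono l z))\<^sup>2)"
proof -
  have "poly_growth (\<lambda>z. cmod (lmono l z))" using poly_growth_lmono[of l] by (simp add: poly_growth_def)
  then show ?thesis by (intro integrable_fm_poly_growth poly_growth_power) (intro continuous_intros)
qed

lemma measurable_lmono [measurable]: "lmono l \<in> borel_measurable borel"
  by (intro borel_measurable_continuous_onI continuous_intros)

lemma part_L2: "integrable fm (\<lambda>z. (cmod (part N z w))\<^sup>2)"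
proof -
  have "poly_growth (\<lambda>z. cmod (part N z w))" using poly_growth_part(1)[of N w] by (simp add: poly_growth_def)
  then show ?thesis by (intro integrable_fm_poly_growth poly_growth_power) (intro continuous_intros continuous_part)
qed

text \<open>A partial sum beyond the degree reproduces exactly; the remainder of the kernel is small
  in norm, hence so is its pairing with the monomial.\<close>

lemma Ker_reproduces_lmono:
  fixes w :: "complex^'n::finite"
  shows "(\<integral>z. lmono l z * cnj (Ker z w) \<partial>fm) = lmono l w"
proof -
  define C where "C = 1 + (\<integral>z. (cmod (lmono l z))\<^sup>2 \<partial>(fm :: (complex^'n) measure))"
  have C: "C > 0" unfolding C_def by (intro add_pos_nonneg) auto
  have bound: "cmod ((\<integral>z. lmono l z * cnj (Ker z w) \<partial>fm) - lmono l w) \<le> e" if e: "e > 0" for e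
  proof -
    define \<epsilon> where "\<epsilon> = e / C"
    have \<epsilon>: "\<epsilon> > 0" using e C by (simp add: \<epsilon>_def)
    then have "\<forall>\<^sub>F N in sequentially. (\<Sum>d. kcoef TYPE('n) (d + N) * ((norm w)\<^sup>2) ^ (d + N)) < \<epsilon>\<^sup>2"
      by (intro order_tendstoD(2)[OF tail_tendsto]) simp
    then have "\<forall>\<^sub>F N in sequentially. (\<Sum>d. kcoef TYPE('n) (d + N) * ((norm w)\<^sup>2) ^ (d + N)) < \<epsilon>\<^sup>2 \<and> N > length l"
      by (intro eventually_conj eventually_gt_at_top)
    then obtain N where N: "(\<Sum>d. kcoef TYPE('n) (d + N) * ((norm w)\<^sup>2) ^ (d + N)) < \<epsilon>\<^sup>2" "N > length l"
      by (auto simp: eventually_sequentially)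
    have [measurable]: "lmono l \<in> borel_measurable fm" "(\<lambda>z. Ker z w) \<in> borel_measurable fm" "(\<lambda>z. part N z w) \<in> borel_measurable fm"
      by simp_all
    have i1: "integrable fm (\<lambda>z. lmono l z * cnj (Ker z w))" by (rule L2_pairing(1)[OF _ _ lmono_L2 Ker_L2(1)]) auto
    have i2: "integrable fm (\<lambda>z. lmono l z * cnj (part N z w))" by (rule L2_pairing(1)[OF _ _ lmono_L2 part_L2]) auto
    have "(\<integral>z. lmono l z * cnj (Ker z w) \<partial>fm) - lmono l w = (\<integral>z. lmono l z * cnj (Ker z w) \<partial>fm) - (\<integral>z. lmono l z * cnj (part N z w) \<partial>fm)"
      using N(2) by (simp add: part_reproduces)
    also have "\<dots> = (\<integral>z. lmono l z * cnj (Ker z w - part N z w) \<partial>fm)"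
      using i1 i2 by (simp add: right_diff_distrib flip: Bochner_Integration.integral_diff)
    also have "cmod \<dots> \<le> \<epsilon> * (1 + (\<integral>z. (cmod (lmono l z))\<^sup>2 \<partial>(fm :: (complex^'n) measure)))"
      using \<epsilon> N(1) Ker_part_L2(2)[of w N] by (intro L2_pairing(2) lmono_L2 Ker_part_L2(1)) auto
    also have "\<dots> = e" using C by (simp add: \<epsilon>_def C_def)
    finally show ?thesis .
  qed
  show ?thesis
  proof (rule ccontr)
    assume "\<not> ?thesis"
    then have "cmod ((\<integral>z. lmono l z * cnj (Ker z w) \<partial>fm) - lmono l w) / 2 > 0" by simp
    from bound[OF this] this show False by simp
  qed
qed

lemma holo_polys_continuous:
  assumes "p \<in> holo_polys" shows "continuous_on UNIV (p :: complex^'n::finite \<Rightarrow> complex)"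
proof -
  obtain A :: "('n \<Rightarrow> nat) set" and c L where "p = (\<lambda>z. \<Sum>\<alpha>\<in>A. c \<alpha> * lmono (L \<alpha>) z)"
    using holo_polys_lmono[OF assms] by blast
  then show ?thesis by (simp only:) (intro continuous_intros)
qed

lemma holo_polys_poly_growth:
  assumes "p \<in> holo_polys" shows "poly_growth (p :: complex^'n::finite \<Rightarrow> complex)"
proof -
  obtain A :: "('n \<Rightarrow> nat) set" and c L where "p = (\<lambda>z. \<Sum>\<alpha>\<in>A. c \<alpha> * lmono (L \<alpha>) z)"
    using holo_polys_lmono[OF assms] by blast
  then show ?thesis by (simp only:) (intro poly_growth_sum poly_growth_mult poly_growth_const poly_growth_lmono)
qed

lemma holo_polys_L2:
  assumes "p \<in> holo_polys" shows "integrable fm (\<lambda>z. (cmod (p z))\<^sup>2)"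
proof -
  have "poly_growth (\<lambda>z. cmod (p z))" using holo_polys_poly_growth[OF assms] by (simp add: poly_growth_def)
  then show ?thesis using holo_polys_continuous[OF assms] by (intro integrable_fm_poly_growth poly_growth_power continuous_intros)
qed

lemma Ker_reproduces_poly:
  fixes w :: "complex^'n::finite"
  assumes "p \<in> holo_polys"
  shows "(\<integral>z. p z * cnj (Ker z w) \<partial>fm) = p w"
proof -
  obtain A :: "('n \<Rightarrow> nat) set" and c L where A: "finite A" "p = (\<lambda>z. \<Sum>\<alpha>\<in>A. c \<alpha> * lmono (L \<alpha>) z)"
    using holo_polys_lmono[OF assms] by blast
  have i: "integrable fm (\<lambda>z. c \<alpha> * (lmono (L \<alpha>) z * cnj (Ker z w)))" for \<alpha>
    by (intro integrable_mult_right L2_pairing(1)[OF _ _ lmono_L2 Ker_L2(1)]) auto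
  have "(\<integral>z. p z * cnj (Ker z w) \<partial>fm) = (\<integral>z. (\<Sum>\<alpha>\<in>A. c \<alpha> * (lmono (L \<alpha>) z * cnj (Ker z w))) \<partial>fm)"
    unfolding A(2) by (simp add: sum_distrib_right mult.assoc)
  also have "\<dots> = (\<Sum>\<alpha>\<in>A. c \<alpha> * lmono (L \<alpha>) w)"
    by (simp only: Bochner_Integration.integral_sum[OF i] integral_mult_right_zero Ker_reproduces_lmono)
  finally show ?thesis by (simp add: A(2))
qed

lemma gen_mono: "0 \<le> x \<Longrightarrow> x \<le> y \<Longrightarrow> gen \<nu> x \<le> gen \<nu> y"
  unfolding gen_def using less_imp_le[OF coef_pos]
  by (intro suminf_le summable_gen mult_left_mono power_mono) auto

lemma Psi_mono: "x \<le> y \<Longrightarrow> \<Psi> x \<le> \<Psi> y"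
  using Psi_growth[of x y] c_pos by (smt (verit) mult_nonneg_nonneg)

text \<open>Membership in the space gives approximation in norm only, while the claim is pointwise.
  The values of the approximating polynomials, being reproduced, converge uniformly near w0 to g(w),
  the pairing of f with the kernel, so g is continuous there. If f(w0) differed from g(w0),
  continuity would keep f away from g, and so from the polynomials, on a whole ball, contradicting
  convergence in norm.\<close>

lemma Ker_reproduces:
  fixes w0 :: "complex^'n::finite"
  assumes f: "f \<in> fock_space \<Psi>"
  shows "f w0 = (\<integral>z. f z * cnj (Ker z w0) \<partial>fm)"
proof (rule ccontr)
  assume neq: "\<not> ?thesis"
  have ent: "entire f" and fmeas: "f \<in> borel_measurable borel" and fint: "integrable fm (\<lambda>z. (cmod (f z))\<^sup>2)"
    and approx: "\<And>\<epsilon>. \<epsilon> > 0 \<Longrightarrow> \<exists>p\<in>holo_polys. (\<integral>z. (cmod (f z - p z))\<^sup>2 \<partial>fm) < \<epsilon>"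
    using f by (auto simp: fock_space_def)
  have fcont: "continuous_on UNIV f"
    using ent by (intro continuous_at_imp_continuous_on ballI) (auto simp: entire_def dest: has_derivative_continuous)
  define g where "g w = (\<integral>z. f z * cnj (Ker z w) \<partial>fm)" for w
  define B where "B = cball w0 1"
  define C where "C = 1 + gen (CARD('n) - 1) ((norm w0 + 1)\<^sup>2) / vol_const TYPE('n)"
  have C: "C > 0" unfolding C_def using gen_pos[of "(norm w0 + 1)\<^sup>2" "CARD('n) - 1"] vol_const_pos[where 'n = 'n]
    by (intro add_pos_pos divide_pos_pos) auto
  have KB: "1 + (\<integral>z. (cmod (Ker z w))\<^sup>2 \<partial>fm) \<le> C" if "w \<in> B" for w
  proof -
    have "norm w \<le> norm w0 + 1" using that norm_triangle_ineq2[of w w0] by (simp add: B_def dist_norm norm_minus_commute)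
    then have "gen (CARD('n) - 1) ((norm w)\<^sup>2) \<le> gen (CARD('n) - 1) ((norm w0 + 1)\<^sup>2)"
      by (intro gen_mono power_mono) auto
    then have "gen (CARD('n) - 1) ((norm w)\<^sup>2) / vol_const TYPE('n) \<le> gen (CARD('n) - 1) ((norm w0 + 1)\<^sup>2) / vol_const TYPE('n)"
      using vol_const_pos[where 'n = 'n] by (intro divide_right_mono) auto
    then show ?thesis using Ker_L2(2)[of w] by (simp add: C_def)
  qed
  have close: "cmod (p w - g w) \<le> \<epsilon> * C"
    if p: "p \<in> holo_polys" "(\<integral>z. (cmod (f z - p z))\<^sup>2 \<partial>fm) < \<epsilon>\<^sup>2" and \<epsilon>: "\<epsilon> > 0" and w: "w \<in> B" for p \<epsilon> w
  proof -
    have pm: "p \<in> borel_measurable borel" using holo_polys_continuous[OF p(1)] by (rule borel_measurable_continuous_onI)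
    note [measurable] = pm fmeas
    have d2: "integrable fm (\<lambda>z. (cmod (f z - p z))\<^sup>2)"
      by (rule square_integrable_diff[OF _ _ fint holo_polys_L2[OF p(1)]]) auto
    have "p w - g w = (\<integral>z. p z * cnj (Ker z w) \<partial>fm) - (\<integral>z. f z * cnj (Ker z w) \<partial>fm)"
      by (simp add: g_def Ker_reproduces_poly[OF p(1)])
    also have "\<dots> = (\<integral>z. p z * cnj (Ker z w) - f z * cnj (Ker z w) \<partial>fm)"
      using L2_pairing(1)[OF _ _ holo_polys_L2[OF p(1)] Ker_L2(1)] L2_pairing(1)[OF _ _ fint Ker_L2(1)]
      by (subst Bochner_Integration.integral_diff) auto
    also have "\<dots> = (\<integral>z. - cnj (Ker z w * cnj (f z - p z)) \<partial>fm)"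
      by (simp add: algebra_simps)
    also have "\<dots> = - cnj (\<integral>z. Ker z w * cnj (f z - p z) \<partial>fm)"
      by (simp only: integral_minus Bochner_Integration.integral_cnj)
    also have "cmod \<dots> = cmod (\<integral>z. Ker z w * cnj (f z - p z) \<partial>fm)" by simp
    also have "\<dots> \<le> \<epsilon> * (1 + (\<integral>z. (cmod (Ker z w))\<^sup>2 \<partial>fm))"
      using p(2) \<epsilon> by (intro L2_pairing(2) Ker_L2(1) d2) auto
    also have "\<dots> \<le> \<epsilon> * C" using \<epsilon> KB[OF w] by (intro mult_left_mono) auto
    finally show ?thesis .
  qed
  have "\<exists>p. p \<in> holo_polys \<and> (\<integral>z. (cmod (f z - p z))\<^sup>2 \<partial>fm) < (1 / real (Suc k))\<^sup>2" for k
    using approx[of "(1 / real (Suc k))\<^sup>2"] by auto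
  then obtain p where p: "\<And>k. p k \<in> holo_polys" "\<And>k. (\<integral>z. (cmod (f z - p k z))\<^sup>2 \<partial>fm) < (1 / real (Suc k))\<^sup>2"
    by metis
  have pg: "cmod (p k w - g w) \<le> 1 / real (Suc k) * C" if "w \<in> B" for k w
    by (rule close[OF p(1) p(2)]) (use that in auto)
  have lim0: "(\<lambda>k. 1 / real (Suc k) * a) \<longlonglongrightarrow> 0" for a
    using tendsto_mult_right[OF LIMSEQ_inverse_real_of_nat, of a] by (simp add: inverse_eq_divide)
  have "uniform_limit B p g sequentially"
    unfolding uniform_limit_iff
  proof (intro allI impI)
    fix e :: real assume "e > 0"
    then have "\<forall>\<^sub>F k in sequentially. 1 / real (Suc k) * C < e" by (rule order_tendstoD(2)[OF lim0])
    then show "\<forall>\<^sub>F k in sequentially. \<forall>w\<in>B. dist (p k w) (g w) < e"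
      by eventually_elim (auto simp: dist_norm intro: le_less_trans[OF pg])
  qed
  then have gcont: "continuous_on B g"
    by (rule uniform_limit_theorem[rotated])
      (auto intro!: always_eventually continuous_on_subset[OF holo_polys_continuous[OF p(1)]])
  have hcont: "continuous_on B (\<lambda>w. f w - g w)"
    using gcont continuous_on_subset[OF fcont, of B] by (intro continuous_intros) auto
  define \<eta> where "\<eta> = cmod (f w0 - g w0)"
  have \<eta>: "\<eta> > 0" using neq by (simp add: \<eta>_def g_def)
  obtain r where r: "r > 0" "\<And>w. w \<in> B \<Longrightarrow> dist w w0 < r \<Longrightarrow> dist (f w - g w) (f w0 - g w0) < \<eta> / 2"
    using hcont[unfolded continuous_on_iff, rule_format, of w0 "\<eta> / 2"] \<eta> by (auto simp: B_def)
  define s where "s = min r 1"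
  have s: "s > 0" using r by (simp add: s_def)
  have far: "cmod (f w - g w) \<ge> \<eta> / 2" if "w \<in> ball w0 s" for w
  proof -
    have "cmod ((f w - g w) - (f w0 - g w0)) < \<eta> / 2"
    proof -
      have "w \<in> B" "dist w w0 < r" using that by (auto simp: B_def s_def dist_commute)
      from r(2)[OF this] show ?thesis by (simp only: dist_norm)
    qed
    then show ?thesis using norm_triangle_ineq2[of "f w0 - g w0" "f w - g w"] unfolding \<eta>_def[symmetric]
      by (simp add: norm_minus_commute)
  qed
  \<comment> \<open>What the ball alone contributes to the squared distance: \<Psi> is
    nondecreasing, so the density on the ball is at least its value at radius
    \<open>norm w0 + 1\<close>.\<close>
  define m where "m = exp (- \<Psi> ((norm w0 + 1)\<^sup>2)) * (\<eta> / 4)\<^sup>2 * measure lborel (ball w0 s)"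
  have m: "m > 0" unfolding m_def using \<eta> s content_ball_pos[of s w0] by (intro mult_pos_pos) auto
  have "\<forall>\<^sub>F k in sequentially. 1 / real (Suc k) * C < \<eta> / 4 \<and> 1 / real (Suc k) * 1 < min m 1"
    by (intro eventually_conj order_tendstoD(2)[OF lim0]) (use \<eta> m in auto)
  then obtain k where k: "1 / real (Suc k) * C < \<eta> / 4" "1 / real (Suc k) < m" "1 / real (Suc k) < 1"
    by (auto simp: eventually_sequentially)
  note [measurable] = fmeas borel_measurable_continuous_onI[OF holo_polys_continuous[OF p(1)]]
  have d2: "integrable fm (\<lambda>z. (cmod (f z - p k z))\<^sup>2)"
    by (rule square_integrable_diff[OF _ _ fint holo_polys_L2[OF p(1)]]) auto
  have "m = (\<integral>z. (exp (- \<Psi> ((norm w0 + 1)\<^sup>2)) * (\<eta> / 4)\<^sup>2) * indicator (ball w0 s) z \<partial>lborel)"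
    unfolding m_def by simp
  also have "\<dots> \<le> (\<integral>z. ew z *\<^sub>R (cmod (f z - p k z))\<^sup>2 \<partial>lborel)"
  proof (rule integral_mono)
    show "integrable lborel (\<lambda>z. ew z *\<^sub>R (cmod (f z - p k z))\<^sup>2)" using d2 by (subst (asm) integrable_fm) auto
    have "integrable lborel (indicator (ball w0 s) :: _ \<Rightarrow> real)"
      by (intro integrable_real_indicator emeasure_lborel_ball_finite) simp
    then show "integrable lborel (\<lambda>z. (exp (- \<Psi> ((norm w0 + 1)\<^sup>2)) * (\<eta> / 4)\<^sup>2) * indicator (ball w0 s) z)"
      by (rule integrable_mult_right)
    fix z :: "complex^'n"
    show "(exp (- \<Psi> ((norm w0 + 1)\<^sup>2)) * (\<eta> / 4)\<^sup>2) * indicator (ball w0 s) z \<le> ew z *\<^sub>R (cmod (f z - p k z))\<^sup>2"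
    proof (cases "z \<in> ball w0 s")
      case True
      then have zB: "z \<in> B" by (auto simp: B_def s_def)
      have "norm z \<le> norm w0 + 1" using zB norm_triangle_ineq2[of z w0] by (simp add: B_def dist_norm norm_minus_commute)
      then have "\<Psi> ((norm z)\<^sup>2) \<le> \<Psi> ((norm w0 + 1)\<^sup>2)" by (intro Psi_mono power_mono) auto
      then have 1: "exp (- \<Psi> ((norm w0 + 1)\<^sup>2)) \<le> ew z" by simp
      have "cmod (f z - g z) \<le> cmod (f z - p k z) + cmod (p k z - g z)"
        using norm_triangle_ineq[of "f z - p k z" "p k z - g z"] by simp
      moreover have "cmod (p k z - g z) < \<eta> / 4" by (rule le_less_trans[OF pg[OF zB] k(1)])
      ultimately have "\<eta> / 4 \<le> cmod (f z - p k z)" using far[OF True] by simp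
      then have "(\<eta> / 4)\<^sup>2 \<le> (cmod (f z - p k z))\<^sup>2" using \<eta> by (intro power_mono) auto
      then show ?thesis using 1 True by (simp add: mult_mono)
    qed simp
  qed
  also have "\<dots> = (\<integral>z. (cmod (f z - p k z))\<^sup>2 \<partial>fm)" by (subst integral_fm) auto
  also have "\<dots> < (1 / real (Suc k))\<^sup>2" by (rule p(2))
  also have "\<dots> \<le> 1 / real (Suc k)" 
    using mult_left_mono[of "1 / real (Suc k)" 1 "1 / real (Suc k)"] k(3) unfolding power2_eq_square by simp
  finally show False using k(2) by simp
qed

text \<open>Reproducing either of two kernels by the other gives K1(u,w) = cnj K2(w,u). Applied to K
  with \<open>Ker\<close> and to \<open>Ker\<close> with itself, this forces equality.\<close>

lemma fock_kernel_eq: "fock_kernel \<Psi> = (Ker :: complex^'n::finite \<Rightarrow> _)"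
  unfolding fock_kernel_def
proof (rule the_equality)
  show rep: "is_reproducing_kernel \<Psi> (Ker :: complex^'n \<Rightarrow> _)"
    unfolding is_reproducing_kernel_def using Ker_in_fock_space Ker_reproduces by blast
  fix K :: "complex^'n \<Rightarrow> complex^'n \<Rightarrow> complex"
  assume K: "is_reproducing_kernel \<Psi> K"
  have sym: "K1 u w = cnj (K2 w u)"
    if "is_reproducing_kernel \<Psi> K1" "is_reproducing_kernel \<Psi> K2" for K1 K2 and u w :: "complex^'n"
  proof -
    have rk: "H v w = (\<integral>z. H z w * cnj (H' z v) \<partial>fm)"
      if "is_reproducing_kernel \<Psi> H" "is_reproducing_kernel \<Psi> H'" for H H' and v w :: "complex^'n"
    proof -
      have mem: "(\<lambda>z. H z w) \<in> fock_space \<Psi>" using that(1) by (simp add: is_reproducing_kernel_def)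
      have "\<forall>f\<in>fock_space \<Psi>. f v = (\<integral>z. f z * cnj (H' z v) \<partial>fm)" using that(2) by (simp add: is_reproducing_kernel_def)
      from bspec[OF this mem] show ?thesis .
    qed
    have "K1 u w = (\<integral>z. K1 z w * cnj (K2 z u) \<partial>fm)" by (rule rk[OF that])
    also have "\<dots> = (\<integral>z. cnj (K2 z u * cnj (K1 z w)) \<partial>fm)" by (simp add: mult.commute)
    also have "\<dots> = cnj (\<integral>z. K2 z u * cnj (K1 z w) \<partial>fm)" by (rule Bochner_Integration.integral_cnj)
    also have "(\<integral>z. K2 z u * cnj (K1 z w) \<partial>fm) = K2 w u" by (rule rk[OF that(2,1), symmetric])
    finally show ?thesis .
  qed
  show "K = Ker" using sym[OF K rep] sym[OF rep rep] by (intro ext) metis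
qed

lemma fock_kernel_diag: "fock_kernel \<Psi> z z = of_real (gen (CARD('n) - 1) ((norm z)\<^sup>2) / vol_const TYPE('n))"
  for z :: "complex^'n::finite"
  unfolding fock_kernel_eq Ker_def herm_self by (rule kser_of_real)

end

section \<open>The Bergman metric\<close>

lemma cmod_herm_le: "cmod (herm z \<xi>) \<le> norm z * norm \<xi>"
proof -
  have "cmod (herm z \<xi>) \<le> (\<Sum>j\<in>UNIV. \<bar>norm (z $ j)\<bar> * \<bar>norm (\<xi> $ j)\<bar>)"
    unfolding herm_def by (rule order_trans[OF norm_sum]) (simp add: norm_mult)
  also have "\<dots> \<le> norm z * norm \<xi>" unfolding norm_vec_def by (rule L2_set_mult_ineq)
  finally show ?thesis .
qed

section \<open>Logarithmic derivatives of the generating series\<close>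

context radial_weight
begin

definition gen' :: "nat \<Rightarrow> real \<Rightarrow> real" where
  "gen' \<nu> x = (\<Sum>d. diffs (coef \<nu>) d * x ^ d)"

definition gen'' :: "nat \<Rightarrow> real \<Rightarrow> real" where
  "gen'' \<nu> x = (\<Sum>d. diffs (diffs (coef \<nu>)) d * x ^ d)"

lemma summable_diffs: "summable (\<lambda>d. diffs (coef \<nu>) d * x ^ d)"
  by (rule termdiff_converges_all) (rule summable_gen)

lemma summable_diffs2: "summable (\<lambda>d. diffs (diffs (coef \<nu>)) d * x ^ d)"
  by (rule termdiff_converges_all) (rule summable_diffs)

lemma gen_deriv: "(gen \<nu> has_real_derivative gen' \<nu> x) (at x)"
  unfolding gen_def gen'_def by (rule termdiffs_strong_converges_everywhere) (rule summable_gen)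

lemma gen'_deriv: "(gen' \<nu> has_real_derivative gen'' \<nu> x) (at x)"
  unfolding gen'_def gen''_def by (rule termdiffs_strong_converges_everywhere) (rule summable_diffs)

text \<open>The operator x d/dx multiplies the d-th coefficient by d; the term d = 0 vanishes, which
  permits the index shift.\<close>

lemma mult_diffs_series:
  fixes a :: "nat \<Rightarrow> real"
  assumes "summable (\<lambda>d. diffs a d * x ^ d)"
  shows "(\<lambda>d. real d * (a d * x ^ d)) sums (x * (\<Sum>d. diffs a d * x ^ d))"
proof -
  have "(\<lambda>d. x * (diffs a d * x ^ d)) sums (x * (\<Sum>d. diffs a d * x ^ d))"
    by (intro sums_mult summable_sums assms)
  then have "(\<lambda>d. real (Suc d) * (a (Suc d) * x ^ Suc d)) sums (x * (\<Sum>d. diffs a d * x ^ d))"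
    by (simp add: diffs_def mult_ac del: of_nat_Suc)
  then show ?thesis by (subst (asm) sums_Suc_iff) simp
qed

lemma gen_mean_eq: "gen_mean \<nu> x = x * (gen' \<nu> x / gen \<nu> x)"
  using mult_diffs_series[OF summable_diffs[of \<nu> x]] by (simp add: gen_mean_def gen'_def sums_iff)

text \<open>d^2 = d(d-1) + d, the falling factorial being what two differentiations produce.\<close>

lemma second_moment: "(\<Sum>d. (real d)\<^sup>2 * (coef \<nu> d * x ^ d)) = x\<^sup>2 * gen'' \<nu> x + x * gen' \<nu> x"
proof -
  have "(\<lambda>d. x * (real d * (diffs (coef \<nu>) d * x ^ d))) sums (x * (x * gen'' \<nu> x))"
    unfolding gen''_def by (intro sums_mult mult_diffs_series summable_diffs2)
  then have "(\<lambda>d. (real (Suc d) * (real (Suc d) - 1)) * (coef \<nu> (Suc d) * x ^ Suc d)) sums (x * (x * gen'' \<nu> x))"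
    by (simp add: diffs_def mult_ac)
  then have "(\<lambda>d. (real d * (real d - 1)) * (coef \<nu> d * x ^ d)) sums (x * (x * gen'' \<nu> x))"
    by (subst (asm) sums_Suc_iff) simp
  from sums_add[OF this mult_diffs_series[OF summable_diffs[of \<nu> x]]]
  have "(\<lambda>d. (real d)\<^sup>2 * (coef \<nu> d * x ^ d)) sums (x * (x * gen'' \<nu> x) + x * gen' \<nu> x)"
    by (simp add: gen'_def power2_eq_square algebra_simps)
  then show ?thesis by (simp add: sums_iff power2_eq_square)
qed

definition lg' :: "nat \<Rightarrow> real \<Rightarrow> real" where "lg' \<nu> x = gen' \<nu> x / gen \<nu> x"

definition lg'' :: "nat \<Rightarrow> real \<Rightarrow> real" where
  "lg'' \<nu> x = (gen'' \<nu> x * gen \<nu> x - (gen' \<nu> x)\<^sup>2) / (gen \<nu> x)\<^sup>2"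

lemma gen_mean_lg: "gen_mean \<nu> x = x * lg' \<nu> x"
  by (simp add: gen_mean_eq lg'_def)

lemma gen_var_lg:
  assumes "x \<ge> 0"
  shows "gen_var \<nu> x = x * (lg' \<nu> x + x * lg'' \<nu> x)"
proof -
  have g: "gen \<nu> x \<noteq> 0" using gen_pos[OF assms, of \<nu>] by simp
  have "(x\<^sup>2 * b + x * a) / g - (x * (a / g))\<^sup>2 = x * (a / g + x * ((b * g - a\<^sup>2) / g\<^sup>2))" if "g \<noteq> 0" for a b g :: real
    using that by (simp add: field_simps power2_eq_square)
  from this[OF g] show ?thesis
    unfolding gen_var_def second_moment gen_mean_eq lg'_def lg''_def .
qed

lemma ln_gen_deriv:
  assumes "x \<ge> 0" "b > 0"
  shows "((\<lambda>x. ln (gen \<nu> x / b)) has_real_derivative lg' \<nu> x) (at x)"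
  using gen_pos[OF assms(1), of \<nu>] assms(2)
  by (auto intro!: derivative_eq_intros gen_deriv simp: lg'_def)

lemma lg'_deriv:
  assumes "x \<ge> 0"
  shows "(lg' \<nu> has_real_derivative lg'' \<nu> x) (at x)"
proof -
  have "((\<lambda>x. gen' \<nu> x / gen \<nu> x) has_real_derivative lg'' \<nu> x) (at x)"
    using gen_pos[OF assms(1), of \<nu>]
    by (auto intro!: derivative_eq_intros gen_deriv gen'_deriv simp: lg''_def power2_eq_square)
  then show ?thesis by (simp add: lg'_def[abs_def])
qed

end

section \<open>Wirtinger derivatives of radial functions\<close>

lemma norm_sq_line_deriv:
  "((\<lambda>t. (norm (z + t *\<^sub>R v))\<^sup>2) has_real_derivative 2 * (z \<bullet> v)) (at 0)"
  unfolding power2_norm_eq_inner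
  by (simp add: inner_add_left inner_add_right power2_eq_square)
     (auto intro!: derivative_eq_intros simp: inner_commute)

lemma radial_line_deriv:
  assumes "(L has_real_derivative L') (at ((norm z)\<^sup>2))"
  shows "((\<lambda>t. complex_of_real (L ((norm (z + t *\<^sub>R v))\<^sup>2))) has_vector_derivative of_real (L' * (2 * (z \<bullet> v)))) (at 0)"
proof -
  have "((\<lambda>t. L ((norm (z + t *\<^sub>R v))\<^sup>2)) has_real_derivative L' * (2 * (z \<bullet> v))) (at 0)"
    by (rule DERIV_chain2[of L]) (use assms norm_sq_line_deriv in auto)
  then show ?thesis
    by (intro has_vector_derivative_of_real) (simp add: has_real_derivative_iff_has_vector_derivative)
qed

lemma inner_axis_complex: "z \<bullet> axis j 1 = Re (z $ j)" "z \<bullet> axis j \<i> = Im (z $ j)"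
  by (simp_all add: inner_axis inner_complex_def)

lemma wirt_bar_radial:
  fixes z :: "complex^'n"
  assumes "(L has_real_derivative L') (at ((norm z)\<^sup>2))"
  shows "wirt_bar k (\<lambda>u. complex_of_real (L ((norm u)\<^sup>2))) z = of_real L' * z $ k"
proof -
  have d: "dir_deriv (\<lambda>u. complex_of_real (L ((norm u)\<^sup>2))) v z = of_real (L' * (2 * (z \<bullet> v)))" for v
    unfolding dir_deriv_def by (rule vector_derivative_at[OF radial_line_deriv[OF assms]])
  show ?thesis unfolding wirt_bar_def d inner_axis_complex by (simp add: complex_eq_iff)
qed

lemma wirt_radial_nth:
  fixes z :: "complex^'n"
  assumes "(L has_real_derivative L') (at ((norm z)\<^sup>2))"
  shows "wirt j (\<lambda>u. complex_of_real (L ((norm u)\<^sup>2)) * u $ k) z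
    = of_real L' * (cnj (z $ j) * z $ k) + (if j = k then of_real (L ((norm z)\<^sup>2)) else 0)"
proof -
  have d: "dir_deriv (\<lambda>u. complex_of_real (L ((norm u)\<^sup>2)) * u $ k) v z
     = of_real (L ((norm z)\<^sup>2)) * v $ k + of_real (L' * (2 * (z \<bullet> v))) * z $ k" for v
  proof -
    have "((\<lambda>t. (z + t *\<^sub>R v) $ k) has_vector_derivative v $ k) (at 0)"
      by (auto intro!: derivative_eq_intros)
    from has_vector_derivative_mult[OF radial_line_deriv[OF assms] this]
    show ?thesis unfolding dir_deriv_def by (intro vector_derivative_at) simp
  qed
  have ax: "axis j a $ k = (if j = k then a else 0)" for a :: complex by (auto simp: axis_def)
  show ?thesis unfolding wirt_def d inner_axis_complex ax by (auto simp: complex_eq_iff field_simps)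
qed

context radial_weight
begin

text \<open>The complex Hessian of L(|z|^2) has the entries L' \<delta>_jk + L'' cnj z_j z_k. Its
  first part contributes |\<xi>|^2, the rank-one part |\<langle>z,\<xi>\<rangle>|^2.\<close>

lemma bergman_metric_radial:
  fixes z \<xi> :: "complex^'n::finite"
  shows "bergman_metric_sq \<Psi> z \<xi> = complex_of_real
    ((norm \<xi>)\<^sup>2 * lg' (CARD('n) - 1) ((norm z)\<^sup>2) + (cmod (herm z \<xi>))\<^sup>2 * lg'' (CARD('n) - 1) ((norm z)\<^sup>2))"
proof -
  let ?\<nu> = "CARD('n) - 1"
  let ?L = "\<lambda>x. ln (gen ?\<nu> x / vol_const TYPE('n))"
  define a where "a = complex_of_real (lg' ?\<nu> ((norm z)\<^sup>2))"
  define b where "b = complex_of_real (lg'' ?\<nu> ((norm z)\<^sup>2))"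
  have "ln (fock_kernel \<Psi> u u) = complex_of_real (?L ((norm u)\<^sup>2))" for u :: "complex^'n"
    unfolding fock_kernel_diag using gen_pos[of "(norm u)\<^sup>2" ?\<nu>] vol_const_pos[where 'n = 'n] by (intro Ln_of_real) simp
  moreover have "wirt_bar k (\<lambda>u. complex_of_real (?L ((norm u)\<^sup>2))) = (\<lambda>u. complex_of_real (lg' ?\<nu> ((norm u)\<^sup>2)) * u $ k)" for k :: 'n
    by (intro ext wirt_bar_radial ln_gen_deriv vol_const_pos) simp
  moreover have "wirt j (\<lambda>u. complex_of_real (lg' ?\<nu> ((norm u)\<^sup>2)) * u $ k) z = b * (cnj (z $ j) * z $ k) + (if j = k then a else 0)" for j k :: 'n
    unfolding a_def b_def by (intro wirt_radial_nth lg'_deriv) simp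
  ultimately have "bergman_metric_sq \<Psi> z \<xi> = (\<Sum>j\<in>UNIV. \<Sum>k\<in>UNIV. (b * (cnj (z $ j) * z $ k) + (if j = k then a else 0)) * \<xi> $ j * cnj (\<xi> $ k))"
    unfolding bergman_metric_sq_def by simp
  also have "\<dots> = (\<Sum>j\<in>UNIV. \<Sum>k\<in>UNIV. b * ((\<xi> $ j * cnj (z $ j)) * (z $ k * cnj (\<xi> $ k)))) + (\<Sum>j\<in>UNIV. \<Sum>k\<in>UNIV. if j = k then a * (\<xi> $ j * cnj (\<xi> $ k)) else 0)"
    unfolding sum.distrib[symmetric] by (intro sum.cong refl) (simp add: algebra_simps)
  also have "(\<Sum>j\<in>UNIV. \<Sum>k\<in>UNIV. b * ((\<xi> $ j * cnj (z $ j)) * (z $ k * cnj (\<xi> $ k)))) = b * (herm \<xi> z * herm z \<xi>)"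
    unfolding herm_def sum_product by (simp only: sum_distrib_left)
  also have "(\<Sum>j\<in>UNIV. \<Sum>k\<in>UNIV. if j = k then a * (\<xi> $ j * cnj (\<xi> $ k)) else 0) = a * herm \<xi> \<xi>"
    by (simp add: herm_def sum_distrib_left)
  also have "herm \<xi> z * herm z \<xi> = of_real ((cmod (herm z \<xi>))\<^sup>2)"
    by (simp only: complex_norm_square cnj_herm mult.commute)
  finally show ?thesis by (simp add: herm_self a_def b_def)
qed

end

section \<open>Derivatives at the origin and the slow variation of \<Phi>'\<close>

lemma linear_extension_deriv:
  fixes f f' :: "real \<Rightarrow> real"
  assumes "\<And>x. x \<ge> 0 \<Longrightarrow> (f has_real_derivative f' x) (at x within {0..})"
  shows "((\<lambda>x. if 0 \<le> x then f x else f 0 + f' 0 * x) has_real_derivative f' (max 0 x)) (at x)"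
    (is "(?g has_real_derivative _) _")
proof -
  have R: "(?g has_real_derivative f' y) (at y within {0..})" if "y \<ge> 0" for y
    using assms[OF that] unfolding has_field_derivative_def
    by (rule has_derivative_transform[rotated 2]) (use that in auto)
  have L: "(?g has_real_derivative f' 0) (at y within {..0})" if "y \<le> 0" for y
  proof -
    have "((\<lambda>x. f 0 + f' 0 * x) has_real_derivative f' 0) (at y within {..0})"
      by (auto intro!: derivative_eq_intros)
    then show ?thesis unfolding has_field_derivative_def
      by (rule has_derivative_transform[rotated 2]) (use that in auto)
  qed
  consider "x > 0" | "x < 0" | "x = 0" by linarith
  then show ?thesis
  proof cases
    case 1
    have "at x within {0..} = at x" using 1 by (intro at_within_interior) (simp add: interior_real_atLeast)
    then show ?thesis using R[of x] 1 by simp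
  next
    case 2
    have "at x within {..0} = at x" using 2 by (intro at_within_interior) (simp add: interior_real_atMost)
    then show ?thesis using L[of x] 2 by simp
  next
    case 3
    have "(?g has_real_derivative f' 0) (at 0 within {0..} \<union> {..0})"
      using R[of 0] L[of 0] unfolding has_field_derivative_iff by (intro Lim_Un) auto
    moreover have "{0..} \<union> {..0::real} = UNIV" by auto
    ultimately show ?thesis using 3 by simp
  qed
qed

lemma hderiv_eq:
  assumes "(f has_real_derivative y) (at x within {0..})" "x \<ge> 0"
  shows "hderiv f x = y"
proof -
  have "at_right x \<le> at x within {0..}" using assms(2) by (intro at_le) auto
  then have "at x within {0..} \<noteq> bot" using trivial_limit_at_right_real[of x] by (auto simp: bot_unique)
  then show ?thesis unfolding hderiv_def using assms(1)
    by (intro vector_derivative_within) (auto simp: has_real_derivative_iff_has_vector_derivative)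
qed

lemma hderiv_works:
  assumes "f differentiable_on {0..}" "x \<ge> 0"
  shows "(f has_real_derivative hderiv f x) (at x within {0..})"
  using assms unfolding hderiv_def differentiable_on_def
  by (auto simp: has_real_derivative_iff_has_vector_derivative vector_derivative_works[symmetric])

text \<open>If \<phi> is bounded, it converges, being monotone, and its variation beyond some s is
  below \<epsilon> c. Otherwise it tends to infinity, and the hypothesis bounds the derivative of
  \<phi>^(-1/2) by a constant times t^(-1/2) \<phi>^(\<eta>-1/2). Over M widths sqrt(t/\<phi>) this
  changes \<phi>^(-1/2) by a fraction of order \<phi>^(\<eta>-1/2) of itself, which vanishes exactly
  because \<eta> < 1/2.\<close>

lemma small_relative_variation:
  fixes \<phi> \<phi>' :: "real \<Rightarrow> real"
  assumes der: "\<And>t. t > 0 \<Longrightarrow> (\<phi> has_real_derivative \<phi>' t) (at t)"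
    and c: "c > 0" and lower: "\<And>t. c \<le> \<phi> t" and mono: "\<And>s t. 0 \<le> s \<Longrightarrow> s \<le> t \<Longrightarrow> \<phi> s \<le> \<phi> t"
    and \<eta>: "\<eta> < 1 / 2" and bigo: "\<phi>' \<in> O(\<lambda>t. t powr (- 1 / 2) * \<phi> t powr (1 + \<eta>))"
    and M: "M > 0" and eps: "\<epsilon> > 0"
  shows "\<forall>\<^sub>F t in at_top. \<forall>\<tau>\<ge>0. \<bar>\<tau> - t\<bar> \<le> M * sqrt (t / \<phi> t) \<longrightarrow> \<bar>\<phi> \<tau> - \<phi> t\<bar> \<le> \<epsilon> * \<phi> t"
proof -
  have pos: "\<phi> t > 0" for t using less_le_trans[OF c lower] .
  have half: "\<forall>\<^sub>F t in at_top. M * sqrt (t / \<phi> t) \<le> t / 2"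
    using eventually_ge_at_top[of "(2 * M / sqrt c)\<^sup>2"]
  proof eventually_elim
    case (elim t)
    have t: "t \<ge> 0" using order_trans[OF zero_le_power2 elim] .
    have "2 * M / sqrt c \<le> sqrt t" using elim by (rule real_le_rsqrt)
    then have "2 * M \<le> sqrt t * sqrt c" using c by (simp add: pos_divide_le_eq)
    then have "2 * M * sqrt t \<le> sqrt t * sqrt c * sqrt t" using t by (intro mult_right_mono) auto
    then have "2 * M * sqrt t \<le> t * sqrt c" using t by (simp add: mult.commute mult.left_commute)
    then have "M * (sqrt t / sqrt c) \<le> t / 2" using c by (simp add: field_simps)
    moreover have "sqrt (t / \<phi> t) \<le> sqrt (t / c)" using t c lower[of t] pos[of t] by (intro real_sqrt_le_mono divide_left_mono) auto
    then have "M * sqrt (t / \<phi> t) \<le> M * (sqrt t / sqrt c)" using M by (intro mult_left_mono) (auto simp: real_sqrt_divide)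
    ultimately show ?case by (rule order_trans[rotated])
  qed
  show ?thesis
  proof (cases "bdd_above (\<phi> ` {0..})")
    case True
    define L where "L = Sup (\<phi> ` {0..})"
    have "L - \<epsilon> * c < L" using eps c by simp
    then obtain s where s: "s \<ge> 0" "L - \<epsilon> * c < \<phi> s"
      unfolding L_def by (subst (asm) less_cSup_iff[OF _ True]) auto
    have up: "\<phi> t \<le> L" if "t \<ge> 0" for t unfolding L_def using True that by (intro cSup_upper) auto
    show ?thesis using half eventually_ge_at_top[of "2 * s"] eventually_gt_at_top[of 0]
    proof eventually_elim
      case (elim t)
      show ?case
      proof (intro allI impI)
        fix \<tau> assume "\<tau> \<ge> 0" "\<bar>\<tau> - t\<bar> \<le> M * sqrt (t / \<phi> t)"
        then have "\<bar>\<tau> - t\<bar> \<le> t / 2" using elim(1) by (rule_tac order_trans)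
        from abs_le_D2[OF this] have ge: "s \<le> \<tau>" "s \<le> t" using elim(2,3) by auto
        have "\<phi> s \<le> \<phi> \<tau>" "\<phi> s \<le> \<phi> t" "\<phi> \<tau> \<le> L" "\<phi> t \<le> L"
          using mono[OF s(1) ge(1)] mono[OF s(1) ge(2)] up[of \<tau>] up[of t] \<open>\<tau> \<ge> 0\<close> elim(3) by auto
        then have "\<bar>\<phi> \<tau> - \<phi> t\<bar> \<le> \<epsilon> * c" using s(2) by (simp add: abs_le_iff)
        also have "\<dots> \<le> \<epsilon> * \<phi> t" using eps lower[of t] by (intro mult_left_mono) auto
        finally show "\<bar>\<phi> \<tau> - \<phi> t\<bar> \<le> \<epsilon> * \<phi> t" .
      qed
    qed
  next
    case False
    have top: "filterlim \<phi> at_top at_top"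
      unfolding filterlim_at_top
    proof
      fix Z
      obtain s where s: "s \<ge> 0" "\<phi> s > Z" using False by (auto simp: bdd_above_def not_le)
      show "\<forall>\<^sub>F t in at_top. Z \<le> \<phi> t"
        using eventually_ge_at_top[of s] by eventually_elim (use mono[OF s(1)] s(2) in force)
    qed
    \<comment> \<open>\<sigma> bounds the relative change of \<phi>^(-1/2). With q the ratio of its
      values, \<phi>(\<tau>) - \<phi>(t) is \<phi>(t) (1 - q)(1 + q)/q^2, and 1 + q \<le> 9/4, q^2
      \<ge> 9/16 turn \<sigma> into 4\<sigma> \<le> \<epsilon>.\<close>
    define \<sigma> where "\<sigma> = min (1/4) (\<epsilon> / 4)"
    have \<sigma>: "\<sigma> > 0" "\<sigma> \<le> 1/4" "4 * \<sigma> \<le> \<epsilon>" using eps by (auto simp: \<sigma>_def)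
    define \<kappa> where "\<kappa> = \<sigma> / M"
    have \<kappa>: "\<kappa> > 0" using \<sigma> M by (simp add: \<kappa>_def)
    obtain C where C: "C > 0" "\<forall>\<^sub>F t in at_top. norm (\<phi>' t) \<le> C * norm (t powr (- 1 / 2) * \<phi> t powr (1 + \<eta>))"
      using bigo by (rule landau_o.bigE)
    have "((\<lambda>t. \<phi> t powr (\<eta> - 1 / 2)) \<longlongrightarrow> 0) at_top"
      using \<eta> by (intro tendsto_neg_powr top) simp
    then have "\<forall>\<^sub>F t in at_top. \<phi> t powr (\<eta> - 1 / 2) < \<kappa> / C" using \<kappa> C(1) by (intro order_tendstoD(2)) auto
    with C(2) have "\<forall>\<^sub>F t in at_top. \<bar>\<phi>' t\<bar> \<le> \<kappa> * (\<phi> t * sqrt (\<phi> t) / sqrt t)"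
      using eventually_gt_at_top[of 0]
    proof eventually_elim
      case (elim t)
      have "\<phi> t powr (1 + \<eta>) = \<phi> t powr ((\<eta> - 1 / 2) + (1 + 1 / 2))" by simp
      also have "\<dots> = \<phi> t powr (\<eta> - 1 / 2) * (\<phi> t powr 1 * \<phi> t powr (1 / 2))" by (simp only: powr_add)
      also have "\<dots> = \<phi> t powr (\<eta> - 1 / 2) * (\<phi> t * sqrt (\<phi> t))" using pos[of t] by (simp add: powr_half_sqrt)
      finally have e1: "\<phi> t powr (1 + \<eta>) = \<phi> t powr (\<eta> - 1 / 2) * (\<phi> t * sqrt (\<phi> t))" .
      have e2: "t powr (- 1 / 2) = 1 / sqrt t" using elim(3) by (simp add: powr_minus powr_half_sqrt inverse_eq_divide)
      have "\<bar>\<phi>' t\<bar> \<le> C * norm (t powr (- 1 / 2) * \<phi> t powr (1 + \<eta>))" using elim(1) by simp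
      also have "\<dots> = (C * \<phi> t powr (\<eta> - 1 / 2)) * (\<phi> t * sqrt (\<phi> t) / sqrt t)"
        unfolding e1 e2 using pos[of t] elim(3) by (simp add: abs_mult)
      also have "\<dots> \<le> \<kappa> * (\<phi> t * sqrt (\<phi> t) / sqrt t)"
        using elim(2,3) C(1) pos[of t] by (intro mult_right_mono) (auto simp: field_simps)
      finally show ?case .
    qed
    then obtain T where T: "\<And>t. t \<ge> T \<Longrightarrow> \<bar>\<phi>' t\<bar> \<le> \<kappa> * (\<phi> t * sqrt (\<phi> t) / sqrt t)"
      by (auto simp: eventually_at_top_linorder)
    show ?thesis using half eventually_ge_at_top[of "2 * T"] eventually_gt_at_top[of 0]
    proof eventually_elim
      case (elim t)
      show ?case
      proof (intro allI impI)
        fix \<tau> assume \<tau>: "\<tau> \<ge> 0" "\<bar>\<tau> - t\<bar> \<le> M * sqrt (t / \<phi> t)"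
        then have "\<bar>\<tau> - t\<bar> \<le> t / 2" using elim(1) by (rule_tac order_trans)
        from abs_le_D2[OF this] have ge: "t / 2 \<le> \<tau>" by simp
        define u where "u s = 1 / sqrt (\<phi> s)" for s
        have u0: "u s > 0" for s using pos[of s] by (simp add: u_def)
        have du: "(u has_real_derivative - \<phi>' s / (2 * (\<phi> s * sqrt (\<phi> s)))) (at s)" if "s > 0" for s
          unfolding u_def using pos[of s]
          by (auto intro!: derivative_eq_intros der[OF that] simp: field_simps)
        have bound: "norm (- \<phi>' s / (2 * (\<phi> s * sqrt (\<phi> s)))) \<le> \<kappa> / sqrt t" if s: "s \<in> {t / 2..}" for s
        proof -
          have s0: "s > 0" "s \<ge> T" using s elim(2,3) by auto
          have p: "\<phi> s * sqrt (\<phi> s) > 0" using pos[of s] by simp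
          have "norm (- \<phi>' s / (2 * (\<phi> s * sqrt (\<phi> s)))) = \<bar>\<phi>' s\<bar> / (2 * (\<phi> s * sqrt (\<phi> s)))"
            using pos[of s] by (simp add: abs_mult)
          also have "\<dots> \<le> \<kappa> * (\<phi> s * sqrt (\<phi> s) / sqrt s) / (2 * (\<phi> s * sqrt (\<phi> s)))"
            using T[OF s0(2)] p by (intro divide_right_mono) auto
          also have "\<dots> = \<kappa> / (2 * sqrt s)" using pos[of s] by simp
          also have "\<dots> \<le> \<kappa> / (2 * sqrt (t / 4))"
            using s \<kappa> elim(3) s0 by (intro divide_left_mono mult_left_mono real_sqrt_le_mono) auto
          also have "\<dots> = \<kappa> / sqrt t" by (simp add: real_sqrt_divide)
          finally show ?thesis .
        qed
        have "norm (u \<tau> - u t) \<le> \<kappa> / sqrt t * norm (\<tau> - t)"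
        proof (rule field_differentiable_bound[where S = "{t / 2..}" and f' = "\<lambda>s. - \<phi>' s / (2 * (\<phi> s * sqrt (\<phi> s)))"])
          fix s assume s: "s \<in> {t / 2..}"
          then have "s > 0" using elim(3) by simp
          then show "(u has_real_derivative - \<phi>' s / (2 * (\<phi> s * sqrt (\<phi> s)))) (at s within {t / 2..})"
            by (rule has_field_derivative_at_within[OF du])
          show "norm (- \<phi>' s / (2 * (\<phi> s * sqrt (\<phi> s)))) \<le> \<kappa> / sqrt t" by (rule bound[OF s])
        qed (use ge elim(3) in auto)
        also have "\<dots> \<le> \<kappa> / sqrt t * (M * sqrt (t / \<phi> t))"
          using \<tau>(2) \<kappa> elim(3) by (intro mult_left_mono) auto
        also have "\<dots> = \<sigma> * u t" using M elim(3) by (simp add: \<kappa>_def u_def real_sqrt_divide)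
        finally have ut: "\<bar>u \<tau> - u t\<bar> \<le> \<sigma> * u t" by simp
        define q where "q = u \<tau> / u t"
        have q1: "\<bar>q - 1\<bar> \<le> \<sigma>"
        proof -
          have "q - 1 = (u \<tau> - u t) / u t" using u0[of t] by (simp add: q_def diff_divide_distrib)
          then show ?thesis using ut u0[of t] by (simp add: abs_divide pos_divide_le_eq)
        qed
        then have q2: "q \<ge> 3/4" "q \<le> 5/4" using \<sigma>(2) by (auto simp: abs_le_iff)
        have "q\<^sup>2 = \<phi> t / \<phi> \<tau>" using pos[of t] pos[of \<tau>] by (simp add: q_def u_def power_divide)
        then have eq: "\<phi> \<tau> * q\<^sup>2 = \<phi> t" using pos[of \<tau>] by simp
        have "\<bar>\<phi> \<tau> - \<phi> t\<bar> * q\<^sup>2 = \<phi> t * (\<bar>q - 1\<bar> * \<bar>1 + q\<bar>)"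
        proof -
          have "(\<phi> \<tau> - \<phi> t) * q\<^sup>2 = \<phi> \<tau> * q\<^sup>2 - \<phi> t * q\<^sup>2" by (rule left_diff_distrib)
          also have "\<dots> = - (\<phi> t * ((q - 1) * (1 + q)))" unfolding eq by (simp add: power2_eq_square algebra_simps)
          finally have "\<bar>(\<phi> \<tau> - \<phi> t) * q\<^sup>2\<bar> = \<bar>\<phi> t * ((q - 1) * (1 + q))\<bar>" by simp
          then show ?thesis using pos[of t] by (simp add: abs_mult)
        qed
        also have "\<dots> \<le> \<phi> t * (\<sigma> * (9/4))" using q1 q2 pos[of t] by (intro mult_left_mono mult_mono) auto
        also have "\<dots> = (4 * \<sigma>) * \<phi> t * (9/16)" by simp
        also have "\<dots> \<le> \<epsilon> * \<phi> t * q\<^sup>2"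
        proof (intro mult_mono)
          show "9 / 16 \<le> q\<^sup>2" using power_mono[OF q2(1), of 2] by (simp add: power2_eq_square)
        qed (use \<sigma> pos[of t] eps in auto)
        finally show "\<bar>\<phi> \<tau> - \<phi> t\<bar> \<le> \<epsilon> * \<phi> t" using q2 by simp
      qed
    qed
  qed
qed

section \<open>From the mean and variance to the metric\<close>

theorem theoremB:
  fixes \<Psi> \<Phi> :: "real \<Rightarrow> real" and \<eta> :: real
  assumes "log_growth \<Psi>"
    and "\<Phi> = (\<lambda>x. x * hderiv \<Psi> x)"
    and "\<eta> < 1 / 2"
    and "(\<lambda>t. hderiv (hderiv \<Phi>) t) \<in> O(\<lambda>t. t powr (- 1 / 2) * (hderiv \<Phi> t) powr (1 + \<eta>))"
  shows "\<exists>e :: complex ^ 'n \<Rightarrow> complex ^ 'n \<Rightarrow> real.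
           uniform_limit UNIV e (\<lambda>_. 0) at_infinity \<and>
           (\<forall>\<^sub>F z in at_infinity. \<forall>\<xi>.
              bergman_metric_sq \<Psi> z \<xi> =
                complex_of_real ((1 + e z \<xi>) *
                  ((norm \<xi>)\<^sup>2 * hderiv \<Psi> ((norm z)\<^sup>2) +
                   (cmod (herm z \<xi>))\<^sup>2 * hderiv (hderiv \<Psi>) ((norm z)\<^sup>2))))"
proof -
  define \<psi>0 where "\<psi>0 = hderiv \<Psi>"
  define \<psi>1 where "\<psi>1 = hderiv \<psi>0"
  define \<psi>2 where "\<psi>2 = hderiv \<psi>1"
  have d0: "(\<Psi> has_real_derivative \<psi>0 x) (at x within {0..})" if "x \<ge> 0" for x
    using assms(1) that hderiv_works unfolding \<psi>0_def log_growth_def by blast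
  have d1: "(\<psi>0 has_real_derivative \<psi>1 x) (at x within {0..})" if "x \<ge> 0" for x
    using assms(1) that hderiv_works unfolding \<psi>1_def \<psi>0_def log_growth_def by blast
  have d2: "(\<psi>1 has_real_derivative \<psi>2 x) (at x within {0..})" if "x \<ge> 0" for x
    using assms(1) that hderiv_works unfolding \<psi>2_def \<psi>1_def \<psi>0_def log_growth_def by blast
  have nn: "\<Psi> x \<ge> 0" "\<psi>0 x > 0" "\<psi>1 x \<ge> 0" "\<psi>2 x \<ge> 0" if "x \<ge> 0" for x
    using assms(1) that unfolding \<psi>2_def \<psi>1_def \<psi>0_def log_growth_def by blast+
  have mono_of_deriv: "f x \<le> f y"
    if "0 \<le> x" "x \<le> y" and der: "\<And>x. x \<ge> 0 \<Longrightarrow> (f has_real_derivative f' x) (at x within {0..})"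
      and nonneg: "\<And>x. x \<ge> 0 \<Longrightarrow> f' x \<ge> 0" for f f' :: "real \<Rightarrow> real" and x y
  proof -
    have "(\<lambda>x. if 0 \<le> x then f x else f 0 + f' 0 * x) x \<le> (\<lambda>x. if 0 \<le> x then f x else f 0 + f' 0 * x) y"
      using linear_extension_deriv[of f f', OF der] nonneg
      by (intro DERIV_nonneg_imp_nondecreasing[OF that(2)] exI conjI) auto
    then show ?thesis using that(1,2) by simp
  qed
  define c where "c = \<psi>0 0"
  have c: "c > 0" using nn(2)[of 0] by (simp add: c_def)
  have \<psi>0_ge: "c \<le> \<psi>0 x" if "x \<ge> 0" for x
    unfolding c_def by (rule mono_of_deriv[of 0 x \<psi>0 \<psi>1]) (use that d1 nn in auto)
  define \<phi>0 where "\<phi>0 x = \<psi>0 x + x * \<psi>1 x" for x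
  define \<phi>1 where "\<phi>1 x = 2 * \<psi>1 x + x * \<psi>2 x" for x
  have e1: "((\<lambda>x. x * \<psi>0 x) has_real_derivative \<phi>0 x) (at x within {0..})" if "x \<ge> 0" for x
    unfolding \<phi>0_def by (rule derivative_eq_intros d1[OF that] refl)+ simp
  have e2: "(\<phi>0 has_real_derivative \<phi>1 x) (at x within {0..})" if "x \<ge> 0" for x
    unfolding \<phi>0_def \<phi>1_def by (rule derivative_eq_intros d1[OF that] d2[OF that] refl)+ simp
  \<comment> \<open>The sign of \<Psi>''' is used here: it makes \<phi> = \<Phi>'
    nondecreasing.\<close>
  have \<phi>1_nn: "\<phi>1 x \<ge> 0" if "x \<ge> 0" for x using nn[OF that] that by (simp add: \<phi>1_def)
  have \<phi>0_mono: "\<phi>0 x \<le> \<phi>0 y" if "0 \<le> x" "x \<le> y" for x y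
    by (rule mono_of_deriv[OF that e2 \<phi>1_nn])
  have \<phi>0_ge: "c \<le> \<phi>0 x" if "x \<ge> 0" for x
    using \<psi>0_ge[OF that] nn(3)[OF that] that by (simp add: \<phi>0_def add_increasing2)
  have h\<Phi>: "hderiv \<Phi> x = \<phi>0 x" if "x \<ge> 0" for x
    unfolding assms(2) \<psi>0_def[symmetric] by (rule hderiv_eq[OF e1[OF that] that])
  have hh\<Phi>: "hderiv (hderiv \<Phi>) x = \<phi>1 x" if "x \<ge> 0" for x
  proof (rule hderiv_eq[OF _ that])
    show "(hderiv \<Phi> has_real_derivative \<phi>1 x) (at x within {0..})"
      using e2[OF that] unfolding has_field_derivative_def
      by (rule has_derivative_transform[rotated 2]) (use that h\<Phi> in auto)
  qed
  \<comment> \<open>Continuation by the tangent line at 0, with p, f and f' frozen at their values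
    at 0; all two-sided derivatives required by the locales then exist, and the bounds on [0,
    \<infinity>) persist.\<close>
  define P where "P x = (if 0 \<le> x then \<Psi> x else \<Psi> 0 + \<psi>0 0 * x)" for x
  define p where "p x = \<psi>0 (max 0 x)" for x
  define f where "f x = \<phi>0 (max 0 x)" for x
  define f' where "f' x = \<phi>1 (max 0 x)" for x
  have f_deriv: "(f has_real_derivative f' t) (at t)" if "t > 0" for t
  proof -
    have "at t within {0..} = at t" using that by (intro at_within_interior) (simp add: interior_real_atLeast)
    then have "(\<phi>0 has_real_derivative f' t) (at t)" using e2[of t] that by (simp add: f'_def)
    then show ?thesis
      by (rule has_field_derivative_transform_within_open[of _ _ _ "{0<..}"]) (use that in \<open>auto simp: f_def\<close>)
  qed
  have bigo: "f' \<in> O(\<lambda>t. t powr (- 1 / 2) * f t powr (1 + \<eta>))"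
  proof -
    have ev1: "\<forall>\<^sub>F t in at_top. hderiv (hderiv \<Phi>) t = f' t"
      using eventually_ge_at_top[of 0] by eventually_elim (simp add: hh\<Phi> f'_def)
    have ev2: "\<forall>\<^sub>F t in at_top. t powr (- 1 / 2) * (hderiv \<Phi> t) powr (1 + \<eta>) = t powr (- 1 / 2) * f t powr (1 + \<eta>)"
      using eventually_ge_at_top[of 0] by eventually_elim (simp add: h\<Phi> f_def)
    show ?thesis
      using assms(4) unfolding landau_o.big.in_cong[OF ev1] landau_o.big.cong[OF ev2] .
  qed
  interpret flat_weight P p c f
  proof
    show "(P has_real_derivative p x) (at x)" for x
      unfolding P_def p_def by (rule linear_extension_deriv[OF d0])
    have "continuous_on {0..} \<psi>0" using d1 by (intro DERIV_continuous_on) auto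
    then show "continuous_on UNIV p" unfolding p_def
      by (rule continuous_on_compose2) (auto intro!: continuous_intros)
    show "0 \<le> P 0" using nn(1)[of 0] by (simp add: P_def)
    have "((\<lambda>x. if 0 \<le> x then x * \<psi>0 x else 0 * \<psi>0 0 + \<phi>0 0 * x) has_real_derivative f x) (at x)" for x
      unfolding f_def by (rule linear_extension_deriv[of "\<lambda>x. x * \<psi>0 x" \<phi>0, OF e1])
    moreover have "(\<lambda>x. if 0 \<le> x then x * \<psi>0 x else 0 * \<psi>0 0 + \<phi>0 0 * x) = (\<lambda>x. x * p x)"
      by (auto simp: fun_eq_iff p_def \<phi>0_def)
    ultimately show "((\<lambda>x. x * p x) has_real_derivative f x) (at x)" for x by simp
    show "\<forall>\<^sub>F t in at_top. \<forall>\<tau>\<ge>0. \<bar>\<tau> - t\<bar> \<le> M * sqrt (t / f t) \<longrightarrow> \<bar>f \<tau> - f t\<bar> \<le> \<epsilon> * f t"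
      if "M > 0" "\<epsilon> > 0" for M \<epsilon>
      by (rule small_relative_variation[OF f_deriv c _ _ assms(3) bigo that])
        (auto simp: f_def \<phi>0_ge intro!: \<phi>0_mono)
  qed (auto simp: c p_def f_def \<psi>0_ge \<phi>0_ge)
  define \<nu> where "\<nu> = CARD('n) - 1"
  define A where "A z \<xi> = (norm \<xi>)\<^sup>2 * \<psi>0 ((norm z)\<^sup>2) + (cmod (herm z \<xi>))\<^sup>2 * \<psi>1 ((norm z)\<^sup>2)" for z \<xi> :: "complex^'n"
  define B where "B z \<xi> = (norm \<xi>)\<^sup>2 * lg' \<nu> ((norm z)\<^sup>2) + (cmod (herm z \<xi>))\<^sup>2 * lg'' \<nu> ((norm z)\<^sup>2)" for z \<xi> :: "complex^'n"
  have metric: "bergman_metric_sq \<Psi> z \<xi> = of_real (B z \<xi>)" for z \<xi> :: "complex^'n"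
  proof -
    \<comment> \<open>The measure sees \<Psi> only at squared norms, where the extension agrees with
      it, so measure, space and kernel are unchanged.\<close>
    have "fock_measure \<Psi> = (fock_measure P :: (complex^'n) measure)" by (simp add: fock_measure_def P_def)
    then have "fock_space \<Psi> = (fock_space P :: (complex^'n \<Rightarrow> complex) set)" by (simp add: fock_space_def)
    with \<open>fock_measure \<Psi> = fock_measure P\<close> have "fock_kernel \<Psi> = (fock_kernel P :: complex^'n \<Rightarrow> _)"
      by (simp add: fock_kernel_def is_reproducing_kernel_def)
    then have "bergman_metric_sq \<Psi> z \<xi> = bergman_metric_sq P z \<xi>" by (simp add: bergman_metric_sq_def)
    then show ?thesis unfolding bergman_metric_radial B_def \<nu>_def .
  qed
  have A_pos: "A z \<xi> > 0" if "\<xi> \<noteq> 0" for z \<xi>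
    unfolding A_def using nn(2,3)[of "(norm z)\<^sup>2"] that by (intro add_pos_nonneg mult_pos_pos) auto
  have close: "\<forall>\<^sub>F z in at_infinity. \<forall>\<xi>. \<bar>B z \<xi> - A z \<xi>\<bar> \<le> \<delta> * A z \<xi>" if \<delta>: "\<delta> > 0" for \<delta>
  proof -
    have lim: "filterlim (\<lambda>z::complex^'n. (norm z)\<^sup>2) at_top at_infinity"
      by (intro filterlim_pow_at_top filterlim_norm_at_top) simp
    have ev: "\<forall>\<^sub>F x in at_top. x > 0 \<and> \<bar>gen_mean \<nu> x - Phi x\<bar> \<le> \<delta> * Phi x \<and> \<bar>gen_var \<nu> x - x * f x\<bar> \<le> \<delta> * (x * f x)"
      using gen_mean_var_asymp[OF \<delta>, of \<nu>] eventually_gt_at_top[of 0] by eventually_elim auto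
    have "\<forall>\<^sub>F z::complex^'n in at_infinity. (norm z)\<^sup>2 > 0 \<and>
       \<bar>gen_mean \<nu> ((norm z)\<^sup>2) - Phi ((norm z)\<^sup>2)\<bar> \<le> \<delta> * Phi ((norm z)\<^sup>2) \<and>
       \<bar>gen_var \<nu> ((norm z)\<^sup>2) - (norm z)\<^sup>2 * f ((norm z)\<^sup>2)\<bar> \<le> \<delta> * ((norm z)\<^sup>2 * f ((norm z)\<^sup>2))"
      using eventually_compose_filterlim[OF ev lim] by simp
    then show ?thesis
    proof eventually_elim
      case (elim z)
      define x where "x = (norm z)\<^sup>2"
      have x: "x > 0" "x \<ge> 0" using elim by (auto simp: x_def)
      have v1: "\<bar>lg' \<nu> x - \<psi>0 x\<bar> \<le> \<delta> * \<psi>0 x"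
      proof -
        have "\<bar>x * (lg' \<nu> x - \<psi>0 x)\<bar> \<le> x * (\<delta> * \<psi>0 x)"
          using elim x unfolding x_def[symmetric] by (simp add: gen_mean_lg Phi_def p_def algebra_simps)
        then show ?thesis using x by (simp add: abs_mult)
      qed
      have v2: "\<bar>(lg' \<nu> x + x * lg'' \<nu> x) - \<phi>0 x\<bar> \<le> \<delta> * \<phi>0 x"
      proof -
        have "\<bar>x * ((lg' \<nu> x + x * lg'' \<nu> x) - \<phi>0 x)\<bar> \<le> x * (\<delta> * \<phi>0 x)"
          using elim x unfolding x_def[symmetric] gen_var_lg[OF x(2)] right_diff_distrib by (simp add: f_def mult_ac)
        then show ?thesis using x by (simp add: abs_mult)
      qed
      show ?case
      proof
        fix \<xi> :: "complex^'n"
        \<comment> \<open>h and r are the squared lengths of the components of \<xi> along and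
          orthogonal to z. In these coordinates both forms have nonnegative weights r and h, with
          coefficients that are relatively close, so the relative error passes to the sum. L'' is
          not compared with \<Psi>'' directly, as the latter may vanish.\<close>
        define h where "h = (cmod (herm z \<xi>))\<^sup>2 / x"
        define r where "r = (norm \<xi>)\<^sup>2 - h"
        have h0: "h \<ge> 0" using x by (simp add: h_def)
        have "(cmod (herm z \<xi>))\<^sup>2 \<le> (norm z * norm \<xi>)\<^sup>2" by (intro power_mono cmod_herm_le) simp
        then have r0: "r \<ge> 0" using x by (simp add: r_def h_def x_def power_mult_distrib field_simps)
        have hx: "(cmod (herm z \<xi>))\<^sup>2 = h * x" using x by (simp add: h_def)
        have nx: "(norm \<xi>)\<^sup>2 = r + h" by (simp add: r_def)
        have A: "A z \<xi> = r * \<psi>0 x + h * \<phi>0 x" unfolding A_def x_def[symmetric] hx nx \<phi>0_def by (simp add: algebra_simps)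
        have B: "B z \<xi> = r * lg' \<nu> x + h * (lg' \<nu> x + x * lg'' \<nu> x)" unfolding B_def x_def[symmetric] hx nx by (simp add: algebra_simps)
        have "B z \<xi> - A z \<xi> = r * (lg' \<nu> x - \<psi>0 x) + h * ((lg' \<nu> x + x * lg'' \<nu> x) - \<phi>0 x)"
          unfolding A B by (simp add: algebra_simps)
        then have "\<bar>B z \<xi> - A z \<xi>\<bar> \<le> \<bar>r * (lg' \<nu> x - \<psi>0 x)\<bar> + \<bar>h * ((lg' \<nu> x + x * lg'' \<nu> x) - \<phi>0 x)\<bar>"
          by (simp only: abs_triangle_ineq)
        also have "\<dots> = r * \<bar>lg' \<nu> x - \<psi>0 x\<bar> + h * \<bar>(lg' \<nu> x + x * lg'' \<nu> x) - \<phi>0 x\<bar>"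
          using r0 h0 by (simp only: abs_mult abs_of_nonneg)
        also have "\<dots> \<le> r * (\<delta> * \<psi>0 x) + h * (\<delta> * \<phi>0 x)"
          using v1 v2 r0 h0 by (intro add_mono mult_left_mono) auto
        also have "\<dots> = \<delta> * A z \<xi>" unfolding A by (simp add: algebra_simps)
        finally show "\<bar>B z \<xi> - A z \<xi>\<bar> \<le> \<delta> * A z \<xi>" .
      qed
    qed
  qed
  \<comment> \<open>For \<xi> = 0 both forms vanish and the quotient is meaningless; the value 0
    keeps the identity true and the bound uniform.\<close>
  define e where "e z \<xi> = (if \<xi> = 0 then 0 else B z \<xi> / A z \<xi> - 1)" for z \<xi> :: "complex^'n"
  have eq: "B z \<xi> = (1 + e z \<xi>) * A z \<xi>" for z \<xi>
  proof (cases "\<xi> = 0")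
    case True
    then show ?thesis by (simp add: A_def B_def herm_def)
  next
    case False
    then show ?thesis using A_pos[OF False, of z] by (simp add: e_def)
  qed
  have "uniform_limit UNIV e (\<lambda>_. 0) at_infinity"
    unfolding uniform_limit_iff
  proof (intro allI impI)
    fix \<delta> :: real assume "\<delta> > 0"
    then have "\<forall>\<^sub>F z in at_infinity. \<forall>\<xi>. \<bar>B z \<xi> - A z \<xi>\<bar> \<le> \<delta> / 2 * A z \<xi>" by (intro close) simp
    then show "\<forall>\<^sub>F z in at_infinity. \<forall>\<xi>\<in>UNIV. dist (e z \<xi>) 0 < \<delta>"
    proof eventually_elim
      case (elim z)
      have "\<bar>e z \<xi>\<bar> < \<delta>" for \<xi>
      proof (cases "\<xi> = 0")
        case False
        have "e z \<xi> = (B z \<xi> - A z \<xi>) / A z \<xi>" using A_pos[OF False, of z] False by (simp add: e_def diff_divide_distrib)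
        then have "\<bar>e z \<xi>\<bar> \<le> \<delta> / 2" using elim A_pos[OF False, of z] by (simp add: abs_divide pos_divide_le_eq)
        then show ?thesis using \<open>\<delta> > 0\<close> by simp
      qed (use \<open>\<delta> > 0\<close> in \<open>simp add: e_def\<close>)
      then show ?case by simp
    qed
  qed
  moreover have "bergman_metric_sq \<Psi> z \<xi> = complex_of_real ((1 + e z \<xi>) * ((norm \<xi>)\<^sup>2 * hderiv \<Psi> ((norm z)\<^sup>2) +
      (cmod (herm z \<xi>))\<^sup>2 * hderiv (hderiv \<Psi>) ((norm z)\<^sup>2)))" for z \<xi> :: "complex^'n"
    unfolding metric eq A_def \<psi>1_def \<psi>0_def ..
  ultimately show ?thesis by (intro exI[of _ e]) simp
qed

end
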